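(* There exist $2^{\aleph_1}$ differential structures on $\mathbb L_+^2$, pairwise non-diffeomorphic, each of which is exotic, i.e. not diffeomorphic to $(\mathbb L_+,\mathcal D)\times(\mathbb L_+,\mathcal E)$ for any differential structures $\mathcal D,\mathcal E$ on $\mathbb L_+$.
   Context: $\omega_1$ denotes the set of countable ordinals. The closed long ray $\mathbb L_{\ge0}$ is $\omega_1\times[0,1)$ with the lexicographic order topology, and the long ray is $\mathbb L_+=\mathbb L_{\ge0}\setminus\{(0,0)\}$. A "differential structure" means a $C^r$ differential structure for some $r\ge1$. *)

theory Defs
  imports "HOL-Analysis.Analysis" "HOL-Library.Equipollence" "HOL-Library.Extended_Nat"
begin

text \<open>C^0 = continuous; C^(k+1) = differentiable with all directional derivatives
  x \<mapsto> Df(x)v of class C^k (in finite dimensions this is the usual C^(k+1)).\<close>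
fun Ck_on :: "nat \<Rightarrow> 'a::real_normed_vector set \<Rightarrow> ('a \<Rightarrow> 'b::real_normed_vector) \<Rightarrow> bool" where
  "Ck_on 0 S f = continuous_on S f"
| "Ck_on (Suc k) S f =
     ((\<forall>x\<in>S. f differentiable (at x)) \<and>
      (\<forall>v. Ck_on k S (\<lambda>x. frechet_derivative f (at x) v)))"

definition Cr_on :: "enat \<Rightarrow> 'a::real_normed_vector set \<Rightarrow> ('a \<Rightarrow> 'b::real_normed_vector) \<Rightarrow> bool" where
  "Cr_on r S f = (\<forall>k::nat. enat k \<le> r \<longrightarrow> Ck_on k S f)"

type_synonym ('x, 'e) chart = "'x set \<times> ('x \<Rightarrow> 'e)"

definition is_chart :: "'x topology \<Rightarrow> ('x, 'e::euclidean_space) chart \<Rightarrow> bool" where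
  "is_chart X c \<longleftrightarrow> openin X (fst c) \<and> open (snd c ` fst c) \<and>
     homeomorphic_map (subtopology X (fst c)) (top_of_set (snd c ` fst c)) (snd c)"

definition compatible :: "enat \<Rightarrow> ('x, 'e::euclidean_space) chart \<Rightarrow> ('x, 'e) chart \<Rightarrow> bool" where
  "compatible r c d \<longleftrightarrow>
     (case c of (U, \<phi>) \<Rightarrow> case d of (V, \<psi>) \<Rightarrow>
        Cr_on r (\<phi> ` (U \<inter> V)) (\<psi> \<circ> inv_into U \<phi>) \<and>
        Cr_on r (\<psi> ` (U \<inter> V)) (\<phi> \<circ> inv_into V \<psi>))"

definition atlas :: "enat \<Rightarrow> 'x topology \<Rightarrow> ('x, 'e::euclidean_space) chart set \<Rightarrow> bool" where
  "atlas r X A \<longleftrightarrow> (\<forall>c\<in>A. is_chart X c) \<and> \<Union> (fst ` A) = topspace X \<and>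
     (\<forall>c\<in>A. \<forall>d\<in>A. compatible r c d)"

definition diff_structure :: "enat \<Rightarrow> 'x topology \<Rightarrow> ('x, 'e::euclidean_space) chart set \<Rightarrow> bool" where
  "diff_structure r X A \<longleftrightarrow> atlas r X A \<and>
     (\<forall>c. is_chart X c \<and> (\<forall>d\<in>A. compatible r c d) \<longrightarrow> c \<in> A)"

definition smooth_map :: "enat \<Rightarrow> ('x, 'e::euclidean_space) chart set \<Rightarrow> ('y, 'f::euclidean_space) chart set
    \<Rightarrow> ('x \<Rightarrow> 'y) \<Rightarrow> bool" where
  "smooth_map r A B f \<longleftrightarrow>
     (\<forall>U \<phi> V \<psi>. (U, \<phi>) \<in> A \<and> (V, \<psi>) \<in> B \<longrightarrow>
        Cr_on r (\<phi> ` (U \<inter> f -` V)) (\<psi> \<circ> f \<circ> inv_into U \<phi>))"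

definition diffeomorphic :: "enat \<Rightarrow> 'x topology \<Rightarrow> ('x, 'e::euclidean_space) chart set
    \<Rightarrow> 'y topology \<Rightarrow> ('y, 'f::euclidean_space) chart set \<Rightarrow> bool" where
  "diffeomorphic r X A Y B \<longleftrightarrow>
     (\<exists>f g. homeomorphic_maps X Y f g \<and> smooth_map r A B f \<and> smooth_map r B A g)"

text \<open>Product atlas (generates the product differential structure).\<close>
definition prod_atlas :: "('x, 'e) chart set \<Rightarrow> ('y, 'f) chart set \<Rightarrow> ('x \<times> 'y, 'e \<times> 'f) chart set" where
  "prod_atlas A B = {(U \<times> V, \<lambda>(x, y). (\<phi> x, \<psi> y)) | U \<phi> V \<psi>. (U, \<phi>) \<in> A \<and> (V, \<psi>) \<in> B}"

definition omega1 :: "nat set rel" where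
  "omega1 = cardSuc (card_of (UNIV :: nat set))"

type_synonym lpoint = "nat set \<times> real"

definition lr_less :: "lpoint \<Rightarrow> lpoint \<Rightarrow> bool" where
  "lr_less p q \<longleftrightarrow> ((fst p, fst q) \<in> omega1 \<and> fst p \<noteq> fst q) \<or> (fst p = fst q \<and> snd p < snd q)"

definition order_topology_on :: "'a set \<Rightarrow> ('a \<Rightarrow> 'a \<Rightarrow> bool) \<Rightarrow> 'a topology" where
  "order_topology_on C lt = topology_generated_by
     ({C} \<union> {{x \<in> C. lt a x} | a. a \<in> C} \<union> {{x \<in> C. lt x a} | a. a \<in> C})"

definition closed_long_ray_set :: "lpoint set" where
  "closed_long_ray_set = Field omega1 \<times> {0..<1}"

definition closed_long_ray :: "lpoint topology" where
  "closed_long_ray = order_topology_on closed_long_ray_set lr_less"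

definition long_ray_set :: "lpoint set" where
  "long_ray_set = {p \<in> closed_long_ray_set. \<exists>q \<in> closed_long_ray_set. lr_less q p}"

definition long_ray :: "lpoint topology" where
  "long_ray = subtopology closed_long_ray long_ray_set"

definition long_ray_sq :: "(lpoint \<times> lpoint) topology" where
  "long_ray_sq = prod_topology long_ray long_ray"

end

theory Submission
  imports Defs "HOL-Homology.Invariance_of_Domain" "HOL-Library.Countable_Set_Type"
begin

text \<open>Write \<open>x\<close> and \<open>y\<close> for the two coordinates. For every countable ordinal \<open>a\<close> we choose positive
  summable weights \<open>m a g\<close> on the ordinals \<open>g < a\<close>, any two choices differing at only finitely many
  places. Summing them over the unit blocks of the long ray gives a coordinate \<open>phi m a\<close> (with
  block lengths \<open>(m a g)\<^sup>2\<close>) and a continuous function \<open>kap m a\<close> (with increments \<open>m a g\<close>); a change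
  of \<open>a\<close> changes both by smooth functions, although \<open>kap\<close> is not differentiable with respect to
  \<open>phi\<close> at limit ordinals. The charts \<open>(x, y) \<mapsto> (phi x, flow (kap x) (phi y))\<close>, where \<open>flow\<close> is a smooth
  flow moving only the first block of the second factor, form an atlas: the nonsmooth \<open>kap\<close>
  cancels in all transition maps because the flow is a one-parameter group.

  A homeomorphism of the square of the long ray fixes, up to interchanging the factors, the lines
  \<open>{a} \<times> block\<close> for many limits \<open>a\<close>, and maps the points \<open>(a, y0)\<close> to points whose other coordinate is
  eventually constant. Near \<open>(a, y0)\<close> the points \<open>(b, y0)\<close> with \<open>b\<close> below \<open>a\<close> approach in the direction of the
  vertical line through \<open>(a, y0)\<close>, which is impossible in a product structure. Moreover the tails
  \<open>kap a - kap b\<close> are determined by the structure up to a nonzero factor. Confining them to windows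
  around \<open>theta n\<close> with \<open>n\<close> in a set coding \<open>A \<inter> a\<close>, with almost disjoint codes for distinct sets, makes
  the structures belonging to distinct \<open>A\<close> non-diffeomorphic.\<close>

subsection \<open>Calculus of \<open>C\<^sup>k\<close> maps\<close>

text \<open>No positive weight on all countable ordinals is summable, so weights can only be chosen
  for each bound \<open>a\<close> separately. Agreement up to finitely many places is what survives,
  and a finite change alters the coordinates only by finitely many smooth modifications. Block
  lengths are squares of the increments so that near a limit the distance in \<open>phi\<close> is
  at most the square of the tail of \<open>kap\<close>; this makes the graph of \<open>kap\<close>
  vertical there. The flow is confined to the first block, where all coordinate changes of the
  second factor are the identity and hence commute with it. A homeomorphism is under control only on
  a closed unbounded set of \<open>a\<close>, so a single bit stored at each \<open>a\<close> could
  be missed; therefore every limit \<open>a\<close> stores all of \<open>A \<inter> a\<close>, and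
  one large \<open>a\<close> of the controlled kind suffices. Derivatives determine the tails only
  up to a factor, so the ratios of distinct values \<open>theta n\<close> must leave every bounded
  range; this is why the exponent in \<open>theta\<close> grows quadratically.\<close>

lemma frechet_derivative_eqI:
  "(f has_derivative f') (at x) \<Longrightarrow> frechet_derivative f (at x) = f'"
  using frechet_derivative_at by fastforce

lemma differentiable_frechet:
  "f differentiable (at x) \<Longrightarrow> (f has_derivative frechet_derivative f (at x)) (at x)"
  by (simp add: frechet_derivative_works)

text \<open>\<open>frechet_derivative\<close> at a point of \<open>S\<close> depends on a full
  neighbourhood, so openness is what lets agreement on \<open>S\<close> pass to the
  derivatives.\<close>

lemma Ck_on_cong:
  assumes "open S" "\<And>x. x \<in> S \<Longrightarrow> f x = g x" "Ck_on k S f"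
  shows "Ck_on k S g"
  using assms(2,3)
proof (induction k arbitrary: f g)
  case 0
  then show ?case by (auto cong: continuous_on_cong)
next
  case (Suc k)
  have d: "f differentiable (at x)" if "x \<in> S" for x
    using Suc.prems that by auto
  have "(g has_derivative frechet_derivative f (at x)) (at x)" if "x \<in> S" for x
    using has_derivative_transform_within_open[OF differentiable_frechet[OF d[OF that]] assms(1) that]
      Suc.prems(1) by auto
  then have "g differentiable (at x)" "frechet_derivative g (at x) = frechet_derivative f (at x)"
    if "x \<in> S" for x
    using that by (auto intro: differentiableI frechet_derivative_eqI)
  moreover have "Ck_on k S (\<lambda>x. frechet_derivative g (at x) v)" for v
    by (rule Suc.IH[of "\<lambda>x. frechet_derivative f (at x) v"]) (use Suc.prems(2) calculation in auto)
  ultimately show ?case by simp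
qed

lemma Ck_on_subset: "Ck_on k S f \<Longrightarrow> T \<subseteq> S \<Longrightarrow> Ck_on k T f"
  by (induction k arbitrary: f) (auto intro: continuous_on_subset)

lemma Ck_on_local:
  assumes "\<And>x. x \<in> S \<Longrightarrow> \<exists>T. open T \<and> x \<in> T \<and> Ck_on k T f"
  shows "Ck_on k S f"
  using assms
proof (induction k arbitrary: f)
  case 0
  then show ?case
    by (auto intro!: continuous_at_imp_continuous_on) (metis continuous_on_eq_continuous_at)
next
  case (Suc k)
  then have "\<forall>x\<in>S. f differentiable (at x)" by fastforce
  moreover have "Ck_on k S (\<lambda>x. frechet_derivative f (at x) v)" for v
    by (rule Suc.IH) (use Suc.prems in fastforce)
  ultimately show ?case by simp
qed

lemma Ck_on_SucI:
  assumes "open S" "\<And>x. x \<in> S \<Longrightarrow> (f has_derivative f' x) (at x)" "\<And>v. Ck_on k S (\<lambda>x. f' x v)"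
  shows "Ck_on (Suc k) S f"
proof -
  have "Ck_on k S (\<lambda>x. frechet_derivative f (at x) v)" for v
    by (rule Ck_on_cong[OF assms(1) _ assms(3)[of v]]) (simp add: frechet_derivative_eqI[OF assms(2)])
  with assms(2) show ?thesis by (auto intro: differentiableI)
qed

text \<open>The recursion of \<open>Ck_on\<close> records only differentiability and the directional
  derivatives, so lowering the order rests on the base case that differentiability implies
  continuity.\<close>

lemma Ck_on_SucD: "Ck_on (Suc k) S f \<Longrightarrow> Ck_on k S f"
proof (induction k arbitrary: f)
  case 0
  then show ?case
    by (auto intro!: continuous_at_imp_continuous_on differentiable_imp_continuous_within)
next
  case (Suc k)
  have "Ck_on k S (\<lambda>x. frechet_derivative f (at x) v)" for v
    by (rule Suc.IH) (use Suc.prems in auto)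
  with Suc.prems show ?case by simp
qed

lemma Ck_on_const: "Ck_on k S (\<lambda>x. c)"
proof (rule Ck_on_subset[OF _ subset_UNIV], induction k arbitrary: c)
  case (Suc k)
  show ?case
    by (rule Ck_on_SucI[where f' = "\<lambda>_ _. 0"]) (use Suc in \<open>auto intro: derivative_eq_intros\<close>)
qed simp

lemma Ck_on_linear: "bounded_linear f \<Longrightarrow> Ck_on k S f"
proof (cases k)
  case (Suc j)
  assume f: "bounded_linear f"
  have "Ck_on (Suc j) UNIV f"
    by (rule Ck_on_SucI[where f' = "\<lambda>_. f"]) (use f in \<open>auto intro: bounded_linear_imp_has_derivative Ck_on_const\<close>)
  then show ?thesis using Ck_on_subset Suc by blast
qed (simp add: linear_continuous_on)

lemma Ck_on_bounded_linear:
  assumes "open S" "bounded_linear h" "Ck_on k S f"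
  shows "Ck_on k S (\<lambda>x. h (f x))"
  using assms(3)
proof (induction k arbitrary: f)
  case 0
  then show ?case using assms(2) by (auto intro: bounded_linear.continuous_on)
next
  case (Suc k)
  show ?case
    by (rule Ck_on_SucI[where f' = "\<lambda>x v. h (frechet_derivative f (at x) v)", OF assms(1)])
      (use Suc in \<open>auto intro!: bounded_linear.has_derivative[OF assms(2) differentiable_frechet]\<close>)
qed

lemma Ck_on_add:
  assumes "open S" "Ck_on k S f" "Ck_on k S g"
  shows "Ck_on k S (\<lambda>x. f x + g x)"
  using assms(2,3)
proof (induction k arbitrary: f g)
  case 0
  then show ?case by (auto intro: continuous_intros)
next
  case (Suc k)
  show ?case
    by (rule Ck_on_SucI[OF assms(1),
          where f' = "\<lambda>x v. frechet_derivative f (at x) v + frechet_derivative g (at x) v"])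
      (use Suc in \<open>auto intro!: has_derivative_add[OF differentiable_frechet differentiable_frechet]\<close>)
qed

lemma Ck_on_bilinear:
  assumes "open S" "bounded_bilinear bp" "Ck_on k S f" "Ck_on k S g"
  shows "Ck_on k S (\<lambda>x. bp (f x) (g x))"
  using assms(3,4)
proof (induction k arbitrary: f g)
  case 0
  then show ?case using bounded_bilinear.continuous_on[OF assms(2)] by auto
next
  case (Suc k)
  show ?case
  proof (rule Ck_on_SucI[OF assms(1), where f' = "\<lambda>x v. bp (f x) (frechet_derivative g (at x) v)
        + bp (frechet_derivative f (at x) v) (g x)"])
    show "((\<lambda>x. bp (f x) (g x)) has_derivative
       (\<lambda>v. bp (f x) (frechet_derivative g (at x) v) + bp (frechet_derivative f (at x) v) (g x))) (at x)"
      if "x \<in> S" for x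
      by (rule bounded_bilinear.FDERIV[OF assms(2)]) (use Suc.prems that in \<open>auto intro: differentiable_frechet\<close>)
    show "Ck_on k S (\<lambda>x. bp (f x) (frechet_derivative g (at x) v) + bp (frechet_derivative f (at x) v) (g x))" for v
      by (intro Ck_on_add[OF assms(1)] Suc.IH) (use Suc.prems Ck_on_SucD in \<open>auto\<close>)
  qed
qed

lemma Ck_on_sum:
  assumes "open S" "finite I" "\<And>i. i \<in> I \<Longrightarrow> Ck_on k S (f i)"
  shows "Ck_on k S (\<lambda>x. \<Sum>i\<in>I. f i x)"
  using assms(2,3) by (induction I rule: finite_induct) (auto intro: Ck_on_const Ck_on_add[OF assms(1)])

text \<open>The chain rule applies the derivative of \<open>g\<close> to a moving direction.
  Expanding this direction in the basis of the intermediate space leaves finitely many derivatives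
  in fixed directions, which is what \<open>Ck_on\<close> controls.\<close>

lemma Ck_on_compose:
  fixes f :: "'a::real_normed_vector \<Rightarrow> 'b::euclidean_space" and g :: "'b \<Rightarrow> 'c::real_normed_vector"
  assumes "open S" "open T" "Ck_on k S f" "Ck_on k T g" "f ` S \<subseteq> T"
  shows "Ck_on k S (\<lambda>x. g (f x))"
  using assms(3-5)
proof (induction k arbitrary: g f)
  case 0
  then show ?case by (auto intro: continuous_on_compose2)
next
  case (Suc k)
  let ?Df = "\<lambda>x. frechet_derivative f (at x)" and ?Dg = "\<lambda>x. frechet_derivative g (at x)"
  have Df: "(f has_derivative ?Df x) (at x)" if "x \<in> S" for x
    using Suc.prems that by (auto intro: differentiable_frechet)
  have Dg: "(g has_derivative ?Dg (f x)) (at (f x))" if "x \<in> S" for x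
    using Suc.prems that by (auto intro!: differentiable_frechet)
  show ?case
  proof (rule Ck_on_SucI[OF assms(1), where f' = "\<lambda>x v. \<Sum>b\<in>Basis. (?Df x v \<bullet> b) *\<^sub>R ?Dg (f x) b"])
    fix x assume x: "x \<in> S"
    have lin: "linear (?Dg (f x))" using Dg[OF x] has_derivative_linear by blast
    have "?Dg (f x) (?Df x v) = (\<Sum>b\<in>Basis. (?Df x v \<bullet> b) *\<^sub>R ?Dg (f x) b)" for v
    proof -
      have "?Dg (f x) (?Df x v) = ?Dg (f x) (\<Sum>b\<in>Basis. (?Df x v \<bullet> b) *\<^sub>R b)"
        by (simp add: euclidean_representation)
      also have "\<dots> = (\<Sum>b\<in>Basis. (?Df x v \<bullet> b) *\<^sub>R ?Dg (f x) b)"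
        by (simp only: linear_sum[OF lin] linear_scale[OF lin])
      finally show ?thesis .
    qed
    then show "((\<lambda>x. g (f x)) has_derivative (\<lambda>v. \<Sum>b\<in>Basis. (?Df x v \<bullet> b) *\<^sub>R ?Dg (f x) b)) (at x)"
      using has_derivative_compose[OF Df[OF x] Dg[OF x]] by simp
  next
    fix v
    show "Ck_on k S (\<lambda>x. \<Sum>b\<in>Basis. (?Df x v \<bullet> b) *\<^sub>R ?Dg (f x) b)"
    proof (intro Ck_on_sum Ck_on_bilinear[OF assms(1) bounded_bilinear_scaleR] assms(1) finite_Basis)
      fix b :: 'b
      show "Ck_on k S (\<lambda>x. ?Df x v \<bullet> b)"
        by (intro Ck_on_bounded_linear[OF assms(1), of "\<lambda>y. y \<bullet> b"] bounded_linear_inner_left)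
          (use Suc.prems in auto)
      show "Ck_on k S (\<lambda>x. ?Dg (f x) b)"
        by (rule Suc.IH[OF Ck_on_SucD[OF Suc.prems(1)]]) (use Suc.prems in auto)
    qed
  qed
qed

definition smooth_on :: "'a::real_normed_vector set \<Rightarrow> ('a \<Rightarrow> 'b::real_normed_vector) \<Rightarrow> bool" where
  "smooth_on S f \<longleftrightarrow> (\<forall>k. Ck_on k S f)"

lemma smooth_on_const: "smooth_on S (\<lambda>x. c)"
  and smooth_on_linear: "bounded_linear h \<Longrightarrow> smooth_on S h"
  and smooth_on_add: "open S \<Longrightarrow> smooth_on S f \<Longrightarrow> smooth_on S g \<Longrightarrow> smooth_on S (\<lambda>x. f x + g x)"
  unfolding smooth_on_def by (auto intro: Ck_on_const Ck_on_linear Ck_on_add)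

lemma smooth_on_mult:
  fixes f :: "'a::real_normed_vector \<Rightarrow> real"
  shows "open S \<Longrightarrow> smooth_on S f \<Longrightarrow> smooth_on S g \<Longrightarrow> smooth_on S (\<lambda>x. f x * g x)"
  unfolding smooth_on_def using Ck_on_bilinear[OF _ bounded_bilinear_mult] by blast

lemma smooth_on_compose:
  fixes f :: "'a::real_normed_vector \<Rightarrow> 'b::euclidean_space"
  shows "smooth_on T g \<Longrightarrow> open T \<Longrightarrow> open S \<Longrightarrow> smooth_on S f \<Longrightarrow> (\<And>x. x \<in> S \<Longrightarrow> f x \<in> T) \<Longrightarrow> smooth_on S (\<lambda>x. g (f x))"
  unfolding smooth_on_def by (blast intro: Ck_on_compose)

lemma smooth_on_compose_UNIV:
  fixes f :: "'a::real_normed_vector \<Rightarrow> 'b::euclidean_space"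
  shows "smooth_on UNIV g \<Longrightarrow> open S \<Longrightarrow> smooth_on S f \<Longrightarrow> smooth_on S (\<lambda>x. g (f x))"
  by (rule smooth_on_compose[of UNIV]) auto

lemma smooth_on_minus: "open S \<Longrightarrow> smooth_on S f \<Longrightarrow> smooth_on S (\<lambda>x. - f x)"
  unfolding smooth_on_def using Ck_on_bounded_linear[OF _ bounded_linear_minus[OF bounded_linear_ident]] by blast

lemma smooth_on_diff: "open S \<Longrightarrow> smooth_on S f \<Longrightarrow> smooth_on S g \<Longrightarrow> smooth_on S (\<lambda>x. f x - g x)"
  using smooth_on_add[of S f "\<lambda>x. - g x"] smooth_on_minus[of S g] by simp

lemma smooth_on_sum:
  "open S \<Longrightarrow> finite I \<Longrightarrow> (\<And>i. i \<in> I \<Longrightarrow> smooth_on S (f i)) \<Longrightarrow> smooth_on S (\<lambda>x. \<Sum>i\<in>I. f i x)"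
  unfolding smooth_on_def by (blast intro: Ck_on_sum)

lemma smooth_on_fst: "smooth_on S (fst :: 'a::real_normed_vector \<times> 'b::real_normed_vector \<Rightarrow> 'a)"
  and smooth_on_snd: "smooth_on S (snd :: 'a \<times> 'b \<Rightarrow> 'b)"
  and smooth_on_id: "smooth_on S' (\<lambda>x::'a. x)"
  by (auto intro: smooth_on_linear bounded_linear_fst bounded_linear_snd bounded_linear_ident)

lemma smooth_on_Pair:
  assumes "open S" "smooth_on S f" "smooth_on S g"
  shows "smooth_on S (\<lambda>x. (f x, g x))"
proof -
  have 1: "bounded_linear (\<lambda>y::'b. (y, 0::'c))" and 2: "bounded_linear (\<lambda>y::'c. (0::'b, y))"
    by (rule bounded_linear_Pair[OF bounded_linear_ident bounded_linear_zero] bounded_linear_Pair[OF bounded_linear_zero bounded_linear_ident])+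
  have "smooth_on S (\<lambda>x. (f x, 0::'c) + (0::'b, g x))"
    using assms Ck_on_bounded_linear[OF assms(1) 1] Ck_on_bounded_linear[OF assms(1) 2]
    by (intro smooth_on_add) (auto simp: smooth_on_def)
  then show ?thesis by simp
qed

lemma Ck_on_Suc_realI:
  fixes f :: "real \<Rightarrow> real"
  assumes "open S" "\<And>x. x \<in> S \<Longrightarrow> (f has_real_derivative f' x) (at x)" "Ck_on k S f'"
  shows "Ck_on (Suc k) S f"
  by (rule Ck_on_SucI[OF assms(1), where f' = "\<lambda>x v. f' x * v"])
    (use assms in \<open>auto simp: has_field_derivative_def intro!: Ck_on_bilinear[OF _ bounded_bilinear_mult] Ck_on_const\<close>)

lemma Ck_on_continuous_on: "Ck_on k S f \<Longrightarrow> continuous_on S f"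
  by (induction k) (use Ck_on_SucD in auto)

lemma Ck_on_deriv:
  fixes f :: "real \<Rightarrow> real"
  assumes "open S" "Ck_on (Suc k) S f"
  shows "Ck_on k S (deriv f)"
proof -
  have "frechet_derivative f (at x) 1 = deriv f x" if "x \<in> S" for x
  proof -
    have "f differentiable (at x)" using assms that by auto
    then obtain D where D: "(f has_real_derivative D) (at x)" using real_differentiable_def by blast
    then have "frechet_derivative f (at x) = (*) D"
      by (intro frechet_derivative_eqI) (simp add: has_field_derivative_def)
    then show ?thesis using DERIV_imp_deriv[OF D] by simp
  qed
  moreover have "Ck_on k S (\<lambda>x. frechet_derivative f (at x) 1)" using assms(2) by simp
  ultimately show ?thesis by (rule Ck_on_cong[OF assms(1), of "\<lambda>x. frechet_derivative f (at x) 1"])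
qed

lemma smooth_on_real_has_deriv:
  fixes f :: "real \<Rightarrow> real"
  assumes "smooth_on S f" "x \<in> S"
  shows "(f has_real_derivative deriv f x) (at x)"
proof -
  have "Ck_on 1 S f" using assms(1) by (simp add: smooth_on_def)
  then have "f differentiable (at x)" using assms(2) by simp
  then show ?thesis by (metis DERIV_imp_deriv real_differentiable_def)
qed

section \<open>Smoothness of reciprocals, logarithms and inverse functions\<close>

lemma smooth_on_inverse: "smooth_on (- {0}) (inverse :: real \<Rightarrow> real)"
proof -
  have "Ck_on k (- {0}) (inverse :: real \<Rightarrow> real)" for k
  proof (induction k)
    case (Suc k)
    have "Ck_on k (- {0::real}) (\<lambda>x. - (inverse x * inverse x))"
      by (intro Ck_on_bounded_linear[OF _ bounded_linear_minus[OF bounded_linear_ident]]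
          Ck_on_bilinear[OF _ bounded_bilinear_mult] Suc) auto
    then show ?case
      by (intro Ck_on_Suc_realI[where f' = "\<lambda>x. - (inverse x * inverse x)"])
        (auto intro!: derivative_eq_intros)
  qed (auto intro: continuous_intros)
  then show ?thesis unfolding smooth_on_def by blast
qed

lemma smooth_on_divide:
  fixes f g :: "'a::real_normed_vector \<Rightarrow> real"
  assumes "open S" "smooth_on S f" "smooth_on S g" "\<And>x. x \<in> S \<Longrightarrow> g x \<noteq> 0"
  shows "smooth_on S (\<lambda>x. f x / g x)"
proof -
  have "smooth_on S (\<lambda>x. inverse (g x))"
    by (rule smooth_on_compose[OF smooth_on_inverse]) (use assms in auto)
  then have "smooth_on S (\<lambda>x. f x * inverse (g x))"
    by (rule smooth_on_mult[OF assms(1,2)])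
  then show ?thesis by (simp add: field_simps)
qed

lemma smooth_on_ln: "smooth_on {0<..} (ln :: real \<Rightarrow> real)"
proof -
  have "Ck_on k {0<..} (ln :: real \<Rightarrow> real)" for k
  proof (cases k)
    case (Suc j)
    have "Ck_on j {0<..} (inverse :: real \<Rightarrow> real)"
      using smooth_on_inverse Ck_on_subset[of j "- {0}" inverse "{0<..}"] unfolding smooth_on_def by force
    then show ?thesis unfolding Suc
      by (intro Ck_on_Suc_realI[where f' = inverse]) (auto intro!: derivative_eq_intros simp: field_simps)
  qed (auto intro: continuous_intros)
  then show ?thesis unfolding smooth_on_def by blast
qed

text \<open>Bootstrapping: the derivative of \<open>g\<close> is
  \<open>inverse (deriv f (g y))\<close>, so \<open>g\<close> of class \<open>k\<close> has a
  derivative of class \<open>k\<close> and is itself of class \<open>k + 1\<close>.\<close>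

lemma smooth_on_inverse_function:
  fixes f g :: "real \<Rightarrow> real"
  assumes f: "smooth_on UNIV f" and pos: "\<And>x. deriv f x > 0"
    and fg: "\<And>y. f (g y) = y" and gc: "continuous_on UNIV g"
  shows "smooth_on UNIV g"
proof -
  have dg: "(g has_real_derivative inverse (deriv f (g y))) (at y)" for y
    by (rule DERIV_inverse_function[where f = f and a = "y - 1" and b = "y + 1"])
      (use smooth_on_real_has_deriv[OF f] pos[of "g y"] fg gc in \<open>auto simp: continuous_on_eq_continuous_at\<close>)
  have "Ck_on k UNIV g" for k
  proof (induction k)
    case (Suc k)
    have "Ck_on k UNIV (deriv f)" using f Ck_on_deriv unfolding smooth_on_def by blast
    then have 1: "Ck_on k UNIV (\<lambda>y. deriv f (g y))"
      using Ck_on_compose[OF open_UNIV open_UNIV Suc] by blast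
    have 2: "Ck_on k (- {0}) (inverse :: real \<Rightarrow> real)" using smooth_on_inverse smooth_on_def by blast
    have "(\<lambda>y. deriv f (g y)) ` UNIV \<subseteq> - {0}"
      using pos by (auto, metis less_irrefl)
    from Ck_on_compose[OF open_UNIV _ 1 2 this]
    have "Ck_on k UNIV (\<lambda>y. inverse (deriv f (g y)))" by (simp add: open_Compl)
    then show ?case by (rule Ck_on_Suc_realI[OF open_UNIV dg])
  qed (use gc in auto)
  then show ?thesis unfolding smooth_on_def by blast
qed

subsection \<open>Auxiliary real functions\<close>

text \<open>The standard flat function is the case \<open>n = 0\<close>. The powers make the family
  closed under differentiation up to linear combinations, so that one induction with
  \<open>n\<close> arbitrary proves smoothness.\<close>

definition flat :: "nat \<Rightarrow> real \<Rightarrow> real" where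
  "flat n z = (if z > 0 then exp (- 1 / z) * (1 / z) ^ n else 0)"

lemma tendsto_flat_0: "(flat n \<longlongrightarrow> 0) (at 0)"
proof -
  have "((\<lambda>z. (inverse z) ^ n / exp (inverse z)) \<longlongrightarrow> (0::real)) (at_right 0)"
    by (rule filterlim_compose[OF tendsto_power_div_exp_0 filterlim_inverse_at_top_right])
  moreover have "\<forall>\<^sub>F z in at_right 0. (inverse z) ^ n / exp (inverse z) = flat n z"
    by (auto simp: eventually_at_filter flat_def exp_minus field_simps)
  ultimately have "(flat n \<longlongrightarrow> 0) (at_right 0)"
    by (rule Lim_transform_eventually)
  moreover have "(flat n \<longlongrightarrow> 0) (at_left 0)"
    by (rule Lim_transform_eventually[OF tendsto_const[of 0]]) (auto simp: eventually_at_filter flat_def)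
  ultimately show ?thesis by (simp add: filterlim_at_split)
qed

lemma flat_has_derivative:
  "(flat n has_real_derivative (flat (n + 2) z - real n * flat (n + 1) z)) (at z)"
proof (cases z "0::real" rule: linorder_cases)
  case less
  then have "\<forall>\<^sub>F x in nhds z. x \<in> {..<0}" by (intro eventually_nhds_in_open) auto
  then have "\<forall>\<^sub>F x in nhds z. flat n x = 0" by eventually_elim (auto simp: flat_def)
  then show ?thesis using less by (subst DERIV_cong_ev[OF refl _ refl]) (auto simp: flat_def)
next
  case equal
  \<comment> \<open>At \<open>0\<close> the difference quotient of \<open>flat n\<close> is
    \<open>flat (n + 1)\<close> itself.\<close>
  have "((\<lambda>h. flat (n + 1) h) \<longlongrightarrow> 0) (at 0)" by (rule tendsto_flat_0)
  then have "((\<lambda>h. (flat n (0 + h) - flat n 0) / h) \<longlongrightarrow> 0) (at 0)"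
    by (rule Lim_transform_eventually) (auto simp: eventually_at_filter flat_def)
  then show ?thesis using equal by (simp add: DERIV_def flat_def)
next
  case greater
  have "\<forall>\<^sub>F x in nhds z. x \<in> {0<..}" using greater by (intro eventually_nhds_in_open) auto
  then have ev: "\<forall>\<^sub>F x in nhds z. flat n x = exp (- 1 / x) * (1 / x) ^ n"
    by eventually_elim (auto simp: flat_def)
  have 1: "((\<lambda>x. 1 / x) has_real_derivative (- 1 / z\<^sup>2)) (at z)"
    and 2: "((\<lambda>x. exp (- 1 / x)) has_real_derivative exp (- 1 / z) * (1 / z\<^sup>2)) (at z)"
    using greater by (auto intro!: derivative_eq_intros simp: power2_eq_square field_simps)
  have "((\<lambda>x. exp (- 1 / x) * (1 / x) ^ n) has_real_derivative
     exp (- 1 / z) * (1 / z\<^sup>2) * (1 / z) ^ n + exp (- 1 / z) * (real n * (1 / z) ^ (n - 1) * (- 1 / z\<^sup>2))) (at z)"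
    using DERIV_mult[OF 2 DERIV_power[OF 1, of n]] by (simp add: mult_ac)
  moreover have "real n * (1 / z) ^ (n - 1) * (- 1 / z\<^sup>2) = - real n * (1 / z) ^ (n + 1)"
    using greater by (cases n) (auto simp: power2_eq_square field_simps)
  then have "exp (- 1 / z) * (1 / z\<^sup>2) * (1 / z) ^ n + exp (- 1 / z) * (real n * (1 / z) ^ (n - 1) * (- 1 / z\<^sup>2))
    = flat (n + 2) z - real n * flat (n + 1) z"
    using greater by (simp only:) (simp add: flat_def power2_eq_square field_simps)
  ultimately have "((\<lambda>x. exp (- 1 / x) * (1 / x) ^ n) has_real_derivative
     flat (n + 2) z - real n * flat (n + 1) z) (at z)" by (simp only:)
  then show ?thesis
    by (subst DERIV_cong_ev[OF refl ev refl])
qed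

lemma smooth_on_flat: "smooth_on UNIV (flat n)"
proof -
  have "Ck_on k UNIV (flat n)" for k
  proof (induction k arbitrary: n)
    case 0
    then show ?case
      by (auto intro!: continuous_at_imp_continuous_on DERIV_isCont flat_has_derivative)
  next
    case (Suc k)
    have "Ck_on k UNIV (\<lambda>z. flat (n + 2) z + (- real n) * flat (n + 1) z)"
      by (intro Ck_on_add Ck_on_bilinear[OF _ bounded_bilinear_mult] Suc Ck_on_const) auto
    then show ?case
      by (intro Ck_on_Suc_realI[OF open_UNIV flat_has_derivative]) auto
  qed
  then show ?thesis unfolding smooth_on_def by blast
qed

section \<open>Smooth steps and rescaling of blocks\<close>

definition bump :: "real \<Rightarrow> real" where
  "bump z = (if z > 0 then exp (- 1 / z) else 0)"

lemma smooth_on_bump: "smooth_on UNIV bump"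
proof -
  have "flat 0 = bump" by (auto simp: flat_def bump_def fun_eq_iff)
  then show ?thesis using smooth_on_flat[of 0] by simp
qed

lemma bump_nonneg: "bump z \<ge> 0" and bump_pos: "z > 0 \<Longrightarrow> bump z > 0"
  and bump_eq_0: "z \<le> 0 \<Longrightarrow> bump z = 0" and bump_less_1: "bump z < 1"
  by (auto simp: bump_def)

lemma bump_strict_mono: "0 \<le> u \<Longrightarrow> u < v \<Longrightarrow> bump u < bump v"
  by (cases "u = 0") (auto simp: bump_def field_simps)

lemma bump_mono: "u \<le> v \<Longrightarrow> bump u \<le> bump v"
  using bump_strict_mono[of u v] bump_nonneg[of v] bump_eq_0[of u]
  by (cases "u < v"; cases "0 \<le> u") auto

text \<open>The usual smooth transition: for \<open>l > 0\<close> it is \<open>0\<close> up to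
  \<open>u = 0\<close>, increases on \<open>[0, l]\<close>, and is \<open>1\<close> from
  \<open>u = l\<close> on.\<close>

definition step :: "real \<Rightarrow> real \<Rightarrow> real" where
  "step l u = bump u / (bump u + bump (l - u))"

lemma step_denom_pos: "l > 0 \<Longrightarrow> bump u + bump (l - u) > 0"
  using bump_pos[of u] bump_pos[of "l - u"] bump_nonneg[of u] bump_nonneg[of "l - u"]
  by (cases "u > 0") (auto simp: add_pos_nonneg add_nonneg_pos)

lemma smooth_on_step: "l > 0 \<Longrightarrow> smooth_on UNIV (step l)"
  unfolding step_def
  by (intro smooth_on_divide smooth_on_add smooth_on_bump smooth_on_compose_UNIV[OF smooth_on_bump]
      smooth_on_diff smooth_on_const smooth_on_id)
    (use step_denom_pos in \<open>auto simp: less_imp_neq[THEN not_sym]\<close>)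

lemma step_le_0: "u \<le> 0 \<Longrightarrow> step l u = 0"
  and step_ge: "l > 0 \<Longrightarrow> l \<le> u \<Longrightarrow> step l u = 1"
  using bump_pos[of u] by (auto simp: step_def bump_eq_0)

lemma step_mono: assumes "l > 0" "u \<le> v" shows "step l u \<le> step l v"
proof -
  have "bump u * bump (l - v) \<le> bump v * bump (l - u)"
    using assms by (intro mult_mono bump_mono bump_nonneg) auto
  then show ?thesis
    using step_denom_pos[OF assms(1), of u] step_denom_pos[OF assms(1), of v]
    by (simp add: step_def field_simps)
qed

lemma step_strict_mono:
  assumes "l > 0" "0 \<le> u" "u < v" "v \<le> l" shows "step l u < step l v"
proof -
  have "bump u * bump (l - v) < bump v * bump (l - u)"
    using assms by (intro mult_strict_mono' bump_strict_mono bump_nonneg) auto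
  then show ?thesis
    using step_denom_pos[OF assms(1), of u] step_denom_pos[OF assms(1), of v]
    by (simp add: step_def field_simps)
qed

text \<open>\<open>stretch l\<close> maps \<open>[0, l]\<close> onto \<open>[0, 1]\<close> and is tangent to infinite order to a translation at
  both ends, so that blocks of different lengths can be exchanged smoothly.\<close>

definition stretch :: "real \<Rightarrow> real \<Rightarrow> real" where
  "stretch l u = u + (1 - l) * step l u"

lemma smooth_on_stretch: "l > 0 \<Longrightarrow> smooth_on UNIV (stretch l)"
  unfolding stretch_def
  by (intro smooth_on_add smooth_on_mult smooth_on_const smooth_on_id smooth_on_step) auto

lemma stretch_le_0: "u \<le> 0 \<Longrightarrow> stretch l u = u"
  and stretch_ge: "l > 0 \<Longrightarrow> l \<le> u \<Longrightarrow> stretch l u = u + (1 - l)"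
  by (auto simp: stretch_def step_le_0 step_ge)

text \<open>For \<open>l \<le> 1\<close> the added multiple of the monotone \<open>step l\<close>
  can only enlarge differences.\<close>

lemma stretch_diff: "0 < l \<Longrightarrow> l \<le> 1 \<Longrightarrow> u \<le> v \<Longrightarrow> v - u \<le> stretch l v - stretch l u"
  using mult_left_mono[OF step_mono[of l u v], of "1 - l"] by (auto simp: stretch_def)

lemma stretch_strict_mono: "0 < l \<Longrightarrow> l \<le> 1 \<Longrightarrow> u < v \<Longrightarrow> stretch l u < stretch l v"
  using stretch_diff[of l u v] by auto

lemma deriv_stretch_pos:
  assumes "0 < l" "l \<le> 1" shows "deriv (stretch l) x > 0"
proof -
  have 1: "(step l has_real_derivative deriv (step l) x) (at x)"
    using smooth_on_step[OF assms(1)] by (rule smooth_on_real_has_deriv) auto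
  have "deriv (step l) x \<ge> 0"
    by (rule mono_on_imp_deriv_nonneg[OF _ 1, of UNIV])
      (use step_mono[OF assms(1)] in \<open>auto simp: mono_on_def\<close>)
  moreover have "(stretch l has_real_derivative (1 + (1 - l) * deriv (step l) x)) (at x)"
    unfolding stretch_def using 1 by (auto intro!: derivative_eq_intros)
  then have "deriv (stretch l) x = 1 + (1 - l) * deriv (step l) x" by (rule DERIV_imp_deriv)
  ultimately show ?thesis using assms by (simp add: add_pos_nonneg)
qed

lemma stretch_bij: assumes "0 < l" "l \<le> 1" shows "bij (stretch l)"
proof -
  have "\<exists>u. stretch l u = y" for y
  proof -
    let ?a = "min 0 y" and ?b = "max l y"
    have "continuous_on {?a..?b} (stretch l)"
      using smooth_on_stretch[OF assms(1)] Ck_on_continuous_on continuous_on_subset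
      unfolding smooth_on_def by blast
    moreover have "stretch l ?a \<le> y" "y \<le> stretch l ?b"
      using assms by (auto simp: stretch_le_0 stretch_ge)
    moreover have "?a \<le> ?b" using assms by auto
    ultimately show ?thesis using IVT'[of "stretch l" ?a y ?b] by blast
  qed
  then have "surj (stretch l)" by (metis surjI)
  moreover have "inj (stretch l)"
    by (metis assms injI less_irrefl linorder_less_linear stretch_strict_mono)
  ultimately show ?thesis by (simp add: bij_def)
qed

definition shrink :: "real \<Rightarrow> real \<Rightarrow> real" where
  "shrink l = inv_into UNIV (stretch l)"

lemma stretch_shrink: "0 < l \<Longrightarrow> l \<le> 1 \<Longrightarrow> stretch l (shrink l y) = y"
  and shrink_stretch: "0 < l \<Longrightarrow> l \<le> 1 \<Longrightarrow> shrink l (stretch l u) = u"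
  using stretch_bij[of l] by (auto simp: shrink_def bij_def surj_f_inv_f inv_f_f)

lemma shrink_strict_mono: "0 < l \<Longrightarrow> l \<le> 1 \<Longrightarrow> u < v \<Longrightarrow> shrink l u < shrink l v"
  by (metis linorder_less_linear order_less_asym stretch_shrink stretch_strict_mono)

lemma shrink_le_0: "0 < l \<Longrightarrow> l \<le> 1 \<Longrightarrow> t \<le> 0 \<Longrightarrow> shrink l t = t"
  and shrink_ge_1: "0 < l \<Longrightarrow> l \<le> 1 \<Longrightarrow> 1 \<le> t \<Longrightarrow> shrink l t = t - (1 - l)"
  using shrink_stretch[of l t] shrink_stretch[of l "t - (1 - l)"] stretch_le_0[of t l] stretch_ge[of l "t - (1 - l)"]
  by auto

lemma shrink_1: "shrink 1 t = t"
  using shrink_stretch[of 1 t] by (simp add: stretch_def)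

lemma continuous_on_shrink: assumes "0 < l" "l \<le> 1" shows "continuous_on UNIV (shrink l)"
proof (rule continuous_onI_mono)
  show "shrink l x \<le> shrink l y" if "x \<le> y" for x y
    using shrink_strict_mono[OF assms, of x y] that by (cases "x = y") auto
  have "shrink l ` UNIV = UNIV"
    using shrink_stretch[OF assms] by (metis surjI)
  then show "open (range (shrink l))" by simp
qed

lemma smooth_on_shrink: "0 < l \<Longrightarrow> l \<le> 1 \<Longrightarrow> smooth_on UNIV (shrink l)"
  by (rule smooth_on_inverse_function[OF smooth_on_stretch deriv_stretch_pos stretch_shrink continuous_on_shrink])

text \<open>In the coordinate \<open>exp (1 / (1 - v))\<close> on \<open>v < 1\<close> the following flow is the translation by \<open>s\<close>;
  it extends smoothly by the identity to \<open>v \<ge> 1\<close>.\<close>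

definition flow :: "real \<Rightarrow> real \<Rightarrow> real" where
  "flow s v = 1 - (1 - v) / (1 + (1 - v) * ln (1 + s * bump (1 - v)))"

lemma flow_ge_1: "v \<ge> 1 \<Longrightarrow> flow s v = v"
  by (simp add: flow_def bump_eq_0)

abbreviation lift1 :: "real \<Rightarrow> real" where
  "lift1 v \<equiv> exp (1 / (1 - v))"

text \<open>Here \<open>bump (1 - v)\<close> is the reciprocal of \<open>lift1 v\<close>, so the
  logarithm in \<open>flow\<close> is the increment of \<open>ln\<close> from \<open>lift1 v\<close>
  to \<open>lift1 v + s\<close>. Writing it through \<open>bump\<close> is what carries the formula
  smoothly across \<open>v = 1\<close>.\<close>

lemma flow_denom:
  assumes "v < 1" "lift1 v + s > 0"
  shows "1 + (1 - v) * ln (1 + s * bump (1 - v)) = (1 - v) * ln (lift1 v + s)"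
proof -
  have b: "bump (1 - v) = 1 / lift1 v"
    using assms by (simp add: bump_def exp_minus field_simps)
  have "1 + s * bump (1 - v) = (lift1 v + s) / lift1 v"
    by (simp add: b field_simps)
  also have "ln \<dots> = ln (lift1 v + s) - 1 / (1 - v)"
    using assms by (simp add: ln_div)
  finally show ?thesis using assms by (simp add: field_simps)
qed

lemma flow_less_1:
  assumes "v < 1" "lift1 v + s > 1"
  shows "flow s v = 1 - 1 / ln (lift1 v + s)"
  unfolding flow_def using flow_denom[of v s] assms by simp

text \<open>The bound \<open>2\<close> leaves room for every parameter \<open>s > -1\<close>: the
  translated value stays above \<open>1\<close>, where its logarithm is positive.\<close>

lemma lift1_ge: assumes "0 < v" "v < 1" shows "lift1 v > 2"
proof -
  have "1 < 1 / (1 - v)" using assms by (simp add: field_simps)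
  then have "exp 1 < lift1 v" by simp
  then show ?thesis using exp_ge_add_one_self[of "1::real"] by linarith
qed

lemma lift1_flow:
  assumes "v < 1" "lift1 v + s > 1"
  shows "flow s v < 1" "lift1 (flow s v) = lift1 v + s"
  using assms by (auto simp: flow_less_1[OF assms])

text \<open>Translations of \<open>lift1\<close> add up. The second parameter may be negative as
  long as the sum is not, because transition maps use differences of two values of
  \<open>kap\<close>.\<close>

lemma flow_flow:
  assumes "0 < v" "s \<ge> 0" "s + c \<ge> 0"
  shows "flow c (flow s v) = flow (s + c) v"
proof (cases "v < 1")
  case True
  note T = lift1_ge[OF assms(1) True]
  have 1: "lift1 v + s > 1" "lift1 v + (s + c) > 1" using T assms by auto
  note L = lift1_flow[OF True 1(1)]
  have "lift1 (flow s v) + c > 1" using L 1 by simp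
  from flow_less_1[OF L(1) this] show ?thesis
    using flow_less_1[OF True 1(2)] L(2) by (simp add: add.assoc)
qed (simp add: flow_ge_1)

lemma flow_0: "flow 0 v = v" by (simp add: flow_def)

lemma flow_pos: assumes "0 < v" "s \<ge> 0" shows "0 < flow s v"
proof (cases "v < 1")
  case True
  have T: "lift1 v > 2" using lift1_ge assms True by auto
  have "ln (lift1 v) \<le> ln (lift1 v + s)" using assms by (subst ln_le_cancel_iff) (auto simp: add_pos_nonneg)
  moreover have "ln (lift1 v) > 1" using assms True by (simp add: field_simps)
  ultimately have "1 / ln (lift1 v + s) < 1" by simp
  then show ?thesis using flow_less_1[OF True, of s] T assms by simp
qed (use assms in \<open>simp add: flow_ge_1\<close>)

lemma flow_inj:
  assumes "0 < v" "0 < w" "s \<ge> 0" "flow s v = flow s w"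
  shows "v = w"
proof -
  have "flow (- s) (flow s x) = x" if "0 < x" for x
    using flow_flow[OF that assms(3), of "- s"] by (simp add: flow_0)
  then show ?thesis using assms by metis
qed

text \<open>The positive speed inside the moving block turns small differences of \<open>kap\<close>
  into proportional vertical displacements; from \<open>v = 1\<close> on the flow is at
  rest.\<close>

lemma flow_has_derivative:
  assumes "0 < v" "v < 1" "s \<ge> 0"
  shows "\<exists>D>0. ((\<lambda>s. flow s v) has_real_derivative D) (at s)"
proof -
  note T = lift1_ge[OF assms(1,2)]
  have "\<forall>\<^sub>F t in nhds s. t \<in> {-1<..}" using assms by (intro eventually_nhds_in_open) auto
  then have ev: "\<forall>\<^sub>F t in nhds s. flow t v = 1 - 1 / ln (lift1 v + t)"
    by eventually_elim (use T assms in \<open>auto intro: flow_less_1\<close>)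
  have p: "lift1 v + s > 1" "ln (lift1 v + s) > 0" using T assms by auto
  let ?D = "1 / ((ln (lift1 v + s))\<^sup>2 * (lift1 v + s))"
  have "((\<lambda>t. 1 - 1 / ln (lift1 v + t)) has_real_derivative ?D) (at s)"
    using p by (auto intro!: derivative_eq_intros simp: power2_eq_square field_simps)
  then have "((\<lambda>s. flow s v) has_real_derivative ?D) (at s)"
    by (subst DERIV_cong_ev[OF refl ev refl])
  moreover have "?D > 0" using p by auto
  ultimately show ?thesis by blast
qed

text \<open>Parameters between \<open>-1\<close> and \<open>1\<close> are exactly what differences
  of values of \<open>kap\<close> require. Since \<open>bump\<close> is below \<open>1\<close>, the
  argument of \<open>ln\<close> stays positive for them, and \<open>v > 0\<close> keeps the outer
  denominator away from \<open>0\<close>.\<close>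

lemma smooth_on_flow: "smooth_on ({-1<..<1} \<times> {0<..}) (\<lambda>p. flow (fst p) (snd p))"
proof -
  let ?S = "{-1<..<1::real} \<times> {0<..} :: (real \<times> real) set"
  have S: "open ?S" by (intro open_Times) auto
  have v: "smooth_on ?S (\<lambda>p. 1 - snd p)"
    by (intro smooth_on_diff smooth_on_const smooth_on_snd S)
  have b: "smooth_on ?S (\<lambda>p. 1 + fst p * bump (1 - snd p))"
    by (intro smooth_on_add smooth_on_mult smooth_on_const smooth_on_fst S smooth_on_compose_UNIV[OF smooth_on_bump] v)
  have pos: "1 + fst p * bump (1 - snd p) > 0" if "p \<in> ?S" for p
  proof -
    have "\<bar>fst p * bump (1 - snd p)\<bar> < 1"
      using that bump_less_1[of "1 - snd p"] bump_nonneg[of "1 - snd p"]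
        mult_strict_mono'[of "\<bar>fst p\<bar>" 1 "bump (1 - snd p)" 1] by (auto simp: abs_mult)
    then show ?thesis by linarith
  qed
  have l: "smooth_on ?S (\<lambda>p. ln (1 + fst p * bump (1 - snd p)))"
    by (rule smooth_on_compose[OF smooth_on_ln _ S b]) (use pos in auto)
  have d: "1 + (1 - snd p) * ln (1 + fst p * bump (1 - snd p)) \<noteq> 0" if p: "p \<in> ?S" for p
  proof (cases "snd p < 1")
    case True
    have "lift1 (snd p) > 2" using lift1_ge p True by auto
    then have "lift1 (snd p) + fst p > 1" using p by auto
    then show ?thesis using flow_denom[of "snd p" "fst p"] True by simp
  qed (simp add: bump_eq_0)
  show ?thesis unfolding flow_def
    by (intro smooth_on_diff smooth_on_divide smooth_on_add smooth_on_mult smooth_on_const v l S) (use d in auto)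
qed

subsection \<open>The type of countable ordinals\<close>

lemma Card_order_omega1: "Card_order omega1"
  unfolding omega1_def by (rule cardSuc_Card_order) (rule card_of_Card_order)

lemma Well_order_omega1: "Well_order omega1"
  using Card_order_omega1 card_order_on_well_order_on by blast

lemma countable_underS_omega1:
  assumes "a \<in> Field omega1" shows "countable (underS omega1 a)"
proof -
  have "|underS omega1 a| <o omega1" using card_of_underS[OF Card_order_omega1 assms] .
  then have "|underS omega1 a| \<le>o |UNIV :: nat set|"
    unfolding omega1_def by (simp add: cardSuc_ordLess_ordLeq card_of_Card_order)
  then show ?thesis by (simp add: countable_card_le_natLeq card_of_nat ordLeq_ordIso_trans)
qed

lemma uncountable_Field_omega1: "uncountable (Field omega1)"
proof
  assume "countable (Field omega1)"
  then have "|Field omega1| \<le>o natLeq" by (simp add: countable_card_le_natLeq)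
  moreover have "|Field omega1| =o omega1" using Card_order_omega1 card_of_Field_ordIso by blast
  ultimately have "omega1 \<le>o |UNIV :: nat set|"
    by (meson card_of_nat ordIso_symmetric ordIso_ordLeq_trans ordLeq_ordIso_trans)
  moreover have "|UNIV :: nat set| <o omega1" unfolding omega1_def by (rule cardSuc_greater) (rule card_of_Card_order)
  ultimately show False using not_ordLess_ordLeq by blast
qed

text \<open>As a type, the countable ordinals become an instance of \<open>wellorder\<close>, with
  \<open>LEAST\<close> and well-founded induction at hand.\<close>

typedef cord = "Field omega1" morphisms rep_cord abs_cord
  using uncountable_Field_omega1 by (metis countable_empty equals0I)

instantiation cord :: linorder
begin
definition less_eq_cord :: "cord \<Rightarrow> cord \<Rightarrow> bool" where "a \<le> b \<longleftrightarrow> (rep_cord a, rep_cord b) \<in> omega1"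
definition less_cord :: "cord \<Rightarrow> cord \<Rightarrow> bool" where "a < b \<longleftrightarrow> (rep_cord a, rep_cord b) \<in> omega1 \<and> a \<noteq> b"
instance
proof
  have W: "Refl omega1" "trans omega1" "antisym omega1" "Total omega1"
    using Well_order_omega1 unfolding order_on_defs by auto
  fix x y z :: cord
  show "(x < y) = (x \<le> y \<and> \<not> y \<le> x)"
    using W(3) unfolding less_eq_cord_def less_cord_def antisym_def
    by (metis rep_cord_inject W(1) rep_cord refl_on_def)
  show "x \<le> x" using W(1) rep_cord[of x] unfolding less_eq_cord_def refl_on_def by blast
  show "x \<le> y \<Longrightarrow> y \<le> z \<Longrightarrow> x \<le> z" using W(2) unfolding less_eq_cord_def trans_def by blast
  show "x \<le> y \<Longrightarrow> y \<le> x \<Longrightarrow> x = y"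
    using W(3) unfolding less_eq_cord_def antisym_def by (metis rep_cord_inject)
  show "x \<le> y \<or> y \<le> x"
    using W(1,4) rep_cord[of x] rep_cord[of y] unfolding less_eq_cord_def total_on_def refl_on_def by metis
qed
end

instance cord :: wellorder
proof
  fix P :: "cord \<Rightarrow> bool" and a
  assume step: "\<And>x. (\<And>y. y < x \<Longrightarrow> P y) \<Longrightarrow> P x"
  have "wf (omega1 - Id)" using Well_order_omega1 unfolding well_order_on_def by blast
  then have "wf (inv_image (omega1 - Id) rep_cord)" by (rule wf_inv_image)
  then show "P a"
    by (induction a rule: wf_induct_rule) (rule step, auto simp: less_cord_def rep_cord_inject)
qed

instantiation cord :: order_bot
begin
definition bot_cord :: cord where "bot_cord = (LEAST x. True)"
instance by standard (simp add: bot_cord_def Least_le)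
end

lemma countable_lessThan_cord: "countable {..<a :: cord}"
proof -
  have "rep_cord ` {..<a} \<subseteq> underS omega1 (rep_cord a)"
    by (auto simp: less_cord_def underS_def rep_cord_inject)
  then have "countable (rep_cord ` {..<a})"
    using countable_underS_omega1[OF rep_cord] countable_subset by blast
  then show ?thesis by (rule countable_image_inj_on) (auto simp: inj_on_def rep_cord_inject)
qed

text \<open>An unbounded countable set would exhibit all countable ordinals as a countable union of
  countable initial segments.\<close>

lemma countable_bounded_cord:
  assumes "countable S" shows "\<exists>b::cord. \<forall>a\<in>S. a < b"
proof (rule ccontr)
  assume "\<not> ?thesis"
  then have "UNIV = (\<Union>a\<in>S. insert a {..<a})" by (force simp: not_less le_less)
  moreover have "countable (\<Union>a\<in>S. insert a {..<a})"
    using assms countable_lessThan_cord by blast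
  ultimately have "countable (UNIV :: cord set)" by simp
  then have "countable (rep_cord ` UNIV)" by blast
  then show False
    using uncountable_Field_omega1 type_definition.Rep_range[OF type_definition_cord] by simp
qed

lemma cord_gt_ex: "\<exists>b::cord. a < b"
  using countable_bounded_cord[of "{a}"] by auto

definition limit_cord :: "cord \<Rightarrow> bool" where
  "limit_cord a \<longleftrightarrow> a \<noteq> bot \<and> (\<forall>b<a. \<exists>c. b < c \<and> c < a)"

text \<open>Enumerate the countably many ordinals below \<open>a\<close> and let each new term
  exceed its predecessor and the ordinal enumerated at that stage.\<close>

lemma limit_cord_ladder:
  assumes "limit_cord a"
  obtains s :: "nat \<Rightarrow> cord" where "strict_mono s" "\<And>n. s n < a" "\<And>b. b < a \<Longrightarrow> \<exists>n. b < s n"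
proof -
  have "bot < a" using assms by (simp add: limit_cord_def bot.not_eq_extremum)
  then have ne: "{..<a} \<noteq> {}" by auto
  define e where "e = from_nat_into {..<a}"
  have e: "range e = {..<a}"
    unfolding e_def using ne countable_lessThan_cord by (rule range_from_nat_into)
  have "\<exists>s. \<forall>n. s n < a \<and> (s n < s (Suc n) \<and> e n < s (Suc n))"
  proof (rule dependent_nat_choice)
    show "\<exists>x. x < a" using \<open>bot < a\<close> by blast
    fix x n assume "x < a"
    moreover have "e n < a" using e by auto
    ultimately have "max x (e n) < a" by simp
    then show "\<exists>y<a. x < y \<and> e n < y"
      using assms unfolding limit_cord_def by (meson max_less_iff_conj)
  qed
  then obtain s where s: "\<And>n. s n < a" "\<And>n. s n < s (Suc n)" "\<And>n. e n < s (Suc n)" by blast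
  show ?thesis
  proof
    show "strict_mono s" using s by (simp add: strict_mono_Suc_iff)
    show "\<exists>n. b < s n" if "b < a" for b
    proof -
      obtain n where "b = e n" using e \<open>b < a\<close> by (metis imageE lessThan_iff)
      then show ?thesis using s(3) by blast
    qed
  qed (use s in auto)
qed

lemma strict_mono_limit_cord:
  fixes s :: "nat \<Rightarrow> cord"
  assumes "strict_mono s"
  obtains a where "limit_cord a" "\<And>n. s n < a" "\<And>b. b < a \<Longrightarrow> \<exists>n. b < s n"
proof -
  have ex: "\<exists>a. \<forall>n. s n < a" using countable_bounded_cord[of "range s"] by auto
  define a where "a = (LEAST a. \<forall>n. s n < a)"
  have a: "\<And>n. s n < a" using LeastI_ex[OF ex] unfolding a_def by blast
  have least: "\<exists>n. b < s n" if "b < a" for b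
  proof -
    from not_less_Least[OF that[unfolded a_def]] obtain n where "s n \<ge> b" by (auto simp: not_less)
    then have "b < s (Suc n)" using assms by (meson le_less_trans strict_mono_Suc_iff)
    then show ?thesis by blast
  qed
  have "limit_cord a"
    unfolding limit_cord_def using a least by (metis bot.not_eq_extremum bot_least not_less)
  with a least that show ?thesis by blast
qed

subsection \<open>Coherent families of weights\<close>

text \<open>The square in the exponent makes the ratio of two values with distinct indices
  \<open>m\<close>, \<open>n\<close> at least \<open>2 ^ (m + n)\<close>, hence eventually larger
  than any constant; a geometric sequence would keep neighbouring ratios bounded.\<close>

definition theta :: "nat \<Rightarrow> real" where "theta n = (1/2) ^ (n\<^sup>2)"

lemma theta_pos: "theta n > 0" by (simp add: theta_def)

lemma theta_le_half: "n \<ge> 1 \<Longrightarrow> theta n \<le> 1/2"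
  unfolding theta_def using power_decreasing[of 1 "n\<^sup>2" "1/2::real"] by simp

lemma theta_decreasing: assumes "m < n" shows "theta n \<le> theta m / 2 ^ (m + n)"
proof -
  have "m\<^sup>2 + (m + n) \<le> n\<^sup>2"
  proof -
    obtain d where "n = Suc (m + d)" using assms less_imp_Suc_add by blast
    then show ?thesis by (simp add: power2_eq_square algebra_simps)
  qed
  then have "theta n \<le> (1/2) ^ (m\<^sup>2 + (m + n))" unfolding theta_def by (intro power_decreasing) auto
  then show ?thesis by (simp add: theta_def power_add power_one_over)
qed

text \<open>Since \<open>r\<close> is increasing and starts at \<open>1\<close> or later,
  consecutive indices add up to at least \<open>3\<close>, so each term is at most an eighth of the
  preceding one; \<open>8/7\<close> is the value of the geometric series.\<close>

lemma theta_sum_le: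
  fixes r :: "nat \<Rightarrow> nat"
  assumes r: "strict_mono r" "\<And>n. r n \<ge> 1" and K: "finite K" "K \<subseteq> {n..}"
  shows "(\<Sum>i\<in>K. theta (r i)) \<le> 8/7 * theta (r n)"
proof -
  have dec: "theta (r (Suc i)) \<le> theta (r i) / 8" for i
  proof -
    have lt: "r i < r (Suc i)" using r by (simp add: strict_mono_def)
    have "(2::real) ^ 3 \<le> 2 ^ (r i + r (Suc i))"
      by (rule power_increasing) (use lt r(2)[of i] in auto)
    then have "theta (r i) / 2 ^ (r i + r (Suc i)) \<le> theta (r i) / 8"
      using theta_pos[of "r i"] by (intro divide_left_mono) auto
    then show ?thesis using theta_decreasing[OF lt] by linarith
  qed
  \<comment> \<open>Keeping \<open>8/7\<close> of the next term in reserve makes the induction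
    close, as \<open>1 + (8/7)/8 = 8/7\<close>.\<close>
  have *: "(\<Sum>i<j. theta (r (n + i))) + 8/7 * theta (r (n + j)) \<le> 8/7 * theta (r n)" for j
  proof (induction j)
    case (Suc j)
    then show ?case using dec[of "n + j"] by simp
  qed simp
  obtain M where M: "K \<subseteq> {..<M}" using K(1) finite_nat_iff_bounded by blast
  have "K \<subseteq> (\<lambda>i. n + i) ` {..<M}"
  proof
    fix x assume "x \<in> K"
    then show "x \<in> (\<lambda>i. n + i) ` {..<M}" using K M by (intro image_eqI[of _ _ "x - n"]) auto
  qed
  then have "(\<Sum>i\<in>K. theta (r i)) \<le> (\<Sum>i\<in>(\<lambda>i. n + i) ` {..<M}. theta (r i))"
    by (intro sum_mono2) (auto simp: theta_pos less_imp_le)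
  also have "\<dots> = (\<Sum>i<M. theta (r (n + i)))" by (subst sum.reindex) auto
  finally show ?thesis using *[of M] theta_pos[of "r (n + M)"] by linarith
qed

text \<open>Finitely many places carry all but \<open>e/2\<close> of the sum. Assigning tiny values
  to them makes the whole small at the cost of a finite change, the only kind that coherence
  permits.\<close>

lemma reduce_weights:
  fixes w :: "'a \<Rightarrow> real"
  assumes "\<And>x. w x > 0" "w summable_on X" "e > 0"
  obtains w' where "\<And>x. w' x > 0" "finite {x\<in>X. w' x \<noteq> w x}"
    "\<And>G. finite G \<Longrightarrow> G \<subseteq> X \<Longrightarrow> sum w' G \<le> e"
proof -
  have "(sum w \<longlongrightarrow> infsum w X) (finite_subsets_at_top X)" using assms(2) by (rule infsum_tendsto)
  then have "\<forall>\<^sub>F F in finite_subsets_at_top X. dist (sum w F) (infsum w X) < e/2"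
    using assms(3) by (intro tendstoD) auto
  then obtain F where F: "finite F" "F \<subseteq> X" "dist (sum w F) (infsum w X) < e/2"
    unfolding eventually_finite_subsets_at_top by blast
  \<comment> \<open>With this value \<open>F\<close> contributes at most \<open>e/2\<close>; the
    added \<open>1\<close> keeps the denominator positive when \<open>F\<close> is empty.\<close>
  define c where "c = e / (2 * (real (card F) + 1))"
  have c: "c > 0" "real (card F) * c \<le> e / 2" using assms(3) by (auto simp: c_def field_simps)
  define w' where "w' = (\<lambda>x. if x \<in> F then c else w x)"
  show ?thesis
  proof
    show "w' x > 0" for x using c assms(1) by (simp add: w'_def)
    show "finite {x\<in>X. w' x \<noteq> w x}"
      by (rule finite_subset[OF _ F(1)]) (auto simp: w'_def split: if_splits)
    fix G assume G: "finite G" "G \<subseteq> X"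
    have "sum w' G = sum w' (G \<inter> F) + sum w' (G - F)"
      using G by (metis add.commute sum.Int_Diff)
    also have "sum w' (G \<inter> F) = real (card (G \<inter> F)) * c" by (simp add: w'_def)
    also have "\<dots> \<le> real (card F) * c"
      using c F by (intro mult_right_mono) (auto intro: card_mono)
    also have "sum w' (G - F) = sum w (G - F)" by (rule sum.cong) (auto simp: w'_def)
    also have "\<dots> = sum w ((G - F) \<union> F) - sum w F"
      using G F by (subst sum.union_disjoint) auto
    also have "sum w ((G - F) \<union> F) \<le> infsum w X"
      using G F assms by (intro finite_sum_le_infsum) (auto simp: less_imp_le)
    finally show "sum w' G \<le> e" using F(3) c by (simp add: dist_real_def) argo
  qed
qed

section \<open>Recursive construction of the coherent weights\<close>

definition in_window :: "nat set \<Rightarrow> real \<Rightarrow> bool" where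
  "in_window I d \<longleftrightarrow> (\<exists>n\<in>I. theta n \<le> d \<and> d \<le> 2 * theta n)"

text \<open>\<open>w\<close> is an admissible choice at stage \<open>a\<close> when \<open>f\<close>
  holds the choices at all smaller stages. A total below \<open>1\<close> leaves room at successor
  stages and keeps \<open>kap\<close> in the parameter range where \<open>flow\<close> is
  smooth.\<close>

definition weights :: "(cord \<Rightarrow> nat set) \<Rightarrow> (cord \<Rightarrow> cord \<Rightarrow> real) \<Rightarrow> cord \<Rightarrow> (cord \<Rightarrow> real) \<Rightarrow> bool" where
  "weights I f a w \<longleftrightarrow> (\<forall>g. w g > 0) \<and> w summable_on {..<a} \<and> infsum w {..<a} < 1 \<and>
     (\<forall>b<a. finite {g. g < b \<and> f b g \<noteq> w g}) \<and>
     (limit_cord a \<longrightarrow> (\<forall>b<a. in_window (I a) (infsum w {b..<a})))"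

lemma weights_bot: "\<exists>w. weights I f bot w"
proof -
  have "{..<bot :: cord} = {}" by auto
  then show ?thesis
    by (intro exI[of _ "\<lambda>_. 1"]) (auto simp: weights_def limit_cord_def simp del: lessThan_eq_iff)
qed

lemma weights_succ:
  assumes b: "b < a" "\<And>g. g < a \<Longrightarrow> g \<le> b" and W: "weights I f b (f b)"
  shows "\<exists>w. weights I f a w"
proof -
  define s where "s = infsum (f b) {..<b}"
  \<comment> \<open>The new place receives half of the room left below \<open>1\<close>.\<close>
  define w where "w = (f b)(b := (1 - s) / 2)"
  have s: "s < 1" "f b summable_on {..<b}" "\<And>g. f b g > 0" using W by (auto simp: s_def weights_def)
  have eq: "{..<a} = insert b {..<b}" using b by force
  have w: "w summable_on {..<b}" "infsum w {..<b} = s"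
  proof -
    have "w g = f b g" if "g \<in> {..<b}" for g using that by (auto simp: w_def)
    then show "w summable_on {..<b}" "infsum w {..<b} = s"
      unfolding s_def using s(2) summable_on_cong[of "{..<b}" w "f b"] infsum_cong[of "{..<b}" w "f b"] by auto
  qed
  have "w summable_on {..<a}" unfolding eq using w by (simp add: summable_on_insert_iff)
  moreover have "infsum w {..<a} = (1 - s) / 2 + s"
    unfolding eq using w by (subst infsum_insert) (auto simp: w_def)
  then have "infsum w {..<a} < 1" using s by (simp add: field_simps)
  moreover have "w g > 0" for g using s by (simp add: w_def)
  moreover have "finite {g. g < c \<and> f c g \<noteq> w g}" if "c < a" for c
  proof (cases "c = b")
    case True
    then have "{g. g < c \<and> f c g \<noteq> w g} = {}" by (auto simp: w_def)
    then show ?thesis by (simp only: finite.emptyI)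
  next
    case False
    then have "c < b" using b(2)[OF that] by simp
    then have "finite {g. g < c \<and> f c g \<noteq> f b g}" using W by (simp add: weights_def)
    then show ?thesis by (rule rev_finite_subset) (use \<open>c < b\<close> in \<open>auto simp: w_def\<close>)
  qed
  moreover have "\<not> limit_cord a" using b by (auto simp: limit_cord_def not_less)
  ultimately show ?thesis unfolding weights_def by blast
qed

text \<open>At a limit \<open>a\<close> with ladder \<open>s\<close>, the interval \<open>]s (n - 1), s n]\<close> receives essentially only the
  weight \<open>theta (r n)\<close> at \<open>s n\<close>, which dominates everything that follows.\<close>

lemma weights_limit:
  assumes lim: "limit_cord a" and I: "infinite (I a)" and W: "\<And>b. b < a \<Longrightarrow> weights I f b (f b)"
  shows "\<exists>w. weights I f a w"
proof -
  obtain s :: "nat \<Rightarrow> cord" where s: "strict_mono s" "\<And>n. s n < a" "\<And>b. b < a \<Longrightarrow> \<exists>n. b < s n"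
    using limit_cord_ladder[OF lim] by blast
  obtain r :: "nat \<Rightarrow> nat" where r: "strict_mono r" "\<And>n. r n \<in> I a - {0}"
    using infinite_enumerate[of "I a - {0}"] I by auto
  then have r1: "\<And>n. r n \<ge> 1" by (metis Diff_iff One_nat_def Suc_leI bot_nat_0.not_eq_extremum insertI1)
  \<comment> \<open>For each ladder term the earlier choice \<open>f (s n)\<close> is modified at
    finitely many places so that its whole mass is at most an eighth of
    \<open>theta (r n)\<close>.\<close>
  have "\<exists>w'. (\<forall>x. w' x > 0) \<and> finite {x\<in>{..<s n}. w' x \<noteq> f (s n) x} \<and>
      (\<forall>G. finite G \<longrightarrow> G \<subseteq> {..<s n} \<longrightarrow> sum w' G \<le> theta (r n) / 8)" for n
    using reduce_weights[of "f (s n)" "{..<s n}" "theta (r n) / 8"] W[OF s(2)[of n]] theta_pos[of "r n"]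
    unfolding weights_def by (metis divide_pos_pos zero_less_numeral)
  then obtain u where u: "\<And>n x. u n x > 0" "\<And>n. finite {x\<in>{..<s n}. u n x \<noteq> f (s n) x}"
      "\<And>n G. finite G \<Longrightarrow> G \<subseteq> {..<s n} \<Longrightarrow> sum (u n) G \<le> theta (r n) / 8" by metis
  \<comment> \<open>\<open>idx g\<close> is the number of the ladder interval containing
    \<open>g\<close>; the top \<open>s n\<close> of an interval carries its dominant weight.\<close>
  define idx where "idx g = (LEAST n. g \<le> s n)" for g
  have idx: "g \<le> s (idx g)" if "g < a" for g
    unfolding idx_def using s(3)[OF that] by (metis (mono_tags, lifting) LeastI_ex less_imp_le)
  have idx_mono: "idx b \<le> idx g" if "b \<le> g" "g < a" for b g
    unfolding idx_def[of b] using idx[OF that(2)] that(1) by (intro Least_le) auto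
  have idx_s: "idx (s n) = n" for n
    unfolding idx_def using s(1) by (intro Least_equality) (auto simp: strict_mono_less_eq)
  define w where "w g = (if g = s (idx g) then theta (r (idx g)) else u (idx g) g)" for g
  have wpos: "w g > 0" for g using u theta_pos by (simp add: w_def)
  have slot: "sum w G \<le> 9/8 * theta (r n)" if G: "finite G" "G \<subseteq> {..<a}" "\<And>g. g \<in> G \<Longrightarrow> idx g = n" for G n
  proof -
    have "sum w G \<le> sum w (insert (s n) (G - {s n}))"
      using G(1) by (intro sum_mono2) (auto simp: wpos less_imp_le)
    also have "\<dots> = w (s n) + sum w (G - {s n})" using G(1) by (subst sum.insert) auto
    also have "w (s n) = theta (r n)" by (simp add: w_def idx_s)
    also have "sum w (G - {s n}) = sum (u n) (G - {s n})"
      by (rule sum.cong) (use G(3) in \<open>auto simp: w_def\<close>)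
    also have "\<dots> \<le> theta (r n) / 8"
    proof (rule u(3))
      show "G - {s n} \<subseteq> {..<s n}"
      proof
        fix g assume g: "g \<in> G - {s n}"
        then have "g \<le> s (idx g)" using G(2) by (intro idx) auto
        then show "g \<in> {..<s n}" using g G(3) by auto
      qed
    qed (use G in auto)
    finally show ?thesis by simp
  qed
  \<comment> \<open>One interval carries at most \<open>1 + 1/8\<close> times its
    \<open>theta\<close>, and summing the intervals from that of \<open>b\<close> on costs the
    factor \<open>8/7\<close>, together \<open>9/7\<close>. The bound \<open>2\<close> serves the
    windows; \<open>9/7\<close> times a first \<open>theta\<close> of at most \<open>1/2\<close>
    keeps the total below \<open>1\<close>.\<close>
  have fin: "sum w G \<le> 2 * theta (r (idx b)) \<and> sum w G \<le> 9/7 * theta (r (idx b))"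
    if "b < a" and G: "finite G" "G \<subseteq> {b..<a}" for b G
  proof -
    have "sum w G = (\<Sum>n\<in>idx ` G. sum w {g\<in>G. idx g = n})"
      using G(1) by (intro sum.image_gen)
    also have "\<dots> \<le> (\<Sum>n\<in>idx ` G. 9/8 * theta (r n))"
      by (intro sum_mono slot) (use G in auto)
    also have "\<dots> = 9/8 * (\<Sum>n\<in>idx ` G. theta (r n))" by (simp add: sum_distrib_left)
    also have "(\<Sum>n\<in>idx ` G. theta (r n)) \<le> 8/7 * theta (r (idx b))"
      by (rule theta_sum_le[OF r(1) r1]) (use G idx_mono in auto)
    finally show ?thesis using theta_pos[of "r (idx b)"] by simp
  qed
  have summ: "w summable_on {b..<a}" if "b < a" for b
  proof (rule nonneg_bdd_above_summable_on)
    show "bdd_above (sum w ` {F. F \<subseteq> {b..<a} \<and> finite F})"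
      using fin[OF that] by (intro bdd_aboveI[of _ "2 * theta (r (idx b))"]) auto
  qed (use wpos less_imp_le in auto)
  have bot: "bot < a" using lim by (simp add: limit_cord_def bot.not_eq_extremum)
  then have "{..<a} = {bot..<a}" by auto
  moreover have "infsum w {bot..<a} \<le> 9/7 * theta (r (idx bot))"
    using fin[OF bot] by (intro infsum_le_finite_sums summ[OF bot]) auto
  moreover have "theta (r (idx bot)) \<le> 1/2" using r1 by (intro theta_le_half) auto
  ultimately have 1: "w summable_on {..<a}" "infsum w {..<a} < 1" using summ[OF bot] by auto
  have 2: "in_window (I a) (infsum w {b..<a})" if b: "b < a" for b
  proof -
    have "infsum w {b..<a} \<le> 2 * theta (r (idx b))"
      using fin[OF b] by (intro infsum_le_finite_sums summ[OF b]) auto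
    moreover have "sum w {s (idx b)} \<le> infsum w {b..<a}"
      by (intro finite_sum_le_infsum summ[OF b]) (use idx[OF b] s wpos in \<open>auto intro: less_imp_le\<close>)
    then have "theta (r (idx b)) \<le> infsum w {b..<a}" by (simp add: w_def idx_s)
    ultimately show ?thesis unfolding in_window_def using r(2) by blast
  qed
  have 3: "finite {g. g < b \<and> f b g \<noteq> w g}" if b: "b < a" for b
  proof -
    \<comment> \<open>Below \<open>b\<close> only the ladder intervals up to \<open>idx b\<close>
      occur. In interval \<open>n\<close> the new weight can differ from \<open>f b\<close> only at
      the top, where \<open>f (s n)\<close> was modified, or where \<open>f b\<close> and
      \<open>f (s n)\<close> already differ.\<close>
    let ?D = "\<lambda>n. {s n} \<union> {x\<in>{..<s n}. u n x \<noteq> f (s n) x} \<union> {g. g < b \<and> g < s n \<and> f b g \<noteq> f (s n) g}"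
    have D: "finite (?D n)" for n
    proof -
      have "finite {g. g < b \<and> g < s n \<and> f b g \<noteq> f (s n) g}"
      proof (cases "b \<le> s n")
        case True
        have "finite {g. g < b \<and> f b g \<noteq> f (s n) g}"
        proof (cases "b = s n")
          case False
          then show ?thesis using True W[OF s(2)[of n]] unfolding weights_def by auto
        qed simp
        then show ?thesis by (rule rev_finite_subset) auto
      next
        case False
        then have "finite {g. g < s n \<and> f (s n) g \<noteq> f b g}" using W[OF b] unfolding weights_def by auto
        then show ?thesis by (rule rev_finite_subset) auto
      qed
      then show ?thesis using u(2) by simp
    qed
    have "{g. g < b \<and> f b g \<noteq> w g} \<subseteq> (\<Union>n\<le>idx b. ?D n)"
    proof
      fix g assume g: "g \<in> {g. g < b \<and> f b g \<noteq> w g}"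
      then have "idx g \<le> idx b" "g \<le> s (idx g)" using b idx_mono idx by auto
      moreover have "g \<in> ?D (idx g)"
        using g \<open>g \<le> s (idx g)\<close> by (cases "g = s (idx g)") (auto simp: w_def)
      ultimately show "g \<in> (\<Union>n\<le>idx b. ?D n)" by blast
    qed
    then show ?thesis by (rule finite_subset) (use D in auto)
  qed
  show ?thesis unfolding weights_def using wpos 1 2 3 by blast
qed

text \<open>The condition at stage \<open>a\<close> reads \<open>f\<close> only below
  \<open>a\<close>, so dependent choice along the well-order applies, and the stages are the bottom,
  successors and limits.\<close>

lemma weights_exist:
  assumes "\<And>a. infinite (I a)"
  obtains m where "\<And>a. weights I m a (m a)"
proof -
  have "\<exists>m. \<forall>a. weights I m a (m a)"
  proof (rule dependent_wf_choice[of "{(x, y :: cord). x < y}" "weights I"])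
    show "wf {(x, y :: cord). x < y}" by (rule wf)
    show "weights I f x r = weights I g x r" if "\<And>z. (z, x) \<in> {(x, y). x < y} \<Longrightarrow> f z = g z" for f g x r
      using that by (simp add: weights_def cong: conj_cong)
    fix a f assume W: "\<And>y. (y, a) \<in> {(x, y). x < y} \<Longrightarrow> weights I f y (f y)"
    consider "a = bot" | "limit_cord a" | b where "b < a" "\<forall>g<a. g \<le> b"
      unfolding limit_cord_def by (metis not_less)
    then show "\<exists>r. weights I f a r"
      by cases (use W weights_bot weights_limit[OF _ assms] weights_succ in auto)
  qed
  then show ?thesis using that by blast
qed

subsection \<open>The long ray as an ordered topological space\<close>

text \<open>A copy of the open long ray as a type carries its order topology as a class instance, so
  continuity and limits can be treated without explicit topologies; \<open>emb\<close> later relates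
  it to \<open>long_ray\<close>.\<close>

typedef lray = "{p :: cord \<times> real. 0 \<le> snd p \<and> snd p < 1 \<and> p \<noteq> (bot, 0)}"
  morphisms pair_of_lray lray_of_pair
  by (rule exI[of _ "(bot, 1/2)"]) auto

definition blk :: "lray \<Rightarrow> cord" where "blk x = fst (pair_of_lray x)"
definition off :: "lray \<Rightarrow> real" where "off x = snd (pair_of_lray x)"
definition lpt :: "cord \<Rightarrow> real \<Rightarrow> lray" where "lpt a t = lray_of_pair (a, t)"

abbreviation mid :: lray where "mid \<equiv> lpt bot (1/2)"

lemma off_bounds: "0 \<le> off x" "off x < 1" and off_pos: "blk x = bot \<Longrightarrow> 0 < off x"
  using pair_of_lray[of x] by (auto simp: off_def blk_def prod_eq_iff less_le)

lemma blk_off_lpt: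
  assumes "0 \<le> t" "t < 1" "a \<noteq> bot \<or> t \<noteq> 0"
  shows "blk (lpt a t) = a" "off (lpt a t) = t"
  using assms by (auto simp: blk_def off_def lpt_def lray_of_pair_inverse)

lemma lpt_blk_off: "lpt (blk x) (off x) = x"
  by (simp add: lpt_def blk_def off_def pair_of_lray_inverse)

lemma lray_eqI: "blk x = blk y \<Longrightarrow> off x = off y \<Longrightarrow> x = y"
  by (metis lpt_blk_off)

instantiation lray :: linorder
begin
definition less_eq_lray :: "lray \<Rightarrow> lray \<Rightarrow> bool" where
  "x \<le> y \<longleftrightarrow> blk x < blk y \<or> blk x = blk y \<and> off x \<le> off y"
definition less_lray :: "lray \<Rightarrow> lray \<Rightarrow> bool" where
  "x < y \<longleftrightarrow> blk x < blk y \<or> blk x = blk y \<and> off x < off y"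
instance by standard (auto simp: less_eq_lray_def less_lray_def intro: lray_eqI)
end

instance lray :: dense_linorder
proof
  fix x y :: lray assume "x < y"
  then consider "blk x < blk y" | "blk x = blk y" "off x < off y" unfolding less_lray_def by auto
  then show "\<exists>z. x < z \<and> z < y"
  proof cases
    case 1
    have "x < lpt (blk x) ((off x + 1) / 2) \<and> lpt (blk x) ((off x + 1) / 2) < y"
      using off_bounds[of x] 1 by (auto simp: less_lray_def blk_off_lpt)
    then show ?thesis by blast
  next
    case 2
    have "x < lpt (blk x) ((off x + off y) / 2) \<and> lpt (blk x) ((off x + off y) / 2) < y"
      using off_bounds[of x] off_bounds[of y] 2 by (auto simp: less_lray_def blk_off_lpt)
    then show ?thesis by blast
  qed
qed

instantiation lray :: linorder_topology
begin
definition open_lray :: "lray set \<Rightarrow> bool" where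
  "open_lray = generate_topology (range (\<lambda>a. {..<a}) \<union> range (\<lambda>a. {a<..}))"
instance by standard (simp add: open_lray_def)
end

definition below :: "cord \<Rightarrow> lray set" where "below a = {x. blk x < a}"

lemma below_eq: "a \<noteq> bot \<Longrightarrow> below a = {..<lpt a 0}"
  by (auto simp: below_def less_lray_def blk_off_lpt leD[OF off_bounds(1)])

lemma open_below: "open (below a)"
  by (cases "a = bot") (auto simp: below_eq, auto simp: below_def)

lemma below_mono: "a \<le> b \<Longrightarrow> below a \<subseteq> below b"
  by (auto simp: below_def)

lemma lpt_less_iff: "a \<noteq> bot \<Longrightarrow> b \<noteq> bot \<Longrightarrow> lpt a 0 < lpt b 0 \<longleftrightarrow> a < b"
  by (auto simp: less_lray_def blk_off_lpt)

lemma lessThan_bot_cord: "{..<bot :: cord} = {}"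
  by auto

subsection \<open>Cumulative coordinate functions\<close>

text \<open>The shape of a coordinate inside one block, rising from \<open>0\<close> to the length
  \<open>l\<close>. As a parameter it lets one development serve both \<open>phi\<close>, with
  \<open>shrink\<close>, and \<open>kap\<close>, with \<open>step_profile\<close>.\<close>

definition profile :: "(real \<Rightarrow> real \<Rightarrow> real) \<Rightarrow> bool" where
  "profile \<sigma> \<longleftrightarrow> (\<forall>l. 0 < l \<and> l \<le> 1 \<longrightarrow> \<sigma> l 0 = 0 \<and> \<sigma> l 1 = l \<and> continuous_on {0..1} (\<sigma> l)
     \<and> (\<forall>s t. 0 \<le> s \<and> s < t \<and> t \<le> 1 \<longrightarrow> \<sigma> l s < \<sigma> l t))"

definition step_profile :: "real \<Rightarrow> real \<Rightarrow> real" where "step_profile l t = l * step 1 t"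

lemma profile_shrink: "profile shrink"
  unfolding profile_def
  by (auto simp: shrink_le_0 shrink_ge_1 shrink_strict_mono intro: continuous_on_subset[OF continuous_on_shrink])

lemma profile_step: "profile step_profile"
proof -
  have "continuous_on UNIV (step 1)"
    using smooth_on_step[of 1] Ck_on_continuous_on unfolding smooth_on_def by fastforce
  then show ?thesis
    unfolding profile_def step_profile_def
    by (auto simp: step_le_0 step_ge step_strict_mono intro!: continuous_intros intro: continuous_on_subset)
qed

definition cum :: "(cord \<Rightarrow> real) \<Rightarrow> (real \<Rightarrow> real \<Rightarrow> real) \<Rightarrow> lray \<Rightarrow> real" where
  "cum w \<sigma> x = infsum w {..<blk x} + \<sigma> (w (blk x)) (off x)"

definition wt :: "cord \<Rightarrow> (cord \<Rightarrow> real) \<Rightarrow> bool" where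
  "wt a w \<longleftrightarrow> (\<forall>g<a. 0 < w g \<and> w g \<le> 1) \<and> w summable_on {..<a}"

lemma wt_summable: "wt a w \<Longrightarrow> S \<subseteq> {..<a} \<Longrightarrow> w summable_on S"
  unfolding wt_def using summable_on_subset_banach by blast

lemma wt_infsum_mono:
  assumes "wt a w" "S \<subseteq> T" "T \<subseteq> {..<a}" shows "infsum w S \<le> infsum w T"
  using assms unfolding wt_def
  by (intro infsum_mono_neutral wt_summable[OF assms(1)]) (auto intro!: less_imp_le)

lemma wt_infsum_insert:
  assumes "wt a w" "b < a" shows "infsum w {..b} = infsum w {..<b} + w b"
proof -
  have "{..b} = insert b {..<b}" by auto
  moreover have "infsum w (insert b {..<b}) = w b + infsum w {..<b}"
    by (rule infsum_insert) (use assms in \<open>auto intro!: wt_summable\<close>)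
  ultimately show ?thesis by simp
qed

lemma infsum_step_le:
  assumes "wt a w" "c < b" "b \<le> a" shows "infsum w {..<c} + w c \<le> infsum w {..<b}"
proof -
  have "infsum w {..<c} + w c = infsum w {..c}"
    using wt_infsum_insert[OF assms(1), of c] assms by auto
  also have "\<dots> \<le> infsum w {..<b}" by (rule wt_infsum_mono[OF assms(1)]) (use assms in auto)
  finally show ?thesis .
qed

lemma infsum_wt_nonneg: assumes "wt a w" "b \<le> a" shows "0 \<le> infsum w {..<b}"
  by (rule infsum_nonneg) (use assms in \<open>auto simp: wt_def less_le_trans intro: less_imp_le\<close>)

context
  fixes a w \<sigma> assumes w: "wt a w" and \<sigma>: "profile \<sigma>"
begin

lemma profile_bounds:
  assumes "b < a" "0 \<le> t" "t < 1" shows "0 \<le> \<sigma> (w b) t" "\<sigma> (w b) t < w b"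
proof -
  have l: "0 < w b" "w b \<le> 1" using w assms by (auto simp: wt_def)
  have *: "\<sigma> (w b) 0 = 0" "\<sigma> (w b) 1 = w b" "\<And>s t. 0 \<le> s \<Longrightarrow> s < t \<Longrightarrow> t \<le> 1 \<Longrightarrow> \<sigma> (w b) s < \<sigma> (w b) t"
    using \<sigma> l unfolding profile_def by blast+
  show "0 \<le> \<sigma> (w b) t" using *(1) *(3)[of 0 t] assms by (cases "t = 0") auto
  show "\<sigma> (w b) t < w b" using *(2) *(3)[of t 1] assms by auto
qed

lemma cum_bounds:
  assumes "x \<in> below a" shows "infsum w {..<blk x} \<le> cum w \<sigma> x" "cum w \<sigma> x < infsum w {..<blk x} + w (blk x)"
  using profile_bounds[of "blk x" "off x"] off_bounds[of x] assms by (auto simp: cum_def below_def)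

lemma cum_strict_mono:
  assumes "x < y" "y \<in> below a" shows "cum w \<sigma> x < cum w \<sigma> y"
proof -
  have b: "blk x \<le> blk y" "blk y < a" using assms by (auto simp: less_lray_def below_def)
  show ?thesis
  proof (cases "blk x = blk y")
    case True
    have "0 < w (blk y)" "w (blk y) \<le> 1" using w b by (auto simp: wt_def)
    moreover have "off x < off y" using assms True by (simp add: less_lray_def)
    ultimately show ?thesis
      using \<sigma> off_bounds[of x] off_bounds[of y] True unfolding profile_def cum_def by simp
  next
    case False
    then have "blk x < blk y" using b by simp
    from infsum_step_le[OF w this] have "infsum w {..<blk x} + w (blk x) \<le> infsum w {..<blk y}"
      using b by simp
    moreover have "x \<in> below a" using b by (simp add: below_def)
    ultimately show ?thesis using cum_bounds(2)[of x] cum_bounds(1)[OF assms(2)] by linarith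
  qed
qed

lemma cum_pos: assumes "x \<in> below a" shows "0 < cum w \<sigma> x"
proof -
  have "0 < off x \<or> bot < blk x" using off_pos[of x] by (metis bot.not_eq_extremum)
  then have "lpt bot (if blk x = bot then off x / 2 else 1/2) < x" (is "?y < x")
    using off_bounds[of x] off_pos[of x] by (auto simp: less_lray_def blk_off_lpt bot.not_eq_extremum)
  then have "cum w \<sigma> ?y < cum w \<sigma> x" using assms by (rule cum_strict_mono)
  moreover have "0 \<le> cum w \<sigma> ?y"
  proof -
    have "blk ?y = bot" using off_bounds[of x] off_pos[of x] by (auto simp: blk_off_lpt)
    then have "?y \<in> below a" using assms by (auto simp: below_def intro: le_less_trans[OF bot_least])
    then show ?thesis using cum_bounds(1)[of ?y] infsum_wt_nonneg[OF w, of "blk ?y"]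
      by (auto simp: below_def less_imp_le)
  qed
  ultimately show ?thesis by linarith
qed

lemma cum_less: assumes "x \<in> below a" shows "cum w \<sigma> x < infsum w {..<a}"
  using cum_bounds(2)[OF assms] infsum_step_le[OF w, of "blk x" a] assms by (auto simp: below_def less_imp_le)

text \<open>The least \<open>g\<close> whose partial sum exceeds \<open>v\<close> is a successor: at
  a limit each finite sum is bounded by an earlier partial sum, hence by \<open>v\<close>. The
  intermediate value theorem in the block preceding \<open>g\<close> then gives the point.\<close>

lemma cum_surj:
  assumes "0 < v" "v < infsum w {..<a}" shows "\<exists>x\<in>below a. cum w \<sigma> x = v"
proof -
  define g where "g = (LEAST g. g \<le> a \<and> v < infsum w {..<g})"
  have g: "g \<le> a" "v < infsum w {..<g}"
    unfolding g_def using LeastI[of "\<lambda>g. g \<le> a \<and> v < infsum w {..<g}" a] assms by auto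
  have least: "infsum w {..<b} \<le> v" if "b < g" for b
  proof -
    have "\<not> (b \<le> a \<and> v < infsum w {..<b})" using that unfolding g_def by (rule not_less_Least)
    moreover have "b \<le> a" using that g(1) by (meson less_imp_le order_trans)
    ultimately show ?thesis by (simp add: not_less)
  qed
  have "\<exists>d<g. \<forall>c<g. c \<le> d"
  proof (rule ccontr)
    assume n: "\<not> ?thesis"
    have "infsum w {..<g} \<le> v"
    proof (rule infsum_le_finite_sums)
      show "w summable_on {..<g}" using g by (intro wt_summable[OF w]) auto
      fix F assume F: "finite F" "F \<subseteq> {..<g}"
      have "\<exists>d<g. F \<subseteq> {..<d}"
      proof (cases "F = {}")
        case True
        have "g \<noteq> bot" using g(2) assms(1) lessThan_bot_cord by auto
        then show ?thesis using True by (auto intro: exI[of _ bot] simp: bot.not_eq_extremum)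
      next
        case False
        then have "Max F < g" using F by (auto simp: Max_in subset_iff)
        then obtain d where "d < g" "Max F < d" using n by (auto simp: not_le)
        moreover have "x < d" if "x \<in> F" for x
          using Max_ge[OF F(1) that] \<open>Max F < d\<close> by (rule le_less_trans)
        ultimately show ?thesis by blast
      qed
      then obtain d where d: "d < g" "F \<subseteq> {..<d}" by blast
      have "sum w F \<le> infsum w {..<d}"
        by (rule finite_sum_le_infsum[OF wt_summable[OF w] F(1) d(2)])
          (use d g w in \<open>auto simp: wt_def dest: less_le_trans less_trans intro: less_imp_le\<close>)
      then show "sum w F \<le> v" using least[OF d(1)] by simp
    qed
    then show False using g by simp
  qed
  then obtain d where d: "d < g" "\<And>c. c < g \<Longrightarrow> c \<le> d" by blast
  then have "{..<g} = {..d}" by (meson atMost_iff equalityI le_less_trans lessThan_iff subsetI)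
  then have v: "infsum w {..<d} \<le> v" "v < infsum w {..<d} + w d"
    using wt_infsum_insert[OF w, of d] d(1) g least[OF d(1)] by auto
  have l: "0 < w d" "w d \<le> 1" "d < a" using w d g by (auto simp: wt_def)
  have p: "\<sigma> (w d) 0 = 0" "\<sigma> (w d) 1 = w d" "continuous_on {0..1} (\<sigma> (w d))"
    using \<sigma> l unfolding profile_def by blast+
  obtain t where t: "0 \<le> t" "t \<le> 1" "\<sigma> (w d) t = v - infsum w {..<d}"
    using IVT'[of "\<sigma> (w d)" 0 "v - infsum w {..<d}" 1] p v by auto
  have "t < 1" using t v p by (cases "t = 1") auto
  \<comment> \<open>The origin, which is missing from the ray, would have the value
    \<open>0\<close>, whereas \<open>v\<close> is positive.\<close>
  moreover have "d \<noteq> bot \<or> t \<noteq> 0"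
  proof (rule ccontr)
    assume "\<not> ?thesis"
    then have "d = bot" "t = 0" by auto
    moreover have "{..<bot::cord} = {}" by auto
    ultimately show False using t p assms by auto
  qed
  ultimately have "blk (lpt d t) = d" "off (lpt d t) = t" using t by (auto simp: blk_off_lpt)
  then show ?thesis using t l by (intro bexI[of _ "lpt d t"]) (auto simp: cum_def below_def)
qed

lemma cum_image: "cum w \<sigma> ` below a = {0<..<infsum w {..<a}}"
  using cum_pos cum_less cum_surj by fastforce

lemma cum_inj: "inj_on (cum w \<sigma>) (below a)"
  by (rule inj_onI) (metis cum_strict_mono less_irrefl linorder_less_linear)

lemma cum_le: "x \<le> y \<Longrightarrow> y \<in> below a \<Longrightarrow> cum w \<sigma> x \<le> cum w \<sigma> y"
  using cum_strict_mono[of x y] by (cases "x = y") (auto simp: less_le)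

text \<open>A monotone map with open image has no jumps, so surjectivity onto an interval replaces
  an analysis at limit ordinals.\<close>

lemma cum_continuous: "continuous_on (below a) (cum w \<sigma>)"
  by (rule continuous_onI_mono) (auto simp: cum_image cum_le)

lemma cum_inv_continuous: "continuous_on {0<..<infsum w {..<a}} (inv_into (below a) (cum w \<sigma>))"
proof (rule continuous_onI_mono)
  have "inv_into (below a) (cum w \<sigma>) ` (cum w \<sigma> ` below a) = below a"
    using cum_inj by (force simp: image_image inv_into_f_f)
  then show "open (inv_into (below a) (cum w \<sigma>) ` {0<..<infsum w {..<a}})"
    by (simp add: cum_image open_below)
  fix u v assume uv: "u \<in> {0<..<infsum w {..<a}}" "v \<in> {0<..<infsum w {..<a}}" "u \<le> v"
  let ?x = "inv_into (below a) (cum w \<sigma>) u" and ?y = "inv_into (below a) (cum w \<sigma>) v"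
  have "?x \<in> below a" "cum w \<sigma> ?x = u" "cum w \<sigma> ?y = v"
    using uv cum_image by (auto intro!: inv_into_into f_inv_into_f)
  then show "?x \<le> ?y" using cum_strict_mono[of ?y ?x] uv(3) by (metis not_less)
qed

lemma cum_homeomorphism:
  "homeomorphism (below a) {0<..<infsum w {..<a}} (cum w \<sigma>) (inv_into (below a) (cum w \<sigma>))"
  by (rule homeomorphismI[OF cum_continuous cum_inv_continuous])
    (use cum_image cum_inj in \<open>auto intro: inv_into_into f_inv_into_f simp: inv_into_f_f\<close>)

end

text \<open>\<open>H\<close> is the identity up to the start \<open>P\<close> of the changed block,
  carries the old block onto the new one through the unit block, and is a translation afterwards.
  \<open>stretch\<close> and \<open>shrink\<close> are translations outside their blocks, so the
  pieces fit smoothly; \<open>P \<ge> 1\<close> keeps \<open>[0, 1]\<close> fixed.\<close>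

lemma cum_transition1:
  assumes w: "wt a w" "wt a w'" and g0: "g0 < a" and eq: "\<And>g. g < a \<Longrightarrow> g \<noteq> g0 \<Longrightarrow> w g = w' g"
    and p: "infsum w {..<g0} \<ge> 1"
  shows "\<exists>H. smooth_on UNIV H \<and> (\<forall>v\<le>1. H v = v) \<and> strict_mono H
     \<and> (\<forall>x\<in>below a. cum w' shrink x = H (cum w shrink x))"
proof -
  define P where "P = infsum w {..<g0}"
  define l l' where "l = w g0" and "l' = w' g0"
  have l: "0 < l" "l \<le> 1" "0 < l'" "l' \<le> 1" using w g0 by (auto simp: wt_def l_def l'_def)
  define H where "H v = P + shrink l' (stretch l (v - P))" for v
  have "smooth_on UNIV H"
    unfolding H_def
    by (intro smooth_on_add smooth_on_const smooth_on_compose_UNIV[OF smooth_on_shrink[OF l(3,4)]]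
        smooth_on_compose_UNIV[OF smooth_on_stretch[OF l(1)]] smooth_on_diff smooth_on_id) auto
  moreover have low: "H v = v" if "v \<le> P" for v
    using that l by (simp add: H_def stretch_le_0 shrink_le_0)
  moreover have "strict_mono H"
    by (rule strict_monoI) (simp add: H_def shrink_strict_mono stretch_strict_mono l)
  moreover have "cum w' shrink x = H (cum w shrink x)" if x: "x \<in> below a" for x
  proof -
    have b: "blk x < a" using x by (simp add: below_def)
    have same: "infsum w' {..<g} = infsum w {..<g}" if "g \<le> g0" for g
      by (rule infsum_cong) (use eq that g0 in \<open>auto\<close>)
    consider "blk x < g0" | "blk x = g0" | "g0 < blk x" by force
    then show ?thesis
    proof cases
      case 1
      then have "cum w' shrink x = cum w shrink x" using same[of "blk x"] eq[OF b] by (simp add: cum_def)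
      moreover have "cum w shrink x \<le> P"
        using cum_bounds(2)[OF w(1) profile_shrink x] infsum_step_le[OF w(1) 1] g0 by (simp add: P_def less_imp_le)
      ultimately show ?thesis using low by simp
    next
      case 2
      then show ?thesis using same[of g0] l
        by (simp add: cum_def H_def P_def l_def l'_def shrink_stretch stretch_shrink)
    next
      case 3
      have ins: "{..<blk x} = insert g0 ({..<blk x} - {g0})" using 3 by auto
      have "infsum w {..<blk x} = l + infsum w ({..<blk x} - {g0})"
        unfolding l_def by (subst ins, rule infsum_insert) (use b in \<open>auto intro!: wt_summable[OF w(1)]\<close>)
      moreover have "infsum w' {..<blk x} = l' + infsum w' ({..<blk x} - {g0})"
        unfolding l'_def by (subst ins, rule infsum_insert) (use b in \<open>auto intro!: wt_summable[OF w(2)]\<close>)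
      moreover have "infsum w' ({..<blk x} - {g0}) = infsum w ({..<blk x} - {g0})"
        by (rule infsum_cong) (use eq b in auto)
      ultimately have "cum w' shrink x = cum w shrink x + l' - l"
        using eq[OF b] 3 by (simp add: cum_def)
      moreover have "P + l \<le> cum w shrink x"
        using infsum_step_le[OF w(1) 3] b cum_bounds(1)[OF w(1) profile_shrink x] by (simp add: P_def l_def less_imp_le)
      ultimately show ?thesis using l by (simp add: H_def stretch_ge shrink_ge_1)
    qed
  qed
  ultimately show ?thesis using p unfolding P_def by (intro exI[of _ H]) auto
qed

text \<open>The differing weights are changed one at a time. Both weights equal \<open>1\<close> at
  \<open>bot\<close>, so every changed block starts at \<open>1\<close> or later and the composed
  map still fixes everything up to \<open>1\<close>.\<close>

lemma cum_transition:
  assumes w: "wt a w" "wt a w'" and fin: "finite {g. g < a \<and> w g \<noteq> w' g}" and b: "w bot = 1" "w' bot = 1"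
  shows "\<exists>H. smooth_on UNIV H \<and> (\<forall>v\<le>1. H v = v) \<and> strict_mono H
     \<and> (\<forall>x\<in>below a. cum w' shrink x = H (cum w shrink x))"
proof -
  have "\<exists>H. smooth_on UNIV H \<and> (\<forall>v\<le>1. H v = v) \<and> strict_mono H
     \<and> (\<forall>x\<in>below a. cum w' shrink x = H (cum w shrink x))"
    if "finite F" "wt a w'" "w' bot = 1" "{g. g < a \<and> w g \<noteq> w' g} \<subseteq> F" for F w'
    using that
  proof (induction F arbitrary: w' rule: finite_induct)
    case empty
    have eq: "w' g = w g" if "g < a" for g using that empty by auto
    have "cum w' shrink x = cum w shrink x" if "x \<in> below a" for x
    proof -
      have "infsum w' {..<blk x} = infsum w {..<blk x}"
        by (rule infsum_cong) (use eq that in \<open>auto simp: below_def\<close>)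
      then show ?thesis using eq that by (simp add: cum_def below_def)
    qed
    then show ?case by (intro exI[of _ "\<lambda>v. v"]) (auto simp: smooth_on_id strict_mono_def)
  next
    case (insert g0 F)
    show ?case
    proof (cases "g0 < a \<and> g0 \<noteq> bot")
      case False
      then have "{g. g < a \<and> w g \<noteq> w' g} \<subseteq> F" using insert.prems b by auto
      then show ?thesis using insert.IH insert.prems by blast
    next
      case True
      define w'' where "w'' = w'(g0 := w g0)"
      have w'': "wt a w''"
      proof -
        have "w' summable_on {..<a} - {g0}" using insert.prems(1) by (intro wt_summable) auto
        then have "w'' summable_on {..<a} - {g0}"
          by (subst summable_on_cong[of _ w'' w']) (auto simp: w''_def)
        then have "w'' summable_on insert g0 ({..<a} - {g0})" by (simp only: summable_on_insert_iff)
        moreover have "insert g0 ({..<a} - {g0}) = {..<a}" using True by auto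
        ultimately show ?thesis using insert.prems(1) w(1) by (auto simp: wt_def w''_def)
      qed
      have "{g. g < a \<and> w g \<noteq> w'' g} \<subseteq> F" using insert.prems(3) by (auto simp: w''_def)
      moreover have "w'' bot = 1" using insert.prems b by (simp add: w''_def)
      ultimately obtain H1 where H1: "smooth_on UNIV H1" "\<forall>v\<le>1. H1 v = v" "strict_mono H1"
          "\<forall>x\<in>below a. cum w'' shrink x = H1 (cum w shrink x)"
        using insert.IH[OF w''] by blast
      have "bot < g0" using True by (simp add: bot.not_eq_extremum)
      then have "infsum w'' {..<bot} + w'' bot \<le> infsum w'' {..<g0}"
        using infsum_step_le[OF w''] True by (auto simp: less_imp_le)
      moreover have "{..<bot::cord} = {}" by auto
      ultimately have "infsum w'' {..<g0} \<ge> 1" using \<open>w'' bot = 1\<close> by simp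
      then obtain H2 where H2: "smooth_on UNIV H2" "\<forall>v\<le>1. H2 v = v" "strict_mono H2"
          "\<forall>x\<in>below a. cum w' shrink x = H2 (cum w'' shrink x)"
        using cum_transition1[OF w'' insert.prems(1), of g0] True by (auto simp: w''_def)
      show ?thesis
        using H1 H2 smooth_on_compose_UNIV[OF H2(1) open_UNIV H1(1)]
        by (intro exI[of _ "\<lambda>v. H2 (H1 v)"]) (auto simp: strict_mono_def)
    qed
  qed
  from this[OF fin w(2) b(2)] show ?thesis by blast
qed

text \<open>Each changed weight contributes its difference times a step that is \<open>0\<close>
  before its block and \<open>1\<close> after it. Expressed in the coordinate
  \<open>cum w shrink\<close> this step is smooth, and only finitely many are added.\<close>

lemma cum_step_transition:
  assumes w: "wt a w" and m: "wt a m" "wt a m'" and fin: "finite {g. g < a \<and> m g \<noteq> m' g}"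
  shows "\<exists>\<kappa>. smooth_on UNIV \<kappa> \<and> (\<forall>x\<in>below a. cum m' step_profile x = cum m step_profile x + \<kappa> (cum w shrink x))"
proof -
  define F where "F = {g. g < a \<and> m g \<noteq> m' g}"
  define \<kappa> where "\<kappa> u = (\<Sum>g\<in>F. (m' g - m g) * step 1 (stretch (w g) (u - infsum w {..<g})))" for u
  have wF: "0 < w g" "w g \<le> 1" if "g < a" for g using w that by (auto simp: wt_def)
  have F: "finite F" "\<And>g. g \<in> F \<Longrightarrow> g < a" using fin by (auto simp: F_def)
  have "smooth_on UNIV \<kappa>"
    unfolding \<kappa>_def
  proof (intro smooth_on_sum smooth_on_mult smooth_on_const F(1) open_UNIV)
    fix g assume "g \<in> F"
    then have "smooth_on UNIV (stretch (w g))" using wF F by (intro smooth_on_stretch) auto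
    moreover have "smooth_on UNIV (\<lambda>u. u - infsum w {..<g})"
      by (intro smooth_on_diff smooth_on_id smooth_on_const open_UNIV)
    ultimately have "smooth_on UNIV (\<lambda>u. stretch (w g) (u - infsum w {..<g}))"
      by (rule smooth_on_compose_UNIV[OF _ open_UNIV])
    then show "smooth_on UNIV (\<lambda>u. step 1 (stretch (w g) (u - infsum w {..<g})))"
      by (rule smooth_on_compose_UNIV[OF smooth_on_step[OF zero_less_one] open_UNIV])
  qed
  moreover have "cum m' step_profile x = cum m step_profile x + \<kappa> (cum w shrink x)" if x: "x \<in> below a" for x
  proof -
    define b where "b = blk x"
    have b: "b < a" using x by (simp add: b_def below_def)
    have st: "step 1 (stretch (w g) (cum w shrink x - infsum w {..<g})) =
        (if g < b then 1 else if g = b then step 1 (off x) else 0)" if "g < a" for g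
    proof -
      consider "g < b" | "g = b" | "b < g" by force
      then show ?thesis
      proof cases
        case 1
        have "infsum w {..<g} + w g \<le> cum w shrink x"
          using infsum_step_le[OF w 1] b cum_bounds(1)[OF w profile_shrink x] by (simp add: b_def less_imp_le)
        then show ?thesis using 1 wF[OF that] by (simp add: stretch_ge step_ge)
      next
        case 2
        then show ?thesis using wF[OF that] by (simp add: cum_def b_def stretch_shrink)
      next
        case 3
        have "cum w shrink x \<le> infsum w {..<g}"
          using infsum_step_le[OF w 3] that cum_bounds(2)[OF w profile_shrink x] by (simp add: b_def less_imp_le)
        then show ?thesis using 3 by (auto simp: stretch_le_0 step_le_0 dest: less_asym)
      qed
    qed
    have "(\<lambda>g. m' g - m g) summable_on (F \<inter> {..<b})" using F by (intro summable_on_finite) auto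
    moreover have z: "m' g - m g = 0" if "g \<in> {..<b} - F \<inter> {..<b}" for g
    proof -
      have "g < a" using that b by (auto intro: less_trans)
      then show ?thesis using that by (auto simp: F_def)
    qed
    ultimately have sd: "(\<lambda>g. m' g - m g) summable_on {..<b}"
      using summable_on_cong_neutral[of "F \<inter> {..<b}" "{..<b}" "\<lambda>g. m' g - m g" "\<lambda>g. m' g - m g"] by blast
    have "infsum m' {..<b} = infsum (\<lambda>g. m g + (m' g - m g)) {..<b}" by simp
    also have "\<dots> = infsum m {..<b} + infsum (\<lambda>g. m' g - m g) {..<b}"
      by (intro infsum_add sd wt_summable[OF m(1)]) (use b in auto)
    also have "infsum (\<lambda>g. m' g - m g) {..<b} = infsum (\<lambda>g. m' g - m g) (F \<inter> {..<b})"
      by (rule infsum_cong_neutral) (use z in auto)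
    also have "\<dots> = (\<Sum>g\<in>F \<inter> {..<b}. m' g - m g)" using F by (intro infsum_finite) auto
    finally have 1: "infsum m' {..<b} = infsum m {..<b} + (\<Sum>g\<in>F \<inter> {..<b}. m' g - m g)" .
    have "\<kappa> (cum w shrink x) = (\<Sum>g\<in>F. (if g < b then m' g - m g else 0) + (if g = b then (m' b - m b) * step 1 (off x) else 0))"
      unfolding \<kappa>_def by (rule sum.cong) (use st F in auto)
    also have "\<dots> = (\<Sum>g\<in>F. if g < b then m' g - m g else 0) + (\<Sum>g\<in>F. if g = b then (m' b - m b) * step 1 (off x) else 0)"
      by (rule sum.distrib)
    also have "(\<Sum>g\<in>F. if g < b then m' g - m g else 0) = (\<Sum>g\<in>F \<inter> {..<b}. m' g - m g)"
      using F(1) by (subst sum.inter_restrict) auto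
    also have "(\<Sum>g\<in>F. if g = b then (m' b - m b) * step 1 (off x) else 0) = (m' b - m b) * step 1 (off x)"
      using F(1) b by (auto simp: F_def)
    finally show ?thesis using 1 by (simp add: cum_def step_profile_def b_def algebra_simps)
  qed
  ultimately show ?thesis by blast
qed

lemma cum_lpt:
  assumes "a \<noteq> bot" "profile \<sigma>" "0 < w a" "w a \<le> 1" shows "cum w \<sigma> (lpt a 0) = infsum w {..<a}"
proof -
  have "\<sigma> (w a) 0 = 0" using assms unfolding profile_def by blast
  then show ?thesis using assms by (simp add: cum_def blk_off_lpt)
qed

lemma infsum_lessThan_diff:
  assumes "wt c w" "b \<le> a" "a \<le> c"
  shows "infsum w {..<a} - infsum w {..<b} = infsum w {b..<a}"
proof -
  have "{..<a} = {..<b} \<union> {b..<a}" using assms by auto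
  moreover have "infsum w ({..<b} \<union> {b..<a}) = infsum w {..<b} + infsum w {b..<a}"
    by (rule infsum_Un_disjoint) (use assms in \<open>auto intro!: wt_summable[OF assms(1)]\<close>)
  ultimately show ?thesis by simp
qed

subsection \<open>Identification with the long ray of the statement\<close>

definition emb :: "lray \<Rightarrow> lpoint" where "emb x = (rep_cord (blk x), off x)"
definition unemb :: "lpoint \<Rightarrow> lray" where "unemb p = lpt (abs_cord (fst p)) (snd p)"

lemma unemb_emb: "unemb (emb x) = x"
  by (simp add: unemb_def emb_def rep_cord_inverse lpt_blk_off)

lemma lr_less_emb: "lr_less (emb x) (emb y) \<longleftrightarrow> x < y"
  by (auto simp: lr_less_def emb_def less_lray_def less_cord_def rep_cord_inject)

lemma closed_long_ray_cases:
  assumes "p \<in> closed_long_ray_set"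
  obtains "p = (rep_cord bot, 0)" | x where "p = emb x"
proof (cases "p = (rep_cord bot, 0)")
  case False
  obtain a t where p: "p = (rep_cord a, t)" "0 \<le> t" "t < 1"
    using assms by (auto simp: closed_long_ray_set_def) (metis rep_cord_cases)
  then have "p = emb (lpt a t)" using False by (auto simp: emb_def blk_off_lpt)
  then show ?thesis using that by blast
qed (use that in blast)

lemma emb_in_closed: "emb x \<in> closed_long_ray_set"
  using off_bounds[of x] rep_cord[of "blk x"] by (auto simp: closed_long_ray_set_def emb_def)

lemma origin_less_emb: "lr_less (rep_cord bot, 0) (emb x)"
  using off_bounds[of x] off_pos[of x] bot_least[of "blk x"]
  by (auto simp: lr_less_def emb_def rep_cord_inject less_eq_cord_def)

lemma not_less_origin: "\<not> lr_less (emb x) (rep_cord bot, 0)"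
proof
  assume "lr_less (emb x) (rep_cord bot, 0)"
  then have "blk x < bot \<or> off x < 0"
    by (auto simp: lr_less_def emb_def rep_cord_inject less_cord_def)
  then show False using off_bounds[of x] by simp
qed

lemma origin_in_closed: "(rep_cord bot, 0) \<in> closed_long_ray_set"
  using rep_cord[of bot] by (simp add: closed_long_ray_set_def)

lemma long_ray_set_eq: "long_ray_set = range emb"
proof
  show "long_ray_set \<subseteq> range emb"
  proof
    fix p assume p: "p \<in> long_ray_set"
    then obtain q where q: "p \<in> closed_long_ray_set" "q \<in> closed_long_ray_set" "lr_less q p"
      by (auto simp: long_ray_set_def)
    from q(1) show "p \<in> range emb"
    proof (cases rule: closed_long_ray_cases)
      case 1
      from q(2) have False
      proof (cases rule: closed_long_ray_cases)
        case 1
        then show ?thesis using q(3) \<open>p = _\<close> by (simp add: lr_less_def)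
      next
        case (2 x)
        then show ?thesis using q(3) \<open>p = _\<close> not_less_origin by simp
      qed
      then show ?thesis ..
    qed auto
  qed
  show "range emb \<subseteq> long_ray_set"
    unfolding long_ray_set_def using emb_in_closed origin_in_closed origin_less_emb by blast
qed

lemma topspace_closed_long_ray: "topspace closed_long_ray = closed_long_ray_set"
  unfolding closed_long_ray_def order_topology_on_def topology_generated_by_topspace by auto

lemma topspace_long_ray: "topspace long_ray = range emb"
  unfolding long_ray_def topspace_subtopology topspace_closed_long_ray long_ray_set_eq
  using emb_in_closed by auto

lemma continuous_map_emb: "continuous_map euclidean long_ray emb"
  unfolding long_ray_def continuous_map_in_subtopology
proof
  show "emb \<in> topspace euclidean \<rightarrow> long_ray_set" by (auto simp: long_ray_set_eq)
  show "continuous_map euclidean closed_long_ray emb"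
    unfolding closed_long_ray_def order_topology_on_def continuous_on_generated_topo_iff
  proof (intro conjI allI impI)
    fix U assume "U \<in> {closed_long_ray_set} \<union> {{x \<in> closed_long_ray_set. lr_less a x} |a. a \<in> closed_long_ray_set}
      \<union> {{x \<in> closed_long_ray_set. lr_less x a} |a. a \<in> closed_long_ray_set}"
    then consider "U = closed_long_ray_set"
      | a where "a \<in> closed_long_ray_set" "U = {x \<in> closed_long_ray_set. lr_less a x}"
      | a where "a \<in> closed_long_ray_set" "U = {x \<in> closed_long_ray_set. lr_less x a}" by blast
    then have "open (emb -` U)"
    proof cases
      case 1
      then have "emb -` U = UNIV" using emb_in_closed by auto
      then show ?thesis by simp
    next
      case (2 a)
      from 2(1) show ?thesis
      proof (cases rule: closed_long_ray_cases)
        case 1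
        then have "emb -` U = UNIV" using 2 emb_in_closed origin_less_emb by auto
        then show ?thesis by simp
      next
        case (2 x)
        then have "emb -` U = {x<..}" using \<open>U = _\<close> emb_in_closed by (auto simp: lr_less_emb)
        then show ?thesis by simp
      qed
    next
      case (3 a)
      from 3(1) show ?thesis
      proof (cases rule: closed_long_ray_cases)
        case 1
        then have "emb -` U = {}" using 3 not_less_origin by auto
        then show ?thesis by simp
      next
        case (2 x)
        then have "emb -` U = {..<x}" using \<open>U = _\<close> emb_in_closed by (auto simp: lr_less_emb)
        then show ?thesis by simp
      qed
    qed
    then show "openin euclidean (emb -` U \<inter> topspace euclidean)" by simp
  qed (use emb_in_closed in auto)
qed

lemma continuous_map_unemb: "continuous_map long_ray euclidean unemb"
proof -
  have "openin long_ray {p \<in> topspace long_ray. unemb p \<in> V}" if "open V" for V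
  proof -
    have "generate_topology (range (\<lambda>a. {..<a}) \<union> range (\<lambda>a. {a<..})) V"
      using that unfolding open_lray_def .
    then show ?thesis
    proof (induction V rule: generate_topology.induct)
      case UNIV
      show ?case by simp
    next
      case (Int A B)
      then have "openin long_ray ({p \<in> topspace long_ray. unemb p \<in> A} \<inter> {p \<in> topspace long_ray. unemb p \<in> B})"
        by blast
      then show ?case by (rule back_subst[of "openin long_ray"]) auto
    next
      case (UN K)
      then have "openin long_ray (\<Union>A\<in>K. {p \<in> topspace long_ray. unemb p \<in> A})" by blast
      then show ?case by (rule back_subst[of "openin long_ray"]) auto
    next
      case (Basis V)
      have sub: "openin long_ray (range emb \<inter> W)" if "openin closed_long_ray W" for W
        unfolding long_ray_def long_ray_set_eq using that by (rule openin_subtopology_Int2)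
      have gen: "openin closed_long_ray {x \<in> closed_long_ray_set. lr_less x (emb a)}"
        "openin closed_long_ray {x \<in> closed_long_ray_set. lr_less (emb a) x}" for a
        unfolding closed_long_ray_def order_topology_on_def
        by (rule topology_generated_by_Basis; use emb_in_closed in blast)+
      from Basis obtain a where "V = {..<a} \<or> V = {a<..}" by auto
      then show ?case
      proof
        assume V: "V = {..<a}"
        have "{p \<in> topspace long_ray. unemb p \<in> V} = range emb \<inter> {x \<in> closed_long_ray_set. lr_less x (emb a)}"
          using emb_in_closed by (auto simp: topspace_long_ray unemb_emb V lr_less_emb)
        then show ?thesis using sub[OF gen(1)] by simp
      next
        assume V: "V = {a<..}"
        have "{p \<in> topspace long_ray. unemb p \<in> V} = range emb \<inter> {x \<in> closed_long_ray_set. lr_less (emb a) x}"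
          using emb_in_closed by (auto simp: topspace_long_ray unemb_emb V lr_less_emb)
        then show ?thesis using sub[OF gen(2)] by simp
      qed
    qed
  qed
  then show ?thesis by (auto simp: continuous_map_def)
qed

lemma homeomorphic_maps_unemb: "homeomorphic_maps long_ray euclidean unemb emb"
  unfolding homeomorphic_maps_def
  using continuous_map_emb continuous_map_unemb unemb_emb by (auto simp: topspace_long_ray)

definition emb2 :: "lray \<times> lray \<Rightarrow> lpoint \<times> lpoint" where "emb2 p = (emb (fst p), emb (snd p))"
definition unemb2 :: "lpoint \<times> lpoint \<Rightarrow> lray \<times> lray" where "unemb2 p = (unemb (fst p), unemb (snd p))"

lemma unemb2_emb2: "unemb2 (emb2 p) = p"
  by (simp add: unemb2_def emb2_def unemb_emb)

lemma homeomorphic_maps_unemb2: "homeomorphic_maps long_ray_sq euclidean unemb2 emb2"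
proof -
  have "homeomorphic_maps (prod_topology long_ray long_ray) (prod_topology euclidean euclidean)
     (\<lambda>(x, y). (unemb x, unemb y)) (\<lambda>(x, y). (emb x, emb y))"
    unfolding homeomorphic_maps_prod using homeomorphic_maps_unemb by blast
  then show ?thesis
    unfolding long_ray_sq_def euclidean_product_topology unemb2_def emb2_def
    by (simp add: case_prod_unfold)
qed

lemma topspace_long_ray_sq: "topspace long_ray_sq = range emb2"
proof -
  have "homeomorphic_map euclidean long_ray_sq emb2"
    using homeomorphic_maps_unemb2 homeomorphic_maps_sym homeomorphic_maps_imp_map by blast
  then show ?thesis using homeomorphic_imp_surjective_map by fastforce
qed

subsection \<open>Atlases\<close>

lemma Cr_on_smooth: "smooth_on S f \<Longrightarrow> Cr_on r S f"
  by (simp add: Cr_on_def smooth_on_def)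

lemma Cr_on_subset: "Cr_on r S f \<Longrightarrow> T \<subseteq> S \<Longrightarrow> Cr_on r T f"
  by (auto simp: Cr_on_def intro: Ck_on_subset)

lemma Cr_on_compose:
  fixes f :: "'a::real_normed_vector \<Rightarrow> 'b::euclidean_space"
  shows "open S \<Longrightarrow> open T \<Longrightarrow> Cr_on r S f \<Longrightarrow> Cr_on r T g \<Longrightarrow> f ` S \<subseteq> T \<Longrightarrow> Cr_on r S (\<lambda>x. g (f x))"
  unfolding Cr_on_def by (blast intro: Ck_on_compose)

lemma Cr_on_cong: "open S \<Longrightarrow> (\<And>x. x \<in> S \<Longrightarrow> f x = g x) \<Longrightarrow> Cr_on r S f \<Longrightarrow> Cr_on r S g"
  unfolding Cr_on_def by (blast intro: Ck_on_cong[of S f g])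

lemma Cr_on_local: "(\<And>x. x \<in> S \<Longrightarrow> \<exists>T. open T \<and> x \<in> T \<and> Cr_on r T f) \<Longrightarrow> Cr_on r S f"
  unfolding Cr_on_def
proof (intro allI impI)
  fix k
  assume "enat k \<le> r" "\<And>x. x \<in> S \<Longrightarrow> \<exists>T. open T \<and> x \<in> T \<and> (\<forall>k. enat k \<le> r \<longrightarrow> Ck_on k T f)"
  then show "Ck_on k S f" by (intro Ck_on_local) meson
qed

lemma is_chart_inj: "is_chart X c \<Longrightarrow> inj_on (snd c) (fst c)"
  using homeomorphic_imp_injective_map[of "subtopology X (fst c)"] openin_subset[of X "fst c"]
  by (fastforce simp: is_chart_def inf_absorb2)

lemma is_chart_open_image:
  assumes "is_chart X c" "openin X V" shows "open (snd c ` (fst c \<inter> V))"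
proof -
  have h: "homeomorphic_map (subtopology X (fst c)) (top_of_set (snd c ` fst c)) (snd c)"
    and o: "open (snd c ` fst c)" using assms by (auto simp: is_chart_def)
  have "openin (subtopology X (fst c)) (fst c \<inter> V)" using assms(2) by (rule openin_subtopology_Int2)
  then have "openin (top_of_set (snd c ` fst c)) (snd c ` (fst c \<inter> V))"
    using homeomorphic_imp_open_map[OF h] unfolding open_map_def by blast
  then show ?thesis using o openin_open_trans by blast
qed

lemma compatible_sym: "compatible r c d \<longleftrightarrow> compatible r d c"
  by (auto simp: compatible_def Int_commute split: prod.splits)

text \<open>Near each point the transition factors through a chart of \<open>A\<close> around that
  point, and differentiability is local.\<close>

lemma Cr_on_transition_trans:
  assumes c: "is_chart X c" and d: "is_chart X d" and A: "\<And>a. a \<in> A \<Longrightarrow> is_chart X a"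
    "topspace X \<subseteq> \<Union> (fst ` A)"
    and ca: "\<And>a. a \<in> A \<Longrightarrow> compatible r c a" and ad: "\<And>a. a \<in> A \<Longrightarrow> compatible r a d"
  shows "Cr_on r (snd c ` (fst c \<inter> fst d)) (snd d \<circ> inv_into (fst c) (snd c))"
proof (rule Cr_on_local)
  fix z assume "z \<in> snd c ` (fst c \<inter> fst d)"
  then obtain x where x: "z = snd c x" "x \<in> fst c" "x \<in> fst d" by auto
  then have "x \<in> topspace X" using c openin_subset unfolding is_chart_def by blast
  then obtain a where a: "a \<in> A" "x \<in> fst a" using A(2) by auto
  have o: "openin X (fst c)" "openin X (fst d)" "openin X (fst a)"
    using c d A(1)[OF a(1)] by (auto simp: is_chart_def)
  let ?S = "snd c ` (fst c \<inter> (fst d \<inter> fst a))" and ?T = "snd a ` (fst a \<inter> fst d)"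
  have S: "open ?S" using o by (intro is_chart_open_image[OF c]) auto
  have T: "open ?T" using o by (intro is_chart_open_image[OF A(1)[OF a(1)]]) auto
  have inv: "inv_into (fst c) (snd c) (snd c y) = y" if "y \<in> fst c" for y
    using is_chart_inj[OF c] that by (rule inv_into_f_f)
  have inva: "inv_into (fst a) (snd a) (snd a y) = y" if "y \<in> fst a" for y
    using is_chart_inj[OF A(1)[OF a(1)]] that by (rule inv_into_f_f)
  have 1: "Cr_on r ?S (snd a \<circ> inv_into (fst c) (snd c))"
    using ca[OF a(1)] by (auto simp: compatible_def split: prod.splits elim: Cr_on_subset)
  have 2: "Cr_on r ?T (snd d \<circ> inv_into (fst a) (snd a))"
    using ad[OF a(1)] by (auto simp: compatible_def split: prod.splits)
  have sub: "(snd a \<circ> inv_into (fst c) (snd c)) ` ?S \<subseteq> ?T" using inv by auto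
  have "Cr_on r ?S (snd d \<circ> inv_into (fst c) (snd c))"
    by (rule Cr_on_cong[OF S _ Cr_on_compose[OF S T 1 2 sub]]) (use inv inva in auto)
  then show "\<exists>T. open T \<and> z \<in> T \<and> Cr_on r T (snd d \<circ> inv_into (fst c) (snd c))"
    using S x a by (intro exI[of _ ?S]) auto
qed

lemma compatible_trans:
  assumes "is_chart X c" "is_chart X d" "\<And>a. a \<in> A \<Longrightarrow> is_chart X a" "topspace X \<subseteq> \<Union> (fst ` A)"
    "\<And>a. a \<in> A \<Longrightarrow> compatible r c a" "\<And>a. a \<in> A \<Longrightarrow> compatible r d a"
  shows "compatible r c d"
proof -
  have s: "\<And>a. a \<in> A \<Longrightarrow> compatible r a c" "\<And>a. a \<in> A \<Longrightarrow> compatible r a d"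
    using assms compatible_sym by blast+
  have "Cr_on r (snd c ` (fst c \<inter> fst d)) (snd d \<circ> inv_into (fst c) (snd c))"
    by (rule Cr_on_transition_trans[OF assms(1-5) s(2)])
  moreover have "Cr_on r (snd d ` (fst d \<inter> fst c)) (snd c \<circ> inv_into (fst d) (snd d))"
    by (rule Cr_on_transition_trans[OF assms(2,1,3,4,6) s(1)])
  ultimately show ?thesis by (auto simp: compatible_def Int_commute split: prod.splits)
qed

definition max_atlas :: "enat \<Rightarrow> 'x topology \<Rightarrow> ('x, 'e::euclidean_space) chart set \<Rightarrow> ('x, 'e) chart set" where
  "max_atlas r X A = {c. is_chart X c \<and> (\<forall>d\<in>A. compatible r c d)}"

lemma atlas_subset_max: "atlas r X A \<Longrightarrow> A \<subseteq> max_atlas r X A"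
  by (auto simp: atlas_def max_atlas_def)

lemma diff_structure_max_atlas:
  assumes A: "atlas r X A" shows "diff_structure r X (max_atlas r X A)"
proof -
  have A': "\<And>a. a \<in> A \<Longrightarrow> is_chart X a" "topspace X \<subseteq> \<Union> (fst ` A)" using A by (auto simp: atlas_def)
  have sub: "A \<subseteq> max_atlas r X A" by (rule atlas_subset_max[OF A])
  have "compatible r c d" if "c \<in> max_atlas r X A" "d \<in> max_atlas r X A" for c d
  proof (rule compatible_trans[OF _ _ A'])
    show "is_chart X c" "is_chart X d" "\<And>a. a \<in> A \<Longrightarrow> compatible r c a" "\<And>a. a \<in> A \<Longrightarrow> compatible r d a"
      using that unfolding max_atlas_def by blast+
  qed
  moreover have "\<Union> (fst ` max_atlas r X A) = topspace X"
  proof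
    show "\<Union> (fst ` max_atlas r X A) \<subseteq> topspace X"
      using openin_subset by (fastforce simp: max_atlas_def is_chart_def)
    show "topspace X \<subseteq> \<Union> (fst ` max_atlas r X A)" using A'(2) sub by blast
  qed
  ultimately have "atlas r X (max_atlas r X A)" unfolding atlas_def by (auto simp: max_atlas_def)
  then show ?thesis using sub unfolding diff_structure_def by (auto simp: max_atlas_def)
qed

text \<open>Smoothness of the identity is the compatibility of the charts. Reflexivity later turns
  non-diffeomorphism for distinct index sets into injectivity of the parametrisation.\<close>

lemma diffeomorphic_refl:
  assumes "diff_structure r X A" shows "diffeomorphic r X A X A"
proof -
  have "smooth_map r A A id"
    unfolding smooth_map_def
  proof (intro allI impI, elim conjE)
    fix U \<phi> V \<psi> assume "(U, \<phi>) \<in> A" "(V, \<psi>) \<in> A"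
    then have "compatible r (U, \<phi>) (V, \<psi>)" using assms unfolding diff_structure_def atlas_def by blast
    then show "Cr_on r (\<phi> ` (U \<inter> id -` V)) (\<psi> \<circ> id \<circ> inv_into U \<phi>)" by (simp add: compatible_def)
  qed
  moreover have "homeomorphic_maps X X id id" by (simp add: homeomorphic_maps_def)
  ultimately show ?thesis unfolding diffeomorphic_def by blast
qed

subsection \<open>The twisted structures\<close>

definition weight_family :: "(cord \<Rightarrow> nat set) \<Rightarrow> (cord \<Rightarrow> cord \<Rightarrow> real) \<Rightarrow> bool" where
  "weight_family I m \<longleftrightarrow> (\<forall>a. weights I m a (m a))"

text \<open>The first block has length exactly \<open>1\<close> for every choice of weights. Hence
  \<open>phi\<close> is \<open>off\<close> on it in all charts, and the region \<open>v < 1\<close>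
  moved by \<open>flow\<close> is this block.\<close>

definition len :: "(cord \<Rightarrow> real) \<Rightarrow> cord \<Rightarrow> real" where
  "len u g = (if g = bot then 1 else (u g)\<^sup>2)"

definition phi :: "(cord \<Rightarrow> cord \<Rightarrow> real) \<Rightarrow> cord \<Rightarrow> lray \<Rightarrow> real" where
  "phi m a = cum (len (m a)) shrink"

definition kap :: "(cord \<Rightarrow> cord \<Rightarrow> real) \<Rightarrow> cord \<Rightarrow> lray \<Rightarrow> real" where
  "kap m a = cum (m a) step_profile"

abbreviation square :: "cord \<Rightarrow> (lray \<times> lray) set" where
  "square a \<equiv> below a \<times> below a"

definition twist :: "(cord \<Rightarrow> cord \<Rightarrow> real) \<Rightarrow> cord \<Rightarrow> lray \<times> lray \<Rightarrow> real \<times> real" where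
  "twist m a p = (phi m a (fst p), flow (kap m a (fst p)) (phi m a (snd p)))"

abbreviation chart_map :: "(cord \<Rightarrow> cord \<Rightarrow> real) \<Rightarrow> cord \<Rightarrow> lpoint \<times> lpoint \<Rightarrow> real \<times> real" where
  "chart_map m a \<equiv> twist m a \<circ> unemb2"

lemma wt_restrict: "wt b w \<Longrightarrow> a \<le> b \<Longrightarrow> wt a w"
  using wt_summable[of b w "{..<a}"] by (auto simp: wt_def dest: less_le_trans)

lemma weights_wt: assumes "weights I m a w" shows "wt a w"
proof -
  have w: "\<And>g. w g > 0" "w summable_on {..<a}" "infsum w {..<a} < 1" using assms by (auto simp: weights_def)
  have "w g \<le> 1" if "g < a" for g
  proof -
    have "sum w {g} \<le> infsum w {..<a}"
      by (rule finite_sum_le_infsum[OF w(2)]) (use that w(1) in \<open>auto intro: less_imp_le\<close>)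
    then show ?thesis using w(3) by simp
  qed
  then show ?thesis using w by (simp add: wt_def)
qed

lemma wt_len: assumes "wt a w" shows "wt a (len w)"
proof -
  have "len w summable_on {..<a}"
  proof (cases "a = bot")
    case False
    have "w summable_on {..<a} - {bot}" by (rule wt_summable[OF assms]) auto
    then have "len w summable_on {..<a} - {bot}"
    proof (rule summable_on_comparison_test)
      fix g assume "g \<in> {..<a} - {bot}"
      then have g: "0 < w g" "w g \<le> 1" "g \<noteq> bot" using assms by (auto simp: wt_def)
      then show "len w g \<le> w g" "0 \<le> len w g"
        using mult_left_le[of "w g" "w g"] by (auto simp: len_def power2_eq_square)
    qed
    then have "len w summable_on insert bot ({..<a} - {bot})" by (simp only: summable_on_insert_iff)
    moreover have "insert bot ({..<a} - {bot}) = {..<a}" using False by (auto simp: bot.not_eq_extremum)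
    ultimately show ?thesis by simp
  qed (simp add: lessThan_bot_cord)
  moreover have "0 < len w g \<and> len w g \<le> 1" if "g < a" for g
  proof -
    have "0 < w g" "w g \<le> 1" using assms that by (auto simp: wt_def)
    then show ?thesis using power_le_one[of "w g" 2] by (simp add: len_def)
  qed
  ultimately show ?thesis by (simp add: wt_def)
qed

context
  fixes I m assumes wf: "weight_family I m"
begin

lemma wt_m: "wt a (m a)"
  using wf weights_wt unfolding weight_family_def by blast

lemma wt_len_m: "wt a (len (m a))"
  by (rule wt_len[OF wt_m])

lemma m_pos: "m a g > 0"
  using wf unfolding weight_family_def weights_def by blast

lemma infsum_m_less: "infsum (m a) {..<a} < 1"
  using wf unfolding weight_family_def weights_def by blast

lemma finite_m_diff: "a < b \<Longrightarrow> finite {g. g < a \<and> m a g \<noteq> m b g}"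
  using wf unfolding weight_family_def weights_def by blast

lemma finite_m_diff_min: "finite {g. g < min a b \<and> m a g \<noteq> m b g}"
proof (cases a b rule: linorder_cases)
  case less
  then have "min a b = a" by (rule min_absorb1[OF less_imp_le])
  then show ?thesis using finite_m_diff[OF less] by (simp only:)
next
  case equal
  then show ?thesis by simp
next
  case greater
  then have "min a b = b" by (rule min_absorb2[OF less_imp_le])
  moreover have "{g. g < b \<and> m a g \<noteq> m b g} \<subseteq> {g. g < b \<and> m b g \<noteq> m a g}"
    by (rule Collect_mono) metis
  ultimately show ?thesis using finite_subset[OF _ finite_m_diff[OF greater]] by (simp only:)
qed

lemma in_window_m: "limit_cord a \<Longrightarrow> b < a \<Longrightarrow> in_window (I a) (infsum (m a) {b..<a})"
  using wf unfolding weight_family_def weights_def by blast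

lemma phi_pos: "x \<in> below a \<Longrightarrow> 0 < phi m a x"
  unfolding phi_def by (rule cum_pos[OF wt_len_m profile_shrink])

lemma kap_bounds: "x \<in> below a \<Longrightarrow> 0 < kap m a x" "x \<in> below a \<Longrightarrow> kap m a x < 1"
  using cum_pos[OF wt_m profile_step] cum_less[OF wt_m profile_step] infsum_m_less[of a]
  unfolding kap_def by fastforce+

lemma phi_bot: "blk x = bot \<Longrightarrow> phi m a x = off x"
  by (simp add: phi_def cum_def lessThan_bot_cord len_def shrink_1)

lemma phi_ge_1: assumes "x \<in> below a" "blk x \<noteq> bot" shows "1 \<le> phi m a x"
proof -
  have "infsum (len (m a)) {..<bot} + len (m a) bot \<le> infsum (len (m a)) {..<blk x}"
    by (rule infsum_step_le[OF wt_len_m]) (use assms in \<open>auto simp: below_def bot.not_eq_extremum less_imp_le\<close>)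
  also have "\<dots> \<le> phi m a x"
    unfolding phi_def by (rule cum_bounds(1)[OF wt_len_m profile_shrink assms(1)])
  finally show ?thesis by (simp add: lessThan_bot_cord len_def)
qed

lemma phi_inj: "inj_on (phi m a) (below a)"
  unfolding phi_def by (rule cum_inj[OF wt_len_m profile_shrink])

lemma phi_continuous: "continuous_on (below a) (phi m a)"
  unfolding phi_def by (rule cum_continuous[OF wt_len_m profile_shrink])

lemma kap_continuous: "continuous_on (below a) (kap m a)"
  unfolding kap_def by (rule cum_continuous[OF wt_m profile_step])

text \<open>In the coordinates \<open>phi\<close> the twist is a continuous map of an open square,
  injective because each \<open>flow\<close> map is. Invariance of domain supplies the open image
  and the continuous inverse.\<close>

lemma twist_homeomorphism:
  "open (twist m a ` (square a)) \<and>
   (\<exists>g. homeomorphism (square a) (twist m a ` (square a)) (twist m a) g)"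
proof -
  let ?J = "{0<..<infsum (len (m a)) {..<a}}"
  obtain h where h: "homeomorphism (below a) ?J (phi m a) h"
    using cum_homeomorphism[OF wt_len_m profile_shrink] unfolding phi_def by blast
  have im: "phi m a ` below a = ?J" and hc: "continuous_on ?J h" and hJ: "h ` ?J = below a"
    using h by (auto simp: homeomorphism_def)
  let ?k = "\<lambda>u. kap m a (h u)"
  define \<Psi> where "\<Psi> p = (fst p, flow (?k (fst p)) (snd p))" for p :: "real \<times> real"
  have kc: "continuous_on ?J ?k"
    by (rule continuous_on_compose2[OF kap_continuous hc]) (use hJ in auto)
  have kb: "0 < ?k u" "?k u < 1" if "u \<in> ?J" for u
    using that hJ kap_bounds[of "h u"] by blast+
  have fc: "continuous_on ({-1<..<1} \<times> {0<..}) (\<lambda>p. flow (fst p) (snd p))"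
    using smooth_on_flow Ck_on_continuous_on unfolding smooth_on_def by blast
  have "continuous_on (?J \<times> ?J) (\<lambda>p. (?k (fst p), snd p))"
    by (intro continuous_intros continuous_on_compose2[OF kc]) auto
  then have "continuous_on (?J \<times> ?J) (\<lambda>p. flow (?k (fst p)) (snd p))"
    using continuous_on_compose2[OF fc, of "?J \<times> ?J" "\<lambda>p. (?k (fst p), snd p)"] kb by fastforce
  then have \<Psi>c: "continuous_on (?J \<times> ?J) \<Psi>"
    unfolding \<Psi>_def by (intro continuous_intros)
  have \<Psi>i: "inj_on \<Psi> (?J \<times> ?J)"
  proof (rule inj_onI)
    fix p q assume pq: "p \<in> ?J \<times> ?J" "q \<in> ?J \<times> ?J" "\<Psi> p = \<Psi> q"
    then have 1: "fst p = fst q" "flow (?k (fst p)) (snd p) = flow (?k (fst p)) (snd q)"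
      by (auto simp: \<Psi>_def)
    have "fst p \<in> ?J" "0 < snd p" "0 < snd q" using pq(1,2) by auto
    then have "snd p = snd q" using kb(1)[of "fst p"] by (intro flow_inj[OF _ _ _ 1(2)]) auto
    then show "p = q" using 1(1) by (rule prod_eqI[rotated])
  qed
  have o: "open (?J \<times> ?J)" by (intro open_Times) auto
  obtain g where g: "homeomorphism (?J \<times> ?J) (\<Psi> ` (?J \<times> ?J)) \<Psi> g"
    using invariance_of_domain_homeomorphism[OF o \<Psi>c _ \<Psi>i] by auto
  have 2: "homeomorphism (square a) (?J \<times> ?J) (\<lambda>p. (phi m a (fst p), phi m a (snd p))) (\<lambda>p. (h (fst p), h (snd p)))"
  proof (rule homeomorphismI)
    show "continuous_on (square a) (\<lambda>p. (phi m a (fst p), phi m a (snd p)))"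
      by (intro continuous_on_Pair continuous_on_compose2[OF phi_continuous] continuous_on_fst continuous_on_snd
          continuous_on_id) auto
    show "continuous_on (?J \<times> ?J) (\<lambda>p. (h (fst p), h (snd p)))"
      by (intro continuous_on_Pair continuous_on_compose2[OF hc] continuous_on_fst continuous_on_snd
          continuous_on_id) auto
  qed (use im hJ homeomorphism_apply1[OF h] homeomorphism_apply2[OF h] in auto)
  have eq: "(\<Psi> \<circ> (\<lambda>p. (phi m a (fst p), phi m a (snd p)))) p = twist m a p" if "p \<in> square a" for p
    using that h by (auto simp: \<Psi>_def twist_def homeomorphism_def)
  from homeomorphism_compose[OF 2 g]
  have hom: "homeomorphism (square a) (\<Psi> ` (?J \<times> ?J)) (twist m a) ((\<lambda>p. (h (fst p), h (snd p))) \<circ> g)"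
    by (rule homeomorphism_cong[OF _ refl refl]) (use eq in auto)
  then have im: "twist m a ` (square a) = \<Psi> ` (?J \<times> ?J)" by (rule homeomorphism_image1)
  have "open (\<Psi> ` (?J \<times> ?J))" by (rule invariance_of_domain[OF \<Psi>c o \<Psi>i])
  then show ?thesis unfolding im using hom by blast
qed

text \<open>Changing weights acts as \<open>H\<close> on \<open>phi\<close> and adds the smooth
  \<open>\<kappa>\<close> to \<open>kap\<close>. The flow through \<open>kap m b x\<close> therefore
  consists of the one already present through \<open>kap m a x\<close> and a further one through
  \<open>\<kappa>\<close>, and only the latter enters \<open>T\<close>.\<close>

lemma twist_transition:
  defines "c \<equiv> \<lambda>a b. min a b"
  shows "\<exists>T. smooth_on (twist m a ` (square (c a b))) T \<and>
     (\<forall>p\<in>square (c a b). twist m b p = T (twist m a p))"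
proof -
  let ?c = "c a b" and ?W = "square (c a b)"
  have c: "?c \<le> a" "?c \<le> b" by (auto simp: c_def)
  have sub: "below ?c \<subseteq> below a" "below ?c \<subseteq> below b" using c by (auto intro: below_mono[THEN subsetD])
  have fin: "finite {g. g < ?c \<and> m a g \<noteq> m b g}" using finite_m_diff_min by (simp add: c_def)
  have w: "wt ?c (m a)" "wt ?c (m b)" "wt ?c (len (m a))" "wt ?c (len (m b))"
    using wt_restrict[OF wt_m c(1)] wt_restrict[OF wt_m c(2)] wt_len by auto
  have "finite {g. g < ?c \<and> len (m a) g \<noteq> len (m b) g}"
    by (rule finite_subset[OF _ fin]) (auto simp: len_def)
  moreover have "len (m a) bot = 1" "len (m b) bot = 1" by (simp_all add: len_def)
  ultimately obtain H where H: "smooth_on UNIV H" "\<forall>v\<le>1. H v = v" "strict_mono H"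
      "\<forall>x\<in>below ?c. phi m b x = H (phi m a x)"
    using cum_transition[OF w(3,4)] unfolding phi_def by blast
  obtain \<kappa> where \<kappa>: "smooth_on UNIV \<kappa>"
      "\<forall>x\<in>below ?c. kap m b x = kap m a x + \<kappa> (phi m a x)"
    using cum_step_transition[OF w(3,1,2) fin] unfolding kap_def phi_def by blast
  define T where "T p = (H (fst p), flow (\<kappa> (fst p)) (H (snd p)))" for p :: "real \<times> real"
  let ?S = "twist m a ` ?W"
  have ow: "open ?W" by (intro open_Times open_below)
  have S: "open ?S"
  proof -
    obtain g where g: "homeomorphism (square a) (twist m a ` (square a)) (twist m a) g"
      using twist_homeomorphism by blast
    have "openin (top_of_set (square a)) ?W"
      using ow sub by (intro open_subset) auto
    then have "openin (top_of_set (twist m a ` (square a))) ?S"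
      using homeomorphism_imp_open_map[OF g] by blast
    then show ?thesis using twist_homeomorphism[of a] openin_open_trans by blast
  qed
  have H0: "H 0 = 0" "H 1 = 1" using H(2) by auto
  have Hpos: "H v > 0" if "v > 0" for v using strict_monoD[OF H(3) that] H0 by simp
  have "smooth_on ?S (\<lambda>p. (\<kappa> (fst p), H (snd p)))"
    by (intro smooth_on_Pair S smooth_on_compose_UNIV[OF \<kappa>(1)] smooth_on_compose_UNIV[OF H(1)] smooth_on_fst smooth_on_snd)
  \<comment> \<open>On the image, \<open>\<kappa>\<close> is a difference of two values of
    \<open>kap\<close>, both between \<open>0\<close> and \<open>1\<close>, so it stays in the
    parameter range where \<open>flow\<close> is smooth.\<close>
  moreover have "(\<kappa> (fst p), H (snd p)) \<in> {-1<..<1} \<times> {0<..}" if pS: "p \<in> ?S" for p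
  proof -
    obtain q where "p = twist m a q" "q \<in> ?W" using pS by blast
    then have q: "p = twist m a q" "fst q \<in> below ?c" "snd q \<in> below ?c" by (simp_all add: mem_Times_iff)
    have qm: "fst q \<in> below a" "fst q \<in> below b" "snd q \<in> below a" using q(2,3) sub by blast+
    have "kap m b (fst q) = kap m a (fst q) + \<kappa> (fst p)" using \<kappa>(2) q by (simp add: twist_def)
    then have "\<kappa> (fst p) < 1" "-1 < \<kappa> (fst p)"
      using kap_bounds[OF qm(1)] kap_bounds[OF qm(2)] by auto
    moreover have "0 < snd p"
      using q(1) flow_pos[OF phi_pos[OF qm(3)], of "kap m a (fst q)"] kap_bounds(1)[OF qm(1)] by (simp add: twist_def)
    ultimately show ?thesis using Hpos by simp
  qed
  ultimately have "smooth_on ?S (\<lambda>p. flow (fst (\<kappa> (fst p), H (snd p))) (snd (\<kappa> (fst p), H (snd p))))"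
    by (intro smooth_on_compose[OF smooth_on_flow _ S]) (auto intro!: open_Times)
  moreover have "smooth_on ?S (\<lambda>p. H (fst p))"
    by (intro smooth_on_compose_UNIV[OF H(1)] S smooth_on_fst)
  ultimately have "smooth_on ?S T" unfolding T_def using smooth_on_Pair[OF S] by simp
  moreover have "twist m b p = T (twist m a p)" if pW: "p \<in> ?W" for p
  proof -
    obtain x y where p: "p = (x, y)" "x \<in> below ?c" "y \<in> below ?c" using pW by auto
    have pm: "x \<in> below a" "x \<in> below b" "y \<in> below a" using p(2,3) sub by blast+
    have k: "0 < kap m a x" "0 < kap m b x" "kap m b x = kap m a x + \<kappa> (phi m a x)"
      using kap_bounds(1)[OF pm(1)] kap_bounds(1)[OF pm(2)] \<kappa>(2) p by auto
    let ?v = "phi m a y"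
    have v: "0 < ?v" "phi m b y = H ?v" using phi_pos[OF pm(3)] H(4) p by auto
    \<comment> \<open>\<open>H\<close> commutes with the flow: below \<open>1\<close> it is the
      identity, and from \<open>1\<close> on the flow is.\<close>
    have "flow (kap m b x) (H ?v) = flow (\<kappa> (phi m a x)) (H (flow (kap m a x) ?v))"
    proof (cases "?v < 1")
      case True
      have "flow (kap m a x) ?v < 1"
        using lift1_flow(1)[OF True] lift1_ge[OF v(1) True] k(1) by force
      then have "H (flow (kap m a x) ?v) = flow (kap m a x) ?v" "H ?v = ?v" using H(2) True by auto
      then show ?thesis using flow_flow[OF v(1), of "kap m a x" "\<kappa> (phi m a x)"] k by simp
    next
      case False
      then have "H ?v \<ge> 1" using H0 strict_mono_less_eq[OF H(3), of 1 ?v] by simp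
      then show ?thesis using False by (simp add: flow_ge_1)
    qed
    then show ?thesis using p H(4) v(2) by (simp add: T_def twist_def)
  qed
  ultimately show ?thesis by blast
qed

definition twist_chart :: "cord \<Rightarrow> (lpoint \<times> lpoint, real \<times> real) chart" where
  "twist_chart a = (emb2 ` (square a), chart_map m a)"

lemma twist_chart_is_chart: "is_chart long_ray_sq (twist_chart a)"
proof -
  let ?W = "square a"
  have h: "homeomorphic_map long_ray_sq euclidean unemb2" "homeomorphic_map euclidean long_ray_sq emb2"
    using homeomorphic_maps_unemb2 homeomorphic_maps_sym homeomorphic_maps_imp_map by blast+
  have o: "openin long_ray_sq (emb2 ` ?W)"
    using homeomorphic_imp_open_map[OF h(2)] open_Times[OF open_below open_below] unfolding open_map_def by auto
  have im: "unemb2 ` emb2 ` ?W = ?W" by (simp add: image_image unemb2_emb2)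
  have "homeomorphic_map (subtopology long_ray_sq (emb2 ` ?W)) (subtopology euclidean ?W) unemb2"
  proof (rule homeomorphic_map_subtopologies[OF h(1)])
    have "range emb2 \<inter> emb2 ` ?W = emb2 ` ?W" by blast
    then show "unemb2 ` (topspace long_ray_sq \<inter> emb2 ` ?W) = topspace euclidean \<inter> ?W"
      using im by (simp add: topspace_long_ray_sq)
  qed
  moreover obtain g where g: "homeomorphism ?W (twist m a ` ?W) (twist m a) g" and ot: "open (twist m a ` ?W)"
    using twist_homeomorphism by blast
  then have "homeomorphic_map (top_of_set ?W) (top_of_set (twist m a ` ?W)) (twist m a)"
    unfolding homeomorphic_map_maps homeomorphic_maps_def homeomorphism_def
    by (intro exI[of _ g]) (auto simp: continuous_map_in_subtopology)
  ultimately have "homeomorphic_map (subtopology long_ray_sq (emb2 ` ?W)) (top_of_set (twist m a ` ?W)) (chart_map m a)"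
    by (rule homeomorphic_map_compose)
  moreover have "(chart_map m a) ` emb2 ` ?W = twist m a ` ?W" using im by (metis image_comp)
  ultimately show ?thesis using o ot by (simp add: is_chart_def twist_chart_def)
qed

lemma inv_twist_chart:
  "p \<in> square a \<Longrightarrow> inv_into (emb2 ` (square a)) (chart_map m a) (twist m a p) = emb2 p"
  using inv_into_f_f[OF is_chart_inj[OF twist_chart_is_chart[of a]], of "emb2 p"]
  by (simp add: twist_chart_def unemb2_emb2)

lemma twist_chart_compatible: "compatible r (twist_chart a) (twist_chart b)"
proof -
  have *: "Cr_on r ((chart_map m a) ` (emb2 ` (square a) \<inter> emb2 ` (square b)))
      (chart_map m b \<circ> inv_into (emb2 ` (square a)) (chart_map m a))" for a b
  proof -
    let ?W = "square (min a b)"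
    have "inj emb2" using unemb2_emb2 by (rule inj_on_inverseI)
    then have "emb2 ` (square a) \<inter> emb2 ` (square b) = emb2 ` ?W"
      by (simp add: image_Int[symmetric]) (auto simp: below_def)
    then have eq: "(chart_map m a) ` (emb2 ` (square a) \<inter> emb2 ` (square b)) = twist m a ` ?W"
      by (simp add: image_image unemb2_emb2)
    have o: "open (twist m a ` ?W)"
      using is_chart_open_image[OF twist_chart_is_chart[of a], of "emb2 ` (square b)"]
        twist_chart_is_chart[of b] eq by (simp add: is_chart_def twist_chart_def)
    obtain T where T: "smooth_on (twist m a ` ?W) T" "\<forall>p\<in>?W. twist m b p = T (twist m a p)"
      using twist_transition[of a b] by blast
    show ?thesis unfolding eq
    proof (rule Cr_on_cong[OF o _ Cr_on_smooth[OF T(1)]])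
      fix z assume "z \<in> twist m a ` ?W"
      then obtain p where p: "p \<in> ?W" "z = twist m a p" by auto
      then have "p \<in> square a" by (auto simp: below_def)
      then show "T z = (chart_map m b \<circ> inv_into (emb2 ` (square a)) (chart_map m a)) z"
        using bspec[OF T(2) p(1)] p(2) by (simp add: inv_twist_chart unemb2_emb2)
    qed
  qed
  show ?thesis using *[of a b] *[of b a] by (simp add: compatible_def twist_chart_def Int_commute)
qed

lemma atlas_twist: "atlas r long_ray_sq (range twist_chart)"
proof -
  have "p \<in> (\<Union>a. square a)" for p
  proof -
    obtain a where "max (blk (fst p)) (blk (snd p)) < a" using cord_gt_ex by blast
    then have "p \<in> square a" by (cases p) (auto simp: below_def)
    then show ?thesis by blast
  qed
  then have "(\<Union>a. square a) = UNIV" by blast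
  then have "range emb2 = (\<Union>a. emb2 ` (square a))" by (metis image_UN)
  moreover have "\<Union> (fst ` range twist_chart) = (\<Union>a. emb2 ` (square a))"
    by (simp add: image_image twist_chart_def)
  ultimately have "\<Union> (fst ` range twist_chart) = topspace long_ray_sq"
    by (simp only: topspace_long_ray_sq)
  moreover have "\<forall>c\<in>range twist_chart. is_chart long_ray_sq c"
    by (intro ballI) (elim rangeE, simp only: twist_chart_is_chart)
  moreover have "\<forall>c\<in>range twist_chart. \<forall>d\<in>range twist_chart. compatible r c d"
    by (intro ballI) (elim rangeE, simp only: twist_chart_compatible)
  ultimately show ?thesis unfolding atlas_def by (intro conjI)
qed

end

definition twisted :: "enat \<Rightarrow> (cord \<Rightarrow> cord \<Rightarrow> real) \<Rightarrow> (lpoint \<times> lpoint, real \<times> real) chart set" where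
  "twisted r m = max_atlas r long_ray_sq (range (twist_chart m))"

lemma diff_structure_twisted: "weight_family I m \<Longrightarrow> diff_structure r long_ray_sq (twisted r m)"
  unfolding twisted_def by (intro diff_structure_max_atlas atlas_twist)

lemma twist_chart_in_twisted: "weight_family I m \<Longrightarrow> twist_chart m a \<in> twisted r m"
  unfolding twisted_def using atlas_subset_max[OF atlas_twist] by blast

subsection \<open>Continuous self-maps of the long ray\<close>

lemma tendsto_lpt:
  assumes a: "limit_cord a" and lt: "\<And>n. blk (x n) < a"
    and ev: "\<And>b. b < a \<Longrightarrow> \<forall>\<^sub>F n in sequentially. b < blk (x n)"
  shows "x \<longlonglongrightarrow> lpt a 0"
proof (rule order_tendstoI)
  have ab: "a \<noteq> bot" using a by (simp add: limit_cord_def)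
  have below_a: "z < lpt a 0 \<longleftrightarrow> blk z < a" for z using below_eq[OF ab] by (auto simp: below_def)
  fix y assume "y < lpt a 0"
  then have "\<forall>\<^sub>F n in sequentially. blk y < blk (x n)" using ev below_a by blast
  then show "\<forall>\<^sub>F n in sequentially. y < x n" by eventually_elim (simp add: less_lray_def)
next
  have ab: "a \<noteq> bot" using a by (simp add: limit_cord_def)
  have below_a: "z < lpt a 0 \<longleftrightarrow> blk z < a" for z using below_eq[OF ab] by (auto simp: below_def)
  fix y assume "lpt a 0 < y"
  then have "x n < y" for n using below_a[of "x n"] lt[of n] by (meson less_trans)
  then show "\<forall>\<^sub>F n in sequentially. x n < y" by simp
qed

lemma ladder_eventually:
  fixes s :: "nat \<Rightarrow> cord"
  assumes s: "strict_mono s" "\<And>b. b < a \<Longrightarrow> \<exists>n. b < s n" and r: "\<And>n. n \<le> r n" and x: "\<And>n. s (r n) \<le> blk (x n)" and b: "b < a"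
  shows "\<forall>\<^sub>F n in sequentially. b < blk (x n)"
proof -
  obtain N where N: "b < s N" using s(2)[OF b] by blast
  have "b < blk (x n)" if "N \<le> n" for n
  proof -
    have "N \<le> r n" using that r[of n] by simp
    then have "s N \<le> s (r n)" using s(1) by (simp add: strict_mono_less_eq)
    then show ?thesis using N x[of n] by (meson less_le_trans)
  qed
  then show ?thesis by (auto simp: eventually_sequentially)
qed

text \<open>Immediately to the right of every point, including limit points \<open>lpt a 0\<close>,
  lie points of its own block, so rational offsets in that single block approximate it.\<close>

lemma rational_point_dense:
  assumes "open V" "x \<in> V"
  obtains t where "t \<in> \<rat>" "0 < t" "t < 1" "lpt (blk x) t \<in> V"
proof -
  define y where "y = lpt (blk x) ((off x + 1) / 2)"
  have y: "blk y = blk x" "off x < off y" using off_bounds[of x] by (auto simp: y_def blk_off_lpt)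
  then have "x < y" by (simp add: less_lray_def)
  from open_right[OF assms this] obtain b where b: "b > x" "{x..<b} \<subseteq> V" by blast
  define z where "z = min b y"
  have "x < z" "z \<le> y" "z \<le> b" using b \<open>x < y\<close> by (auto simp: z_def)
  then have z: "blk z = blk x" "off x < off z"
    using y(1) unfolding less_lray_def less_eq_lray_def by auto
  obtain t where t: "t \<in> \<rat>" "off x < t" "t < off z" using Rats_dense_in_real[OF z(2)] by blast
  have bo: "0 < t" "t < 1" using off_bounds[of x] off_bounds[of z] t by auto
  have "x \<le> lpt (blk x) t" "lpt (blk x) t < z"
    using t bo z by (auto simp: less_lray_def less_eq_lray_def blk_off_lpt)
  then have "lpt (blk x) t \<in> V" using b(2) \<open>z \<le> b\<close> by (meson atLeastLessThan_iff less_le_trans subsetD)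
  then show ?thesis using that t bo by blast
qed

lemma closed_dense_extend:
  fixes h :: "lray \<Rightarrow> 'a::topological_space"
  assumes h: "continuous_on UNIV h" and C: "closed C"
    and q: "\<And>t. t \<in> \<rat> \<Longrightarrow> 0 < t \<Longrightarrow> t < 1 \<Longrightarrow> h (lpt (blk x) t) \<in> C"
  shows "h x \<in> C"
proof (rule ccontr)
  assume "h x \<notin> C"
  moreover have "open (h -` (- C))" using h C by (intro open_vimage) auto
  ultimately obtain t where "t \<in> \<rat>" "0 < t" "t < 1" "lpt (blk x) t \<in> h -` (- C)"
    using rational_point_dense[of "h -` (- C)" x] by auto
  then show False using q by auto
qed

section \<open>Fixed points of unbounded maps and eventual constancy of bounded ones\<close>

definition bounded_ray :: "(lray \<Rightarrow> lray) \<Rightarrow> bool" where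
  "bounded_ray h \<longleftrightarrow> (\<exists>c. \<forall>x. blk (h x) < c)"

lemma le_lpt_iff: "c \<noteq> bot \<Longrightarrow> x \<le> lpt c 0 \<Longrightarrow> blk x \<le> c"
  by (auto simp: less_eq_lray_def blk_off_lpt)

text \<open>The countably many points with rational offset below \<open>b\<close> have images with a
  common bound, and the closed condition extends to all points.\<close>

lemma image_below_bounded:
  assumes h: "continuous_on UNIV h" shows "\<exists>c. \<forall>x\<in>below b. blk (h x) \<le> c"
proof -
  have "countable ((\<lambda>p. blk (h (lpt (fst p) (snd p)))) ` ({..<b} \<times> \<rat>))"
    using countable_lessThan_cord countable_rat by blast
  from countable_bounded_cord[OF this] obtain c where
    c: "\<And>g t. g < b \<Longrightarrow> t \<in> \<rat> \<Longrightarrow> blk (h (lpt g t)) < c" by force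
  have "blk (h x) \<le> c" if x: "x \<in> below b" for x
  proof -
    have xb: "blk x < b" using x by (simp add: below_def)
    have "c \<noteq> bot" using c[OF xb, of 0] by auto
    have "h x \<in> {..lpt c 0}"
    proof (rule closed_dense_extend[OF h])
      fix t :: real assume "t \<in> \<rat>"
      then have "h (lpt (blk x) t) \<in> below c" using c[OF xb] by (simp add: below_def)
      then show "h (lpt (blk x) t) \<in> {..lpt c 0}" using below_eq[OF \<open>c \<noteq> bot\<close>] by auto
    qed simp
    then show ?thesis using le_lpt_iff[OF \<open>c \<noteq> bot\<close>] by simp
  qed
  then show ?thesis by blast
qed

lemma unbounded_ray_far:
  assumes "continuous_on UNIV h" "\<not> bounded_ray h"
  shows "\<exists>x. b \<le> blk x \<and> b \<le> blk (h x)"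
proof -
  obtain c where c: "\<And>x. x \<in> below b \<Longrightarrow> blk (h x) \<le> c" using image_below_bounded[OF assms(1)] by blast
  obtain d where d: "max b c < d" using cord_gt_ex by blast
  obtain x where x: "d \<le> blk (h x)" using assms(2) unfolding bounded_ray_def by (metis not_less)
  have "x \<notin> below b" using c[of x] x d by (meson leD le_less_trans max.cobounded2)
  then have "b \<le> blk x" by (simp add: below_def not_less)
  moreover have "b \<le> blk (h x)" using x d by (meson le_less_trans less_imp_le max.cobounded1 order_trans)
  ultimately show ?thesis by blast
qed

text \<open>A ladder is built that traps, between consecutive terms, a point together with its image
  under one of the maps, each map being served infinitely often. Points and images then both
  converge to the supremum, which continuity makes a fixed point.\<close>

lemma common_fixed_point:
  assumes "countable K" and K: "\<And>h. h \<in> K \<Longrightarrow> continuous_on UNIV h \<and> \<not> bounded_ray h"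
  shows "\<exists>a>b. limit_cord a \<and> (\<forall>h\<in>K. h (lpt a 0) = lpt a 0)"
proof -
  \<comment> \<open>Adding \<open>id\<close> guarantees a nonempty set, so that
    \<open>from_nat_into\<close> enumerates it.\<close>
  define K' where "K' = insert id K"
  have K': "continuous_on UNIV h \<and> \<not> bounded_ray h" if "h \<in> K'" for h
  proof (cases "h = id")
    case True
    have "\<exists>x. \<not> blk x < c" for c
      by (rule exI[of _ "lpt c (1/2)"]) (simp add: blk_off_lpt)
    then show ?thesis using True by (auto simp: bounded_ray_def)
  qed (use that K in \<open>auto simp: K'_def\<close>)
  define e where "e = from_nat_into K'"
  have e: "range e = K'"
    unfolding e_def using assms(1) by (intro range_from_nat_into) (auto simp: K'_def)
  have far: "\<exists>x. d \<le> blk x \<and> d \<le> blk (e i x)" for d i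
    using unbounded_ray_far K' e by blast
  \<comment> \<open>The first component of the pairing function takes each value infinitely often,
    so every map has its turn at arbitrarily late stages.\<close>
  define i where "i n = fst (prod_decode n)" for n
  have "\<exists>s. \<forall>n. b < s n \<and> (s n < s (Suc n) \<and> (\<exists>x. s n \<le> blk x \<and> s n \<le> blk (e (i n) x) \<and> blk x < s (Suc n) \<and> blk (e (i n) x) < s (Suc n)))"
  proof (rule dependent_nat_choice)
    show "\<exists>x. b < x" by (rule cord_gt_ex)
    fix d n assume d: "b < d"
    obtain x where x: "d \<le> blk x" "d \<le> blk (e (i n) x)" using far by blast
    obtain d' where d': "max (blk x) (blk (e (i n) x)) < d'" using cord_gt_ex by blast
    then have "blk x < d'" "blk (e (i n) x) < d'" by auto
    moreover have "d < d'" using x(1) \<open>blk x < d'\<close> by (rule le_less_trans)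
    ultimately show "\<exists>y. b < y \<and> d < y \<and> (\<exists>x. d \<le> blk x \<and> d \<le> blk (e (i n) x) \<and> blk x < y \<and> blk (e (i n) x) < y)"
      using x d less_trans by blast
  qed
  then obtain s where s: "\<And>n. b < s n" "\<And>n. s n < s (Suc n)"
    and "\<forall>n. \<exists>x. s n \<le> blk x \<and> s n \<le> blk (e (i n) x) \<and> blk x < s (Suc n) \<and> blk (e (i n) x) < s (Suc n)" by blast
  then obtain x where x: "\<And>n. s n \<le> blk (x n)" "\<And>n. s n \<le> blk (e (i n) (x n))"
      "\<And>n. blk (x n) < s (Suc n)" "\<And>n. blk (e (i n) (x n)) < s (Suc n)" by metis
  have sm: "strict_mono s" using s(2) by (simp add: strict_mono_Suc_iff)
  obtain a where a: "limit_cord a" "\<And>n. s n < a" "\<And>c. c < a \<Longrightarrow> \<exists>n. c < s n"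
    using strict_mono_limit_cord[OF sm] by blast
  have "h (lpt a 0) = lpt a 0" if "h \<in> K" for h
  proof -
    have "h \<in> range e" using that e by (simp add: K'_def)
    then obtain j where j: "h = e j" by blast
    define r where "r k = prod_encode (j, k)" for k
    have r: "\<And>k. k \<le> r k" "\<And>k. i (r k) = j" by (auto simp: r_def i_def le_prod_encode_2)
    have lim1: "(\<lambda>k. x (r k)) \<longlonglongrightarrow> lpt a 0"
    proof (rule tendsto_lpt[OF a(1)])
      show "blk (x (r k)) < a" for k using x(3) a(2) by (rule less_trans)
      show "\<forall>\<^sub>F k in sequentially. c < blk (x (r k))" if "c < a" for c
        by (rule ladder_eventually[OF sm a(3) r(1) x(1) that])
    qed
    have xr: "s (r k) \<le> blk (h (x (r k)))" "blk (h (x (r k))) < s (Suc (r k))" for k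
      using x(2,4)[of "r k"] r(2)[of k] j by simp_all
    have lim2: "(\<lambda>k. h (x (r k))) \<longlonglongrightarrow> lpt a 0"
    proof (rule tendsto_lpt[OF a(1)])
      show "blk (h (x (r k))) < a" for k using xr(2) a(2) by (rule less_trans)
      show "\<forall>\<^sub>F k in sequentially. c < blk (h (x (r k)))" if "c < a" for c
        by (rule ladder_eventually[OF sm a(3) r(1) xr(1) that])
    qed
    have "isCont h (lpt a 0)" using K[OF that] by (simp add: continuous_on_eq_continuous_at)
    from isCont_tendsto_compose[OF this lim1] lim2 show ?thesis
      by (rule LIMSEQ_unique)
  qed
  moreover have "b < a" using s(1)[of 0] a(2)[of 0] by (rule less_trans)
  ultimately show ?thesis using a(1) by blast
qed

lemma real_coordinate:
  obtains \<phi> :: "lray \<Rightarrow> real" where "continuous_on (below c) \<phi>" "inj_on \<phi> (below c)"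
proof -
  obtain m where "\<And>a. weights (\<lambda>_. UNIV) m a (m a)" using weights_exist[of "\<lambda>_. UNIV"] by auto
  then have "weight_family (\<lambda>_. UNIV) m" by (simp add: weight_family_def)
  then show ?thesis using that phi_continuous phi_inj by blast
qed

text \<open>Read in a real coordinate, the oscillation beyond some bound is below any given
  \<open>e\<close>: otherwise a ladder traps pairs of points with values at least \<open>e\<close>
  apart, although both sequences converge to the same limit. Countably many bounds for
  \<open>e = 1/(n + 1)\<close> have a common one.\<close>

lemma bounded_eventually_const:
  assumes h: "continuous_on UNIV h" and "bounded_ray h"
  shows "\<exists>q b. \<forall>x. b \<le> blk x \<longrightarrow> h x = q"
proof -
  obtain c where c: "\<And>x. blk (h x) < c" using assms(2) unfolding bounded_ray_def by blast
  obtain \<phi> :: "lray \<Rightarrow> real" where \<phi>: "continuous_on (below c) \<phi>" "inj_on \<phi> (below c)" by (rule real_coordinate)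
  define g where "g x = \<phi> (h x)" for x
  have g: "continuous_on UNIV g"
    unfolding g_def by (rule continuous_on_compose2[OF \<phi>(1) h]) (use c in \<open>auto simp: below_def\<close>)
  have osc: "\<exists>b. \<forall>x y. b \<le> blk x \<longrightarrow> b \<le> blk y \<longrightarrow> \<bar>g x - g y\<bar> < e" if "e > 0" for e
  proof (rule ccontr)
    assume neg: "\<nexists>b. \<forall>x y. b \<le> blk x \<longrightarrow> b \<le> blk y \<longrightarrow> \<bar>g x - g y\<bar> < e"
    have "\<exists>s :: nat \<Rightarrow> cord. \<forall>n. True \<and> (s n < s (Suc n) \<and> (\<exists>x y. s n \<le> blk x \<and> s n \<le> blk y \<and> blk x < s (Suc n) \<and> blk y < s (Suc n) \<and> e \<le> \<bar>g x - g y\<bar>))"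
    proof (rule dependent_nat_choice)
      fix d :: cord and n :: nat
      obtain x y where xy: "d \<le> blk x" "d \<le> blk y" "e \<le> \<bar>g x - g y\<bar>" using neg by (meson not_less)
      obtain d' where d': "max (blk x) (blk y) < d'" using cord_gt_ex by blast
      then have "blk x < d'" "blk y < d'" by auto
      moreover have "d < d'" using xy(1) \<open>blk x < d'\<close> by (rule le_less_trans)
      ultimately show "\<exists>z. True \<and> d < z \<and> (\<exists>x y. d \<le> blk x \<and> d \<le> blk y \<and> blk x < z \<and> blk y < z \<and> e \<le> \<bar>g x - g y\<bar>)"
        using xy by blast
    qed simp
    then obtain s :: "nat \<Rightarrow> cord" where s: "\<And>n. s n < s (Suc n)"
      and "\<forall>n. \<exists>x y. s n \<le> blk x \<and> s n \<le> blk y \<and> blk x < s (Suc n) \<and> blk y < s (Suc n) \<and> e \<le> \<bar>g x - g y\<bar>" by blast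
    then obtain x y where xy: "\<And>n. s n \<le> blk (x n)" "\<And>n. s n \<le> blk (y n)" "\<And>n. blk (x n) < s (Suc n)"
        "\<And>n. blk (y n) < s (Suc n)" "\<And>n. e \<le> \<bar>g (x n) - g (y n)\<bar>" by metis
    have sm: "strict_mono s" using s by (simp add: strict_mono_Suc_iff)
    obtain a where a: "limit_cord a" "\<And>n. s n < a" "\<And>c. c < a \<Longrightarrow> \<exists>n. c < s n"
      using strict_mono_limit_cord[OF sm] by blast
    have gc: "isCont g (lpt a 0)" using g by (simp add: continuous_on_eq_continuous_at)
    have lim: "z \<longlonglongrightarrow> lpt a 0" if zl: "\<And>n. s n \<le> blk (z n)" and zu: "\<And>n. blk (z n) < s (Suc n)" for z
    proof (rule tendsto_lpt[OF a(1)])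
      show "blk (z n) < a" for n using zu a(2) by (rule less_trans)
      show "\<forall>\<^sub>F n in sequentially. c < blk (z n)" if "c < a" for c
        by (rule ladder_eventually[OF sm a(3) order_refl zl that])
    qed
    have "(\<lambda>n. \<bar>g (x n) - g (y n)\<bar>) \<longlonglongrightarrow> \<bar>g (lpt a 0) - g (lpt a 0)\<bar>"
      by (intro tendsto_intros isCont_tendsto_compose[OF gc] lim xy)
    then have "e \<le> \<bar>g (lpt a 0) - g (lpt a 0)\<bar>"
      by (rule Lim_bounded2[where N = 0]) (use xy(5) in auto)
    then show False using that by simp
  qed
  then have "\<exists>b. \<forall>x y. b \<le> blk x \<longrightarrow> b \<le> blk y \<longrightarrow> \<bar>g x - g y\<bar> < inverse (real (Suc n))" for n by simp
  then obtain B where B: "\<And>n x y. B n \<le> blk x \<Longrightarrow> B n \<le> blk y \<Longrightarrow> \<bar>g x - g y\<bar> < inverse (real (Suc n))" by metis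
  obtain b where b: "\<And>n. B n < b" using countable_bounded_cord[of "range B"] by auto
  have "h x = h (lpt b (1/2))" if "b \<le> blk x" for x
  proof -
    have "B n \<le> blk x" "B n \<le> blk (lpt b (1/2))" for n
      using b[of n] that by (auto simp: blk_off_lpt intro: less_imp_le less_le_trans)
    then have "\<bar>g x - g (lpt b (1/2))\<bar> < inverse (real (Suc n))" for n using B by blast
    then have "\<not> 0 < \<bar>g x - g (lpt b (1/2))\<bar>" using reals_Archimedean less_asym by blast
    then have "g x = g (lpt b (1/2))" by simp
    then show ?thesis using \<phi>(2) c by (auto simp: g_def inj_on_def below_def)
  qed
  then show ?thesis by blast
qed

subsection \<open>Rigidity of continuous injections of the squared long ray\<close>

lemma open_block0: "open {y :: lray. blk y = bot}"
proof -
  define b :: cord where "b = (LEAST b. bot < b)"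
  have "bot < b" unfolding b_def by (rule LeastI_ex[OF cord_gt_ex])
  moreover have "c = bot" if "c < b" for c
    using not_less_Least[OF that[unfolded b_def]] by (metis bot.not_eq_extremum)
  ultimately have "{y :: lray. blk y = bot} = below b" by (auto simp: below_def)
  then show ?thesis by (simp add: open_below)
qed

lemma block0_image: "lpt bot ` {0<..<1} = {y. blk y = bot}"
proof
  show "{y. blk y = bot} \<subseteq> lpt bot ` {0<..<1}"
  proof
    fix y assume "y \<in> {y. blk y = bot}"
    then have "y = lpt bot (off y)" "off y \<in> {0<..<1}"
      using lpt_blk_off[of y] off_bounds[of y] off_pos[of y] by auto
    then show "y \<in> lpt bot ` {0<..<1}" by blast
  qed
qed (auto simp: blk_off_lpt)

lemma continuous_lpt_bot: "continuous_on {0<..<1} (lpt bot)"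
  by (rule continuous_onI_mono) (auto simp: block0_image open_block0 less_eq_lray_def blk_off_lpt)

lemma continuous_slice:
  assumes "continuous_on UNIV (f :: lray \<times> lray \<Rightarrow> 'a::topological_space)"
  shows "continuous_on UNIV (\<lambda>x. f (x, y))" "continuous_on UNIV (\<lambda>y. f (x, y))"
  by (auto intro!: continuous_on_compose2[OF assms] continuous_intros)

text \<open>Along a convergent sequence of heights the countably many bounds have a common upper
  bound, and lying at or below it is preserved in the limit.\<close>

lemma bounded_slices_closed:
  assumes u: "continuous_on UNIV (u :: lray \<times> lray \<Rightarrow> lray)"
  shows "closedin (top_of_set {0<..<1}) {t \<in> {0<..<1}. bounded_ray (\<lambda>x. u (x, lpt bot t))}"
proof -
  let ?Y = "{t \<in> {0<..<1}. bounded_ray (\<lambda>x. u (x, lpt bot t))}"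
  have seq: "t \<in> ?Y" if t: "t \<in> {0<..<1}" "\<And>n. \<tau> n \<in> ?Y" "\<tau> \<longlonglongrightarrow> t" for t \<tau>
  proof -
    have "\<exists>c. \<forall>x. blk (u (x, lpt bot (\<tau> n))) < c" for n using t(2)[of n] by (auto simp: bounded_ray_def)
    then obtain c where c: "\<And>n x. blk (u (x, lpt bot (\<tau> n))) < c n" by metis
    obtain d where d: "\<And>n. c n < d" using countable_bounded_cord[of "range c"] by auto
    have db: "d \<noteq> bot" using d[of 0] by auto
    have "u (x, lpt bot t) \<le> lpt d 0" for x
    proof -
      have "isCont (lpt bot) t" using continuous_lpt_bot t(1) by (simp add: continuous_on_eq_continuous_at)
      then have "(\<lambda>n. lpt bot (\<tau> n)) \<longlonglongrightarrow> lpt bot t" using t(3) by (rule isCont_tendsto_compose)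
      moreover have "isCont (\<lambda>y. u (x, y)) (lpt bot t)"
        using continuous_slice(2)[OF u, of x] by (simp add: continuous_on_eq_continuous_at)
      ultimately have "(\<lambda>n. u (x, lpt bot (\<tau> n))) \<longlonglongrightarrow> u (x, lpt bot t)" by (rule isCont_tendsto_compose[rotated])
      moreover have "u (x, lpt bot (\<tau> n)) \<le> lpt d 0" for n
      proof -
        have "u (x, lpt bot (\<tau> n)) \<in> below d" using c[of x n] d[of n] by (auto simp: below_def)
        then show ?thesis using below_eq[OF db] by auto
      qed
      ultimately show ?thesis using LIMSEQ_le_const2 by blast
    qed
    then have le: "blk (u (x, lpt bot t)) \<le> d" for x using le_lpt_iff[OF db] by blast
    obtain d' where "d < d'" using cord_gt_ex by blast
    then have "bounded_ray (\<lambda>x. u (x, lpt bot t))" unfolding bounded_ray_def using le by (meson le_less_trans)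
    then show ?thesis using t(1) by simp
  qed
  have "closure ?Y \<inter> {0<..<1} \<subseteq> ?Y"
  proof
    fix t assume t: "t \<in> closure ?Y \<inter> {0<..<1}"
    then have "\<exists>\<tau>. (\<forall>n. \<tau> n \<in> ?Y) \<and> \<tau> \<longlonglongrightarrow> t" by (simp only: closure_sequential Int_iff)
    then show "t \<in> ?Y" using seq t by blast
  qed
  then have "?Y = {0<..<1} \<inter> closure ?Y" using closure_subset[of ?Y] by auto
  then show ?thesis using closed_closure closedin_closed by blast
qed

text \<open>Two bounded components would be eventually constant, against injectivity. If both were
  unbounded at two heights, a common fixed point of the four maps would give two points with the
  same image, so there is at most one such height; these heights form an open set, hence there are
  none. Connectedness of the interval then selects one alternative for all heights.\<close>

lemma slice_dichotomy:
  assumes u: "continuous_on UNIV (u :: lray \<times> lray \<Rightarrow> lray)" and v: "continuous_on UNIV (v :: lray \<times> lray \<Rightarrow> lray)"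
    and inj: "inj (\<lambda>p. (u p, v p))"
  shows "(\<forall>t\<in>{0<..<1}. bounded_ray (\<lambda>x. v (x, lpt bot t)) \<and> \<not> bounded_ray (\<lambda>x. u (x, lpt bot t))) \<or>
    (\<forall>t\<in>{0<..<1}. bounded_ray (\<lambda>x. u (x, lpt bot t)) \<and> \<not> bounded_ray (\<lambda>x. v (x, lpt bot t)))"
proof -
  let ?U = "{t \<in> {0<..<1}. bounded_ray (\<lambda>x. u (x, lpt bot t))}"
  let ?V = "{t \<in> {0<..<1}. bounded_ray (\<lambda>x. v (x, lpt bot t))}"
  have disj: "\<not> (bounded_ray (\<lambda>x. u (x, y)) \<and> bounded_ray (\<lambda>x. v (x, y)))" for y
  proof
    assume b: "bounded_ray (\<lambda>x. u (x, y)) \<and> bounded_ray (\<lambda>x. v (x, y))"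
    obtain q b1 where 1: "\<And>x. b1 \<le> blk x \<Longrightarrow> u (x, y) = q"
      using bounded_eventually_const[OF continuous_slice(1)[OF u]] b by blast
    obtain q' b2 where 2: "\<And>x. b2 \<le> blk x \<Longrightarrow> v (x, y) = q'"
      using bounded_eventually_const[OF continuous_slice(1)[OF v]] b by blast
    let ?x = "lpt (max b1 b2) (1/2)" and ?x' = "lpt (max b1 b2) (1/4)"
    have "blk ?x = max b1 b2" "blk ?x' = max b1 b2" "off ?x = 1/2" "off ?x' = 1/4"
      by (auto simp: blk_off_lpt)
    moreover from this have "(u (?x, y), v (?x, y)) = (u (?x', y), v (?x', y))" using 1 2 by simp
    then have "?x = ?x'" using injD[OF inj, of "(?x, y)" "(?x', y)"] by simp
    ultimately show False by simp
  qed
  have unique: "t = t'" if t: "t \<in> {0<..<1} - (?U \<union> ?V)" "t' \<in> {0<..<1} - (?U \<union> ?V)" for t t'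
  proof -
    let ?K = "{\<lambda>x. u (x, lpt bot t), \<lambda>x. v (x, lpt bot t), \<lambda>x. u (x, lpt bot t'), \<lambda>x. v (x, lpt bot t')}"
    obtain a where "limit_cord a" "\<forall>h\<in>?K. h (lpt a 0) = lpt a 0"
      using common_fixed_point[of ?K bot] t continuous_slice(1)[OF u] continuous_slice(1)[OF v] by auto
    then have "(u (lpt a 0, lpt bot t), v (lpt a 0, lpt bot t)) = (u (lpt a 0, lpt bot t'), v (lpt a 0, lpt bot t'))" by simp
    then have "lpt bot t = lpt bot t'" using injD[OF inj, of "(lpt a 0, lpt bot t)" "(lpt a 0, lpt bot t')"] by simp
    then have "off (lpt bot t) = off (lpt bot t')" by simp
    then show ?thesis using t by (simp add: blk_off_lpt)
  qed
  have cl: "closedin (top_of_set {0<..<1}) ?U" "closedin (top_of_set {0<..<1}) ?V"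
    using bounded_slices_closed u v by auto
  have "{0<..<1} - (?U \<union> ?V) = {}"
  proof (rule ccontr)
    assume "{0<..<1} - (?U \<union> ?V) \<noteq> {}"
    then obtain t where "t \<in> {0<..<1} - (?U \<union> ?V)" by blast
    then have eq: "{0<..<1} - (?U \<union> ?V) = {t}" using unique by blast
    have "openin (top_of_set {0<..<1::real}) ({0<..<1} - (?U \<union> ?V))"
      using closedin_Un[OF cl] by (metis (no_types, lifting) openin_diff openin_subtopology_self)
    then have "openin (top_of_set {0<..<1::real}) {t}" using eq by simp
    then have "open {t}" using openin_open_trans open_greaterThanLessThan by blast
    then show False using not_open_singleton by blast
  qed
  then have cover: "{0<..<1} \<subseteq> ?U \<union> ?V" by blast
  have "?U \<inter> ?V = {}" using disj by blast
  moreover have "connected {0<..<1::real}" by simp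
  ultimately have "?U = {} \<or> ?V = {}" using cl cover unfolding connected_closedin by meson
  then show ?thesis using cover disj by blast
qed

text \<open>The common fixed points form a closed unbounded set; one convergent ladder of them beyond a given
  bound is enough.\<close>

lemma slice_ladder:
  assumes u: "continuous_on UNIV (u :: lray \<times> lray \<Rightarrow> lray)" and v: "continuous_on UNIV (v :: lray \<times> lray \<Rightarrow> lray)"
    and b: "\<forall>t\<in>{0<..<1}. bounded_ray (\<lambda>x. v (x, lpt bot t)) \<and> \<not> bounded_ray (\<lambda>x. u (x, lpt bot t))"
  obtains s a q where "strict_mono (s :: nat \<Rightarrow> cord)" "limit_cord a" "\<And>n. s n < a" "\<And>c. c < a \<Longrightarrow> \<exists>n. c < s n"
    "\<And>n. d < s n" "blk q < s 0"
    "\<And>n y. blk y = bot \<Longrightarrow> u (lpt (s n) 0, y) = lpt (s n) 0"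
    "\<And>y. blk y = bot \<Longrightarrow> u (lpt a 0, y) = lpt a 0"
    "\<And>n. v (lpt (s n) 0, mid) = q" "v (lpt a 0, mid) = q"
proof -
  obtain q b0 where q: "\<And>x. b0 \<le> blk x \<Longrightarrow> v (x, mid) = q"
    using bounded_eventually_const[OF continuous_slice(1)[OF v]] b by force
  \<comment> \<open>Beyond \<open>b0\<close> the map \<open>v\<close> is constant on the line
    through \<open>mid\<close>; beyond \<open>blk q\<close> any chart square reaching past the
    ladder also contains \<open>q\<close>.\<close>
  define b1 where "b1 = max d (max b0 (blk q))"
  have b1: "d \<le> b1" "b0 \<le> b1" "blk q \<le> b1" by (simp_all add: b1_def le_max_iff_disj)
  \<comment> \<open>Rational heights give countably many maps, as \<open>common_fixed_point\<close>
    requires; \<open>fix_all\<close> recovers the remaining heights by density.\<close>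
  define J where "J = (\<lambda>t x. u (x, lpt bot t)) ` ({0<..<1} \<inter> \<rat>)"
  have K: "countable J" "\<And>h. h \<in> J \<Longrightarrow> continuous_on UNIV h \<and> \<not> bounded_ray h"
    unfolding J_def using countable_rat continuous_slice(1)[OF u] b by (auto intro: countable_subset)
  have fix_all: "u (lpt a 0, y) = lpt a 0" if "\<forall>h\<in>J. h (lpt a 0) = lpt a 0" "blk y = bot" for a y
  proof -
    have "u (lpt a 0, y) \<in> {lpt a 0}"
      by (rule closed_dense_extend[OF continuous_slice(2)[OF u]]) (use that in \<open>auto simp: J_def\<close>)
    then show ?thesis by simp
  qed
  have "\<exists>s. \<forall>n. (b1 < s n \<and> limit_cord (s n) \<and> (\<forall>h\<in>J. h (lpt (s n) 0) = lpt (s n) 0)) \<and> s n < s (Suc n)"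
  proof (rule dependent_nat_choice)
    show "\<exists>a. b1 < a \<and> limit_cord a \<and> (\<forall>h\<in>J. h (lpt a 0) = lpt a 0)"
      using common_fixed_point[OF K] by blast
    fix c assume c: "b1 < c \<and> limit_cord c \<and> (\<forall>h\<in>J. h (lpt c 0) = lpt c 0)"
    obtain y where y: "c < y" "limit_cord y" "\<forall>h\<in>J. h (lpt y 0) = lpt y 0"
      using common_fixed_point[OF K, of c] by blast
    have "b1 < y" using conjunct1[OF c] y(1) by (rule less_trans)
    with y show "\<exists>y. (b1 < y \<and> limit_cord y \<and> (\<forall>h\<in>J. h (lpt y 0) = lpt y 0)) \<and> c < y" by blast
  qed
  then obtain s where s: "\<And>n. b1 < s n" "\<And>n. limit_cord (s n)" "\<And>n. \<forall>h\<in>J. h (lpt (s n) 0) = lpt (s n) 0"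
    "\<And>n. s n < s (Suc n)" by blast
  have sm: "strict_mono s" using s(4) by (simp add: strict_mono_Suc_iff)
  obtain a where a: "limit_cord a" "\<And>n. s n < a" "\<And>c. c < a \<Longrightarrow> \<exists>n. c < s n"
    using strict_mono_limit_cord[OF sm] by blast
  have sb: "s n \<noteq> bot" for n using s(2)[of n] by (simp add: limit_cord_def)
  have blk_s: "blk (lpt (s n) 0) = s n" for n using sb by (simp add: blk_off_lpt)
  have blk_a: "blk (lpt a 0) = a" using a(1) by (simp add: limit_cord_def blk_off_lpt)
  have lim: "(\<lambda>n. lpt (s n) 0) \<longlonglongrightarrow> lpt a 0"
  proof (rule tendsto_lpt[OF a(1)])
    show "blk (lpt (s n) 0) < a" for n using a(2) by (simp add: blk_s)
    show "\<forall>\<^sub>F n in sequentially. c < blk (lpt (s n) 0)" if "c < a" for c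
      by (rule ladder_eventually[OF sm a(3) order_refl eq_refl[OF blk_s[symmetric]] that])
  qed
  have us: "u (lpt (s n) 0, y) = lpt (s n) 0" if "blk y = bot" for n y using fix_all s(3) that by blast
  show ?thesis
  proof (rule that[OF sm a, of q])
    show "d < s n" for n using b1(1) s(1) by (rule le_less_trans)
    show "blk q < s 0" using b1(3) s(1) by (rule le_less_trans)
    show "u (lpt (s n) 0, y) = lpt (s n) 0" if "blk y = bot" for n y by (rule us[OF that])
    show "u (lpt a 0, y) = lpt a 0" if y: "blk y = bot" for y
    proof -
      have "isCont (\<lambda>x. u (x, y)) (lpt a 0)"
        using continuous_slice(1)[OF u] by (simp add: continuous_on_eq_continuous_at)
      from isCont_tendsto_compose[OF this lim] have "(\<lambda>n. lpt (s n) 0) \<longlonglongrightarrow> u (lpt a 0, y)" by (simp add: us[OF y])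
      then show ?thesis using lim by (rule LIMSEQ_unique)
    qed
    have "b0 \<le> s n" for n using b1(2) s(1) by (meson le_less_trans less_imp_le)
    then show "v (lpt (s n) 0, mid) = q" for n by (intro q) (simp add: blk_s)
    have "b0 \<le> a" using \<open>b0 \<le> s 0\<close> a(2)[of 0] by (meson le_less_trans less_imp_le)
    then show "v (lpt a 0, mid) = q" by (intro q) (simp add: blk_a)
  qed
qed

subsection \<open>Diffeomorphisms defined on a twisted structure\<close>

text \<open>The displacement \<open>z n - z0\<close> is \<open>k n\<close> times \<open>w\<close> up
  to an error of smaller order. This covers ladder points, which form no differentiable curve, and
  permits \<open>k\<close> of either sign.\<close>

lemma has_derivative_along_sequence:
  fixes G :: "'a::real_normed_vector \<Rightarrow> 'b::real_normed_vector"
  assumes G: "(G has_derivative D) (at z0)" and k: "k \<longlonglongrightarrow> 0" "\<And>n. k n \<noteq> 0"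
    and z: "(\<lambda>n. (z n - z0) /\<^sub>R k n) \<longlonglongrightarrow> w"
  shows "(\<lambda>n. (G (z n) - G z0) /\<^sub>R k n) \<longlonglongrightarrow> D w"
proof -
  interpret D: bounded_linear D using G by (rule has_derivative_bounded_linear)
  define R where "R y = G y - G z0 - D (y - z0)" for y
  have zlim: "z \<longlonglongrightarrow> z0"
  proof -
    have "(\<lambda>n. k n *\<^sub>R ((z n - z0) /\<^sub>R k n) + z0) \<longlonglongrightarrow> 0 *\<^sub>R w + z0"
      by (intro tendsto_intros k z)
    then show ?thesis using k(2) by simp
  qed
  have nz: "(\<lambda>n. norm ((z n - z0) /\<^sub>R k n)) \<longlonglongrightarrow> norm w" using z by (rule tendsto_norm)
  have "(\<lambda>n. R (z n) /\<^sub>R k n) \<longlonglongrightarrow> 0"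
  proof (rule tendstoI)
    fix e :: real assume e: "e > 0"
    define e' where "e' = e / 2 / (norm w + 1)"
    have w1: "0 < norm w + 1" by (simp add: add_nonneg_pos)
    have "e' * (norm w + 1) = e / 2" using w1 unfolding e'_def by (intro nonzero_eq_divide_eq[THEN iffD1]) auto
    then have e'2: "e' * (norm w + 1) < e" using e by linarith
    have e'1: "e' > 0" unfolding e'_def using e w1 by (intro divide_pos_pos) auto
    obtain d where d: "d > 0" "\<And>y. norm (y - z0) < d \<Longrightarrow> norm (R y) \<le> e' * norm (y - z0)"
      using G e'1 unfolding has_derivative_at_alt R_def by blast
    have "\<forall>\<^sub>F n in sequentially. norm (z n - z0) < d"
      using tendstoD[OF zlim d(1)] by (simp add: dist_norm)
    moreover have "\<forall>\<^sub>F n in sequentially. norm ((z n - z0) /\<^sub>R k n) < norm w + 1"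
      by (rule order_tendstoD(2)[OF nz]) simp
    ultimately show "\<forall>\<^sub>F n in sequentially. dist (R (z n) /\<^sub>R k n) 0 < e"
    proof eventually_elim
      case (elim n)
      have "norm (R (z n) /\<^sub>R k n) \<le> e' * norm (z n - z0) / \<bar>k n\<bar>"
        using d(2)[OF elim(1)] by (simp add: divide_inverse_commute mult_left_mono)
      also have "\<dots> = e' * norm ((z n - z0) /\<^sub>R k n)" by (simp add: divide_inverse_commute)
      also have "\<dots> \<le> e' * (norm w + 1)" using elim(2) e'1 by (intro mult_left_mono) auto
      finally show ?case using e'2 by simp
    qed
  qed
  moreover have "(\<lambda>n. D ((z n - z0) /\<^sub>R k n)) \<longlonglongrightarrow> D w" using z by (rule D.tendsto)
  ultimately have "(\<lambda>n. R (z n) /\<^sub>R k n + D ((z n - z0) /\<^sub>R k n)) \<longlonglongrightarrow> 0 + D w" by (rule tendsto_add)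
  moreover have "R (z n) /\<^sub>R k n + D ((z n - z0) /\<^sub>R k n) = (G (z n) - G z0) /\<^sub>R k n" for n
    unfolding D.scaleR R_def by (simp add: scaleR_add_right[symmetric])
  ultimately show ?thesis by simp
qed

lemma smooth_map_differentiable:
  assumes "r \<ge> 1" "smooth_map r A B f" "(U, \<phi>) \<in> A" "(V, \<psi>) \<in> B" "p \<in> U" "f p \<in> V"
  shows "(\<psi> \<circ> f \<circ> inv_into U \<phi>) differentiable (at (\<phi> p))"
proof -
  have "Cr_on r (\<phi> ` (U \<inter> f -` V)) (\<psi> \<circ> f \<circ> inv_into U \<phi>)"
    using assms unfolding smooth_map_def by blast
  then have "Ck_on 1 (\<phi> ` (U \<inter> f -` V)) (\<psi> \<circ> f \<circ> inv_into U \<phi>)"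
    using assms(1) unfolding Cr_on_def by (simp only: one_enat_def)
  then show ?thesis using assms(5,6) by auto
qed

text \<open>The chain rule for \<open>g\<close> after \<open>f\<close> gives the identity, so the
  derivative is injective. \<open>B\<close> may be any set of charts, which admits both product
  atlases and twisted structures as targets.\<close>

lemma diffeo_chart_derivative:
  fixes A :: "(lpoint \<times> lpoint, real \<times> real) chart set" and B :: "(lpoint \<times> lpoint, real \<times> real) chart set"
  assumes r: "r \<ge> 1" and fg: "homeomorphic_maps X X f g" "smooth_map r A B f" "smooth_map r B A g"
    and U: "(U, \<phi>) \<in> A" "is_chart X (U, \<phi>)" and V: "(V, \<psi>) \<in> B" "openin X V" "inj_on \<psi> V"
    and p: "p \<in> U" "f p \<in> V"
  obtains D where "((\<psi> \<circ> f \<circ> inv_into U \<phi>) has_derivative D) (at (\<phi> p))" "\<And>w. D w = 0 \<Longrightarrow> w = 0"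
proof -
  let ?G = "\<psi> \<circ> f \<circ> inv_into U \<phi>" and ?H = "\<phi> \<circ> g \<circ> inv_into V \<psi>"
  have inv: "inv_into U \<phi> (\<phi> x) = x" if "x \<in> U" for x
    using is_chart_inj[OF U(2)] that by (simp add: inv_into_f_f)
  have Usub: "U \<subseteq> topspace X" using U(2) openin_subset by (auto simp: is_chart_def)
  have gf: "g (f x) = x" if "x \<in> U" for x using fg(1) Usub that by (auto simp: homeomorphic_maps_def)
  have "?G differentiable (at (\<phi> p))" by (rule smooth_map_differentiable[OF r fg(2) U(1) V(1) p])
  then obtain D where D: "(?G has_derivative D) (at (\<phi> p))" by (auto simp: differentiable_def)
  have Gp: "?G (\<phi> p) = \<psi> (f p)" using inv[OF p(1)] by simp
  have "?H differentiable (at (\<psi> (f p)))"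
    by (rule smooth_map_differentiable[OF r fg(3) V(1) U(1) p(2)]) (use gf p in simp)
  then obtain E where E: "(?H has_derivative E) (at (?G (\<phi> p)))" unfolding Gp by (auto simp: differentiable_def)
  have "openin X {x \<in> topspace X. f x \<in> V}"
    using fg(1) V(2) by (auto simp: homeomorphic_maps_def continuous_map_def)
  then have o: "open (\<phi> ` (U \<inter> {x \<in> topspace X. f x \<in> V}))"
    using is_chart_open_image[OF U(2)] by simp
  have "((\<lambda>z. ?H (?G z)) has_derivative (\<lambda>w. E (D w))) (at (\<phi> p))"
    using has_derivative_compose[OF D E] .
  then have "((\<lambda>z. z) has_derivative (\<lambda>w. E (D w))) (at (\<phi> p))"
  proof (rule has_derivative_transform_within_open[OF _ o])
    show "\<phi> p \<in> \<phi> ` (U \<inter> {x \<in> topspace X. f x \<in> V})" using p Usub by auto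
    fix z assume "z \<in> \<phi> ` (U \<inter> {x \<in> topspace X. f x \<in> V})"
    then obtain x where x: "x \<in> U" "f x \<in> V" "z = \<phi> x" by auto
    then show "?H (?G z) = z" using inv gf V(3) by (simp add: inv_into_f_f)
  qed
  then have ED: "(\<lambda>w. E (D w)) = (\<lambda>w. w)" using has_derivative_ident has_derivative_unique by blast
  have "E 0 = 0" using E has_derivative_bounded_linear linear_0 bounded_linear.linear by blast
  then have "w = 0" if "D w = 0" for w using fun_cong[OF ED, of w] that by simp
  then show ?thesis using that D by blast
qed

lemma ladder_tendsto:
  assumes "strict_mono (s :: nat \<Rightarrow> cord)" "limit_cord a" "\<And>n. s n < a" "\<And>c. c < a \<Longrightarrow> \<exists>n. c < s n" "\<And>n. s n \<noteq> bot"
  shows "(\<lambda>n. lpt (s n) 0) \<longlonglongrightarrow> lpt a 0"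
proof -
  have blk_s: "blk (lpt (s n) 0) = s n" for n using assms(5) by (simp add: blk_off_lpt)
  show ?thesis
  proof (rule tendsto_lpt[OF assms(2)])
    show "blk (lpt (s n) 0) < a" for n using assms(3) by (simp only: blk_s)
    show "\<forall>\<^sub>F n in sequentially. c < blk (lpt (s n) 0)" if "c < a" for c
      by (rule ladder_eventually[OF assms(1,4) order_refl eq_refl[OF blk_s[symmetric]] that])
  qed
qed

lemma kap_lpt:
  assumes "weight_family I m" "a < c" "b \<le> a" "b \<noteq> bot"
  shows "kap m c (lpt a 0) - kap m c (lpt b 0) = infsum (m c) {b..<a}"
proof -
  have w: "wt c (m c)" using wt_m[OF assms(1)] .
  have bc: "b < c" using assms by (meson le_less_trans)
  have ab: "a \<noteq> bot" using assms(3,4) by (metis bot.extremum_uniqueI)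
  have "0 < m c a" "m c a \<le> 1" "0 < m c b" "m c b \<le> 1" using w assms(2) bc by (auto simp: wt_def)
  then have "kap m c (lpt a 0) = infsum (m c) {..<a}" "kap m c (lpt b 0) = infsum (m c) {..<b}"
    unfolding kap_def using cum_lpt[OF _ profile_step] ab assms(4) by blast+
  then show ?thesis using infsum_lessThan_diff[OF w assms(3) less_imp_le[OF assms(2)]] by simp
qed

text \<open>The sum of the squares of positive terms is at most the square of their sum
  \<open>T\<close>, as each term is at most \<open>T\<close>. Starting after \<open>bot\<close>
  leaves out the one block whose length is not a square.\<close>

lemma phi_lpt_diff:
  assumes m: "weight_family I m" and "a < c" "b \<le> a" "b \<noteq> bot"
  shows "\<bar>phi m c (lpt a 0) - phi m c (lpt b 0)\<bar> \<le> (infsum (m c) {b..<a})\<^sup>2"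
proof -
  have w: "wt c (m c)" "wt c (len (m c))" using wt_m[OF m] wt_len_m[OF m] .
  have bc: "b < c" using assms by (meson le_less_trans)
  have ab: "a \<noteq> bot" using assms(3,4) by (metis bot.extremum_uniqueI)
  have "0 < len (m c) a" "len (m c) a \<le> 1" "0 < len (m c) b" "len (m c) b \<le> 1"
    using w(2) assms(2) bc by (auto simp: wt_def)
  then have "phi m c (lpt a 0) = infsum (len (m c)) {..<a}" "phi m c (lpt b 0) = infsum (len (m c)) {..<b}"
    unfolding phi_def using cum_lpt[OF _ profile_shrink] ab assms(4) by blast+
  then have eq: "phi m c (lpt a 0) - phi m c (lpt b 0) = infsum (len (m c)) {b..<a}"
    using infsum_lessThan_diff[OF w(2) assms(3) less_imp_le[OF assms(2)]] by simp
  define T where "T = infsum (m c) {b..<a}"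
  have sub: "{b..<a} \<subseteq> {..<c}" using assms(2) by auto
  have s: "m c summable_on {b..<a}" "len (m c) summable_on {b..<a}"
    using wt_summable[OF w(1) sub] wt_summable[OF w(2) sub] .
  have pos: "0 < m c g" for g by (rule m_pos[OF m])
  have le: "m c g \<le> T" if "g \<in> {b..<a}" for g
  proof -
    have "sum (m c) {g} \<le> T"
      unfolding T_def by (rule finite_sum_le_infsum[OF s(1)]) (use that pos in \<open>auto intro: less_imp_le\<close>)
    then show ?thesis by simp
  qed
  have len: "len (m c) g = (m c g)\<^sup>2" if "g \<in> {b..<a}" for g
    using that assms(4) by (auto simp: len_def bot_unique)
  have "infsum (len (m c)) {b..<a} \<le> infsum (\<lambda>g. T * m c g) {b..<a}"
  proof (rule infsum_mono[OF s(2)])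
    show "(\<lambda>g. T * m c g) summable_on {b..<a}" by (rule summable_on_cmult_right[OF s(1)])
    show "len (m c) g \<le> T * m c g" if "g \<in> {b..<a}" for g
      using len[OF that] le[OF that] pos[of g] by (simp add: power2_eq_square mult_right_mono less_imp_le)
  qed
  also have "\<dots> = T * T" unfolding T_def by (rule infsum_cmult_right')
  finally have "infsum (len (m c)) {b..<a} \<le> T\<^sup>2" by (simp add: power2_eq_square)
  moreover have "0 \<le> infsum (len (m c)) {b..<a}"
    by (rule infsum_nonneg) (use len in auto)
  ultimately show ?thesis unfolding eq T_def by simp
qed

lemma continuous_flow:
  assumes "0 < k" "k < 1" shows "continuous_on {0<..} (flow k)"
proof -
  have "continuous_on ({-1<..<1} \<times> {0<..}) (\<lambda>p. flow (fst p) (snd p))"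
    using smooth_on_flow Ck_on_continuous_on unfolding smooth_on_def by blast
  moreover have "continuous_on {0<..} (Pair k)" by (rule continuous_on_Pair[OF continuous_on_const continuous_on_id])
  ultimately have "continuous_on {0<..} (\<lambda>v. flow (fst (k, v)) (snd (k, v)))"
    by (rule continuous_on_compose2) (use assms in auto)
  then show ?thesis by simp
qed

text \<open>Along a ladder the chart differences of the points \<open>(lpt (s n) 0, mid)\<close> become vertical,
  since their first component is at most the square of the weight tail.\<close>

lemma twisted_diffeo_directions:
  fixes B :: "(lpoint \<times> lpoint, real \<times> real) chart set"
  assumes r: "r \<ge> 1" and m: "weight_family I m"
    and fg: "homeomorphic_maps long_ray_sq long_ray_sq f g" "smooth_map r (twisted r m) B f" "smooth_map r B (twisted r m) g"
    and V: "(V, \<psi>) \<in> B" "openin long_ray_sq V" "inj_on \<psi> V" "f (emb2 (lpt a 0, mid)) \<in> V"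
    and s: "strict_mono (s :: nat \<Rightarrow> cord)" "limit_cord a" "\<And>n. s n < a" "\<And>c. c < a \<Longrightarrow> \<exists>n. c < s n" "\<And>n. s n \<noteq> bot"
    and ac: "a < c"
  obtains e \<delta> y b where "e \<noteq> (0 :: real \<times> real)" "\<delta> > 0" "\<And>n :: nat. blk (y n) = bot"
    "(\<lambda>n. (\<psi> (f (emb2 (lpt a 0, y n))) - \<psi> (f (emb2 (lpt a 0, mid)))) /\<^sub>R b n) \<longlonglongrightarrow> e"
    "(\<lambda>n. (\<psi> (f (emb2 (lpt (s n) 0, mid))) - \<psi> (f (emb2 (lpt a 0, mid))))
       /\<^sub>R (- infsum (m c) {s n..<a})) \<longlonglongrightarrow> \<delta> *\<^sub>R e"
proof -
  have ab: "a \<noteq> bot" using s(2) by (simp add: limit_cord_def)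
  have blks: "blk (lpt (s n) 0) = s n" "blk (lpt a 0) = a" "blk mid = bot" "off mid = 1/2" for n
    using ab s(5) by (auto simp: blk_off_lpt)
  have cb: "bot < c" using ac by (metis bot_least le_less_trans)
  have sc: "s n < c" for n using s(3) ac by (rule less_trans)
  have bc: "lpt (s n) 0 \<in> below c" "lpt a 0 \<in> below c" "mid \<in> below c" for n
    using blks ac cb sc by (auto simp: below_def)
  have v0: "phi m c mid = 1/2" using phi_bot[OF m, of mid] blks by simp
  define \<phi> where "\<phi> = chart_map m c"
  let ?U = "emb2 ` (square c)"
  have ch: "(?U, \<phi>) = twist_chart m c" by (simp add: twist_chart_def[OF m] \<phi>_def)
  have U: "(?U, \<phi>) \<in> twisted r m" "is_chart long_ray_sq (?U, \<phi>)"
    unfolding ch by (rule twist_chart_in_twisted[OF m], rule twist_chart_is_chart[OF m])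
  define G where "G = \<psi> \<circ> f \<circ> inv_into ?U \<phi>"
  have G: "G (twist m c P) = \<psi> (f (emb2 P))" if "P \<in> square c" for P
    unfolding G_def \<phi>_def using inv_twist_chart[OF m that] by simp
  have p0: "emb2 (lpt a 0, mid) \<in> ?U" using bc by auto
  define z0 where "z0 = twist m c (lpt a 0, mid)"
  have z0: "\<phi> (emb2 (lpt a 0, mid)) = z0" by (simp add: \<phi>_def z0_def unemb2_emb2)
  obtain D where D: "(G has_derivative D) (at z0)" and Dinj: "\<And>w. D w = 0 \<Longrightarrow> w = 0"
    using diffeo_chart_derivative[OF r fg U V(1-3) p0 V(4)] unfolding G_def z0 by blast
  have lin: "linear D" using D by (rule has_derivative_linear)
  define ka where "ka = kap m c (lpt a 0)"
  have ka: "0 < ka" "ka < 1" unfolding ka_def using kap_bounds[OF m bc(2)] .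
  \<comment> \<open>The shift by \<open>3\<close> keeps all offsets strictly between
    \<open>1/2\<close> and \<open>1\<close>, so the points stay in the first block and differ from
    \<open>mid\<close>.\<close>
  define y where "y n = lpt bot (1/2 + 1 / real (n + 3))" for n :: nat
  have q: "0 < 1 / real (n + 3)" "1 / real (n + 3) < 1/2" for n by (auto simp: field_simps)
  have y: "blk (y n) = bot" "off (y n) = 1/2 + 1 / real (n + 3)" for n
  proof -
    have "0 \<le> 1/2 + 1 / real (n + 3)" "1/2 + 1 / real (n + 3) < 1" "bot \<noteq> (bot::cord) \<or> 1/2 + 1 / real (n + 3) \<noteq> 0"
      using q[of n] by linarith+
    then show "blk (y n) = bot" "off (y n) = 1/2 + 1 / real (n + 3)"
      unfolding y_def by (rule blk_off_lpt)+
  qed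
  have yphi: "phi m c (y n) = 1/2 + 1 / real (n + 3)" for n using phi_bot[OF m y(1)] y(2) by simp
  \<comment> \<open>Dividing by the vertical displacement itself makes every difference quotient in
    the chart equal to \<open>(0, 1)\<close>.\<close>
  define b where "b n = flow ka (phi m c (y n)) - flow ka (1/2)" for n
  have b0: "b n \<noteq> 0" for n
  proof
    assume "b n = 0"
    then have eq: "flow ka (phi m c (y n)) = flow ka (1/2)" by (simp add: b_def)
    have "0 < phi m c (y n)" using q(1)[of n] unfolding yphi by linarith
    from flow_inj[OF this _ less_imp_le[OF ka(1)] eq] have "phi m c (y n) = 1/2" by simp
    then show False using q(1)[of n] unfolding yphi by linarith
  qed
  have b: "b \<longlonglongrightarrow> 0"
  proof -
    have "(\<lambda>n. 1 / real (n + 3)) \<longlonglongrightarrow> 0"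
      using LIMSEQ_ignore_initial_segment[OF lim_1_over_n, of 3] by simp
    then have "(\<lambda>n. 1/2 + 1 / real (n + 3)) \<longlonglongrightarrow> 1/2 + 0" by (rule tendsto_add[OF tendsto_const])
    then have yl: "(\<lambda>n. phi m c (y n)) \<longlonglongrightarrow> 1/2" unfolding yphi by simp
    have "isCont (flow ka) (1/2)"
      using continuous_flow[OF ka] by (simp add: continuous_on_eq_continuous_at)
    then have "(\<lambda>n. flow ka (phi m c (y n))) \<longlonglongrightarrow> flow ka (1/2)"
      using yl by (rule isCont_tendsto_compose)
    then show ?thesis unfolding b_def LIM_zero_iff .
  qed
  have vert: "(twist m c (lpt a 0, y n) - z0) /\<^sub>R b n = (0, 1)" for n
    using b0[of n] by (simp add: twist_def z0_def v0 ka_def[symmetric] b_def)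
  have ybc: "(lpt a 0, y n) \<in> square c" for n using bc y cb by (simp add: below_def)
  have 1: "(\<lambda>n. (G (twist m c (lpt a 0, y n)) - G z0) /\<^sub>R b n) \<longlonglongrightarrow> D (0, 1)"
    by (rule has_derivative_along_sequence[OF D b b0]) (simp only: vert, rule tendsto_const)
  \<comment> \<open>The sign is negative because the ladder approaches \<open>a\<close> from below
    and \<open>kap\<close> increases.\<close>
  define k where "k n = - infsum (m c) {s n..<a}" for n
  have kk: "k n = kap m c (lpt (s n) 0) - ka" for n
    using kap_lpt[OF m ac less_imp_le[OF s(3)] s(5), of n] by (simp add: k_def ka_def)
  have lim: "(\<lambda>n. lpt (s n) 0) \<longlonglongrightarrow> lpt a 0" by (rule ladder_tendsto[OF s])
  have klim: "k \<longlonglongrightarrow> 0"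
  proof -
    have "isCont (kap m c) (lpt a 0)"
      using kap_continuous[OF m] bc(2) open_below by (simp add: continuous_on_eq_continuous_at)
    from isCont_tendsto_compose[OF this lim] have "(\<lambda>n. kap m c (lpt (s n) 0) - ka) \<longlonglongrightarrow> ka - ka"
      unfolding ka_def by (intro tendsto_intros)
    then show ?thesis by (simp add: kk[abs_def])
  qed
  have k0: "k n \<noteq> 0" for n
  proof -
    have "lpt (s n) 0 < lpt a 0" using s(3) by (simp add: lpt_less_iff[OF s(5) ab])
    then have "kap m c (lpt (s n) 0) < ka"
      unfolding kap_def ka_def by (rule cum_strict_mono[OF wt_m[OF m] profile_step _ bc(2)])
    then show ?thesis by (simp add: kk)
  qed
  obtain \<delta> where \<delta>: "\<delta> > 0" "((\<lambda>t. flow t (1/2)) has_real_derivative \<delta>) (at ka)"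
    using flow_has_derivative[of "1/2" ka] ka by auto
  have f1: "(\<lambda>n. (phi m c (lpt (s n) 0) - phi m c (lpt a 0)) / k n) \<longlonglongrightarrow> 0"
  proof (rule Lim_null_comparison)
    show "(\<lambda>n. \<bar>k n\<bar>) \<longlonglongrightarrow> 0" using tendsto_rabs[OF klim] by simp
    have "norm ((phi m c (lpt (s n) 0) - phi m c (lpt a 0)) / k n) \<le> \<bar>k n\<bar>" for n
      using phi_lpt_diff[OF m ac less_imp_le[OF s(3)] s(5), of n] k0[of n]
      by (simp add: k_def abs_minus_commute field_simps power2_eq_square)
    then show "\<forall>\<^sub>F n in sequentially. norm ((phi m c (lpt (s n) 0) - phi m c (lpt a 0)) / k n) \<le> \<bar>k n\<bar>" by simp
  qed
  have f2: "(\<lambda>n. (flow (ka + k n) (1/2) - flow ka (1/2)) /\<^sub>R k n) \<longlonglongrightarrow> \<delta> * 1"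
  proof -
    have "((\<lambda>t. flow t (1/2)) has_derivative (*) \<delta>) (at ka)" using \<delta>(2) by (simp add: has_field_derivative_def)
    moreover have "(\<lambda>n. (ka + k n - ka) /\<^sub>R k n) \<longlonglongrightarrow> 1" using k0 by simp
    ultimately show ?thesis by (rule has_derivative_along_sequence[OF _ klim k0])
  qed
  have zs: "(twist m c (lpt (s n) 0, mid) - z0) /\<^sub>R k n
      = ((phi m c (lpt (s n) 0) - phi m c (lpt a 0)) / k n, (flow (ka + k n) (1/2) - flow ka (1/2)) /\<^sub>R k n)" for n
  proof -
    have "kap m c (lpt (s n) 0) = ka + k n" using kk by simp
    then have "twist m c (lpt (s n) 0, mid) = (phi m c (lpt (s n) 0), flow (ka + k n) (1/2))"
      by (simp only: twist_def fst_conv snd_conv v0)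
    moreover have "z0 = (phi m c (lpt a 0), flow ka (1/2))"
      by (simp only: z0_def twist_def fst_conv snd_conv v0 ka_def)
    ultimately show ?thesis by (simp only: diff_Pair scaleR_Pair real_scaleR_def divide_inverse_commute)
  qed
  have 2: "(\<lambda>n. (G (twist m c (lpt (s n) 0, mid)) - G z0) /\<^sub>R k n) \<longlonglongrightarrow> D (0, \<delta>)"
  proof (rule has_derivative_along_sequence[OF D klim k0])
    show "(\<lambda>n. (twist m c (lpt (s n) 0, mid) - z0) /\<^sub>R k n) \<longlonglongrightarrow> (0, \<delta>)"
      unfolding zs using tendsto_Pair[OF f1 f2] by simp
  qed
  have "D (0, \<delta>) = \<delta> *\<^sub>R D (0, 1)" using linear_scale[OF lin, of \<delta> "(0, 1)"] by simp
  moreover have "D (0, 1) \<noteq> 0" using Dinj[of "(0, 1)"] by (auto simp: zero_prod_def)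
  moreover have "G z0 = \<psi> (f (emb2 (lpt a 0, mid)))" unfolding z0_def by (rule G) (simp add: bc)
  moreover have "G (twist m c (lpt (s n) 0, mid)) = \<psi> (f (emb2 (lpt (s n) 0, mid)))" for n
    by (rule G) (simp add: bc)
  moreover have "G (twist m c (lpt a 0, y n)) = \<psi> (f (emb2 (lpt a 0, y n)))" for n by (rule G[OF ybc])
  ultimately show ?thesis using that[of "D (0, 1)" \<delta> y b] \<delta>(1) y(1) 1 2 unfolding k_def by (simp only: not_False_eq_True)
qed

text \<open>A coordinate that is constant along a sequence vanishes in its limiting direction. Both
  directions are positive multiples of \<open>e\<close>, so constancy of one coordinate on each
  sequence would make \<open>e\<close> zero.\<close>

lemma no_constant_components:
  fixes \<Psi> :: "nat \<Rightarrow> real \<times> real"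
  assumes "e \<noteq> 0" "\<delta> > 0" "(\<lambda>n. (X n - x0) /\<^sub>R b n) \<longlonglongrightarrow> e" "(\<lambda>n. (Y n - x0) /\<^sub>R k n) \<longlonglongrightarrow> \<delta> *\<^sub>R (e :: real \<times> real)"
  shows "\<not> ((\<forall>n :: nat. fst (X n) = fst x0) \<and> (\<forall>n. snd (Y n) = snd x0))"
    "\<not> ((\<forall>n. snd (X n) = snd x0) \<and> (\<forall>n. fst (Y n) = fst x0))"
proof -
  note l = tendsto_fst[OF assms(3)] tendsto_snd[OF assms(3)] tendsto_fst[OF assms(4)] tendsto_snd[OF assms(4)]
  show "\<not> ((\<forall>n. fst (X n) = fst x0) \<and> (\<forall>n. snd (Y n) = snd x0))"
    using l(1,4) assms(1,2) by (auto simp: LIMSEQ_const_iff prod_eq_iff)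
  show "\<not> ((\<forall>n. snd (X n) = snd x0) \<and> (\<forall>n. fst (Y n) = fst x0))"
    using l(2,3) assms(1,2) by (auto simp: LIMSEQ_const_iff prod_eq_iff)
qed

subsection \<open>Almost disjoint windows\<close>

text \<open>A nonzero limit would keep \<open>d\<close> and \<open>d'\<close> within a bounded
  factor. Small values force large indices of their windows, which differ once they are beyond the
  finite intersection, and then the two values of \<open>theta\<close> are further apart than any
  prescribed factor.\<close>

lemma windows_not_comparable:
  assumes I: "finite (I \<inter> J)"
    and d: "\<forall>\<^sub>F n in sequentially. in_window I (d n)" "d \<longlonglongrightarrow> 0"
    and d': "\<forall>\<^sub>F n in sequentially. in_window J (d' n)" "d' \<longlonglongrightarrow> 0"
    and L: "(\<lambda>n. d' n / d n) \<longlonglongrightarrow> L"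
  shows "L = 0"
proof (rule ccontr)
  assume L0: "L \<noteq> 0"
  have pos: "x > 0" if "in_window K x" for K x
    using that theta_pos unfolding in_window_def by (meson less_le_trans)
  have "\<forall>\<^sub>F n in sequentially. 0 \<le> d' n / d n"
    using d(1) d'(1) by eventually_elim (auto dest!: pos)
  then have "0 \<le> L" using L by (intro tendsto_lowerbound) auto
  then have Lp: "L > 0" using L0 by simp
  obtain K0 where K0: "\<And>i. i \<in> I \<inter> J \<Longrightarrow> i < K0" using I finite_nat_iff_bounded by (metis lessThan_iff subsetD)
  \<comment> \<open>\<open>4 / L < 2 ^ K\<close> refutes the case where the index for
    \<open>d\<close> is the smaller one, and \<open>4 * L < 2 ^ K\<close> the opposite case; each
    \<open>4\<close> combines the window factor \<open>2\<close> with the tolerance factor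
    \<open>2\<close> around \<open>L\<close>.\<close>
  obtain K1 where K1: "4 / L < 2 ^ K1" using real_arch_pow[of 2 "4 / L"] by auto
  obtain K2 where K2: "4 * L < 2 ^ K2" using real_arch_pow[of 2 "4 * L"] by auto
  define K where "K = max K0 (max K1 K2)"
  have "(2::real) ^ K1 \<le> 2 ^ K" "(2::real) ^ K2 \<le> 2 ^ K"
    by (rule power_increasing; simp add: K_def)+
  then have K: "4 / L < 2 ^ K" "4 * L < 2 ^ K" using K1 K2 by linarith+
  have small: "\<forall>\<^sub>F n in sequentially. x n < theta K" if "x \<longlonglongrightarrow> 0" for x :: "nat \<Rightarrow> real"
    using that theta_pos by (rule order_tendstoD)
  have big: "K < N" if "theta N \<le> x" "x < theta K" for N x
  proof (rule ccontr)
    assume "\<not> K < N"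
    then have "N\<^sup>2 \<le> K\<^sup>2" by (simp add: power_mono)
    then have "theta K \<le> theta N" unfolding theta_def by (intro power_decreasing) auto
    then show False using that by simp
  qed
  have up: "theta M * 2 ^ K \<le> theta N" if "N < M" "K < N" for N M
  proof -
    have "theta M * 2 ^ (N + M) \<le> theta N" using theta_decreasing[OF that(1)] by (simp add: field_simps)
    moreover have "(2::real) ^ K \<le> 2 ^ (N + M)" using that by (intro power_increasing) auto
    then have "theta M * 2 ^ K \<le> theta M * 2 ^ (N + M)"
      using theta_pos[of M] by (intro mult_left_mono) auto
    ultimately show ?thesis by linarith
  qed
  have ev: "\<forall>\<^sub>F n in sequentially. d' n / d n < 2 * L" "\<forall>\<^sub>F n in sequentially. L / 2 < d' n / d n"
    by (rule order_tendstoD[OF L]; use Lp in simp)+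
  have "\<forall>\<^sub>F n in sequentially. False"
    using d(1) d'(1) small[OF d(2)] small[OF d'(2)] ev
  proof eventually_elim
    case (elim n)
    obtain N where N: "N \<in> I" "theta N \<le> d n" "d n \<le> 2 * theta N" using elim(1) by (auto simp: in_window_def)
    obtain M where M: "M \<in> J" "theta M \<le> d' n" "d' n \<le> 2 * theta M" using elim(2) by (auto simp: in_window_def)
    have NM: "K < N" "K < M" using big N(2) M(2) elim(3,4) by auto
    have dp: "0 < d n" using pos elim(1) by blast
    have "N \<noteq> M"
    proof
      assume "N = M"
      then have "N < K0" using K0 N(1) M(1) by blast
      then show False using NM by (simp add: K_def)
    qed
    then consider "N < M" | "M < N" by linarith
    then show False
    proof cases
      case 1
      have "d' n * 2 ^ K \<le> 2 * theta M * 2 ^ K" using M(3) by (intro mult_right_mono) auto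
      also have "\<dots> \<le> 2 * d n" using up[OF 1 NM(1)] N(2) by simp
      finally have 1: "d' n * 2 ^ K \<le> 2 * d n" .
      have "L / 2 * d n < d' n" using elim(6) dp by (simp add: field_simps)
      then have "L / 2 * d n * 2 ^ K < d' n * 2 ^ K" by (intro mult_strict_right_mono) auto
      moreover have "d n * (L * 2 ^ K) = 2 * (L / 2 * d n * 2 ^ K)" by simp
      ultimately have "d n * (L * 2 ^ K) < d n * 4" using 1 by linarith
      then have "L * 2 ^ K < 4" using dp by simp
      then show False using K(1) Lp by (simp add: field_simps)
    next
      case 2
      have "d n * 2 ^ K \<le> 2 * theta N * 2 ^ K" using N(3) by (intro mult_right_mono) auto
      also have "\<dots> \<le> 2 * d' n" using up[OF 2 NM(2)] M(2) by simp
      also have "\<dots> < 2 * (2 * L * d n)" using elim(5) dp by (simp add: field_simps)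
      also have "\<dots> = d n * (4 * L)" by simp
      finally have "d n * 2 ^ K < d n * (4 * L)" .
      then show False using K(2) dp by simp
    qed
  qed
  then show False by simp
qed

text \<open>The branch of \<open>R\<close> in the binary tree, its nodes being codes of the finite
  initial segments tagged with their lengths. Distinct branches separate at the first differing
  element, the classical almost disjoint family.\<close>

definition code_set :: "nat set \<Rightarrow> nat set" where
  "code_set R = range (\<lambda>n. prod_encode (n, set_encode (R \<inter> {..<n})))"

lemma infinite_code_set: "infinite (code_set R)"
proof -
  have "inj (\<lambda>n. prod_encode (n, set_encode (R \<inter> {..<n})))"
    by (auto intro!: injI simp: prod_encode_eq)
  then show ?thesis unfolding code_set_def by (rule range_inj_infinite)
qed

lemma finite_code_set_Int:
  assumes "R \<noteq> R'" shows "finite (code_set R \<inter> code_set R')"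
proof -
  obtain i where i: "(i \<in> R) \<noteq> (i \<in> R')" using assms by blast
  have "code_set R \<inter> code_set R' \<subseteq> (\<lambda>n. prod_encode (n, set_encode (R \<inter> {..<n}))) ` {..i}"
  proof
    fix x assume x: "x \<in> code_set R \<inter> code_set R'"
    then obtain n n' where n: "x = prod_encode (n, set_encode (R \<inter> {..<n}))" "x = prod_encode (n', set_encode (R' \<inter> {..<n'}))"
      unfolding code_set_def by blast
    then have "n = n' \<and> set_encode (R \<inter> {..<n}) = set_encode (R' \<inter> {..<n'})"
      by (metis prod_encode_eq prod.inject)
    then have "set_encode (R \<inter> {..<n}) = set_encode (R' \<inter> {..<n})" by metis
    then have "R \<inter> {..<n} = R' \<inter> {..<n}" by (simp add: set_encode_eq)
    then have "n \<le> i" using i by (metis Int_iff lessThan_iff not_less)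
    then show "x \<in> (\<lambda>n. prod_encode (n, set_encode (R \<inter> {..<n}))) ` {..i}" using n(1) by blast
  qed
  then show ?thesis by (rule finite_subset) simp
qed

text \<open>For each \<open>a\<close> a single injection of the ordinals below \<open>a\<close> into
  the naturals serves all \<open>A\<close>, so distinct traces below \<open>a\<close> yield distinct
  branches.\<close>

definition subset_code :: "nat set set \<Rightarrow> cord \<Rightarrow> nat set" where
  "subset_code A a = code_set (to_nat_on {..<a} ` {g. g < a \<and> rep_cord g \<in> A})"

text \<open>One ordinal in which \<open>A\<close> and \<open>B\<close> differ separates their traces
  at every larger \<open>a\<close>, so every late stage tells the two sets apart.\<close>

lemma finite_subset_code_Int:
  assumes "A \<subseteq> Field omega1" "B \<subseteq> Field omega1" "A \<noteq> B"
  shows "\<exists>d. \<forall>a>d. finite (subset_code A a \<inter> subset_code B a)"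
proof -
  obtain x where "(x \<in> A) \<noteq> (x \<in> B)" using assms(3) by blast
  moreover from this have "x \<in> Field omega1" using assms(1,2) by blast
  ultimately obtain g where g: "(rep_cord g \<in> A) \<noteq> (rep_cord g \<in> B)" by (metis rep_cord_cases)
  have "finite (subset_code A a \<inter> subset_code B a)" if "g < a" for a
    unfolding subset_code_def
  proof (rule finite_code_set_Int)
    have inj: "inj_on (to_nat_on {..<a}) {..<a}" by (rule inj_on_to_nat_on[OF countable_lessThan_cord])
    have "{g. g < a \<and> rep_cord g \<in> A} \<noteq> {g. g < a \<and> rep_cord g \<in> B}" using g that by blast
    then show "to_nat_on {..<a} ` {g. g < a \<and> rep_cord g \<in> A} \<noteq> to_nat_on {..<a} ` {g. g < a \<and> rep_cord g \<in> B}"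
      using inj_on_image_eq_iff[OF inj, of "{g. g < a \<and> rep_cord g \<in> A}" "{g. g < a \<and> rep_cord g \<in> B}"] by blast
  qed
  then show ?thesis by blast
qed

subsection \<open>Non-diffeomorphism\<close>

text \<open>The windows are prescribed for the choice \<open>m a\<close> at stage \<open>a\<close>,
  whereas a chart around the point uses \<open>m c\<close> with \<open>c > a\<close>. The two differ
  at finitely many places below \<open>a\<close>, so tails starting beyond these places
  coincide.\<close>

lemma tail_facts:
  assumes m: "weight_family I m" and ac: "a < c"
    and s: "strict_mono (s :: nat \<Rightarrow> cord)" "limit_cord a" "\<And>n. s n < a" "\<And>c. c < a \<Longrightarrow> \<exists>n. c < s n" "\<And>n. s n \<noteq> bot"
  shows "(\<lambda>n. infsum (m c) {s n..<a}) \<longlonglongrightarrow> 0"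
    and "\<And>n. infsum (m c) {s n..<a} > 0"
    and "\<forall>\<^sub>F n in sequentially. in_window (I a) (infsum (m c) {s n..<a})"
proof -
  have ab: "a \<noteq> bot" using s(2) by (simp add: limit_cord_def)
  have bc: "lpt a 0 \<in> below c" using ac ab by (simp add: below_def blk_off_lpt)
  have eq: "infsum (m c) {s n..<a} = kap m c (lpt a 0) - kap m c (lpt (s n) 0)" for n
    using kap_lpt[OF m ac less_imp_le[OF s(3)] s(5), of n] by simp
  have "isCont (kap m c) (lpt a 0)"
    using kap_continuous[OF m] bc open_below by (simp add: continuous_on_eq_continuous_at)
  from tendsto_diff[OF tendsto_const[of "kap m c (lpt a 0)"] isCont_tendsto_compose[OF this ladder_tendsto[OF s]]]
  show "(\<lambda>n. infsum (m c) {s n..<a}) \<longlonglongrightarrow> 0" unfolding eq by simp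
  show "infsum (m c) {s n..<a} > 0" for n
  proof -
    have "lpt (s n) 0 < lpt a 0" using s(3) by (simp add: lpt_less_iff[OF s(5) ab])
    then have "kap m c (lpt (s n) 0) < kap m c (lpt a 0)"
      unfolding kap_def by (rule cum_strict_mono[OF wt_m[OF m] profile_step _ bc])
    then show ?thesis unfolding eq by simp
  qed
  define Z where "Z = {g. g < a \<and> m a g \<noteq> m c g}"
  have Z: "finite Z" unfolding Z_def by (rule finite_m_diff[OF m ac])
  have "\<exists>b<a. \<forall>g\<in>Z. g \<le> b"
  proof (cases "Z = {}")
    case True
    then show ?thesis using ab by (auto intro!: exI[of _ bot] simp: bot.not_eq_extremum)
  next
    case False
    then have "Max Z \<in> Z" using Z by simp
    then show ?thesis using Z by (intro exI[of _ "Max Z"]) (auto simp: Z_def)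
  qed
  then obtain b where b: "b < a" "\<And>g. g \<in> Z \<Longrightarrow> g \<le> b" by blast
  obtain N where N: "b < s N" using s(4)[OF b(1)] by blast
  have "in_window (I a) (infsum (m c) {s n..<a})" if n: "N \<le> n" for n
  proof -
    have "s N \<le> s n" using s(1) n by (simp add: strict_mono_less_eq)
    then have bn: "b < s n" using N by (meson less_le_trans)
    have "infsum (m c) {s n..<a} = infsum (m a) {s n..<a}"
    proof (rule infsum_cong)
      fix g assume g: "g \<in> {s n..<a}"
      then have "b < g" using bn by (meson atLeastLessThan_iff less_le_trans)
      then have "g \<notin> Z" using b(2) leD by blast
      then show "m c g = m a g" using g by (simp add: Z_def)
    qed
    then show ?thesis using in_window_m[OF m s(2) s(3), of n] by simp
  qed
  then show "\<forall>\<^sub>F n in sequentially. in_window (I a) (infsum (m c) {s n..<a})"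
    unfolding eventually_sequentially by blast
qed

section \<open>Exclusion of product-like behaviour and comparison of tails\<close>

lemma induced_map:
  assumes "homeomorphic_maps long_ray_sq long_ray_sq f g"
  obtains F where "continuous_on UNIV F" "inj F" "\<And>P. f (emb2 P) = emb2 (F P)"
proof -
  define F where "F = unemb2 \<circ> (f \<circ> emb2)"
  have c: "continuous_map long_ray_sq long_ray_sq f" and gf: "\<And>p. p \<in> topspace long_ray_sq \<Longrightarrow> g (f p) = p"
    using assms by (auto simp: homeomorphic_maps_def)
  have e: "continuous_map euclidean long_ray_sq emb2" "continuous_map long_ray_sq euclidean unemb2"
    using homeomorphic_maps_unemb2 by (auto simp: homeomorphic_maps_def)
  have "continuous_map euclidean euclidean F"
    unfolding F_def by (intro continuous_map_compose[OF _ e(2)] continuous_map_compose[OF e(1)] c)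
  then have "continuous_on UNIV F" by simp
  moreover have fe: "f (emb2 P) = emb2 (F P)" for P
  proof -
    have "emb2 P \<in> topspace long_ray_sq" by (simp add: topspace_long_ray_sq)
    then have "f (emb2 P) \<in> range emb2"
      using continuous_map_image_subset_topspace[OF c] topspace_long_ray_sq by blast
    then show ?thesis by (auto simp: F_def unemb2_emb2)
  qed
  moreover have "inj F"
  proof (rule inj_on_inverseI)
    show "unemb2 (g (emb2 (F P))) = P" for P
      using gf[of "emb2 P"] fe[of P] by (simp add: topspace_long_ray_sq unemb2_emb2)
  qed
  ultimately show ?thesis using that by blast
qed

text \<open>The target chart has to look like a product only along the vertical line and along the
  ladder. This covers genuine product charts and also twisted charts at places where the flow is at
  rest.\<close>

lemma diffeo_not_product_like:
  fixes B :: "(lpoint \<times> lpoint, real \<times> real) chart set"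
  assumes r: "r \<ge> 1" and m: "weight_family I m"
    and fg: "homeomorphic_maps long_ray_sq long_ray_sq f g" "smooth_map r (twisted r m) B f" "smooth_map r B (twisted r m) g"
    and V: "(V, \<psi>) \<in> B" "openin long_ray_sq V" "inj_on \<psi> V" "f (emb2 (lpt a 0, mid)) \<in> V"
    and s: "strict_mono (s :: nat \<Rightarrow> cord)" "limit_cord a" "\<And>n. s n < a" "\<And>c. c < a \<Longrightarrow> \<exists>n. c < s n" "\<And>n. s n \<noteq> bot"
    and const: "(\<forall>y. blk y = bot \<longrightarrow> fst (\<psi> (f (emb2 (lpt a 0, y)))) = fst (\<psi> (f (emb2 (lpt a 0, mid))))) \<and>
        (\<forall>n. snd (\<psi> (f (emb2 (lpt (s n) 0, mid)))) = snd (\<psi> (f (emb2 (lpt a 0, mid)))))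
      \<or> (\<forall>y. blk y = bot \<longrightarrow> snd (\<psi> (f (emb2 (lpt a 0, y)))) = snd (\<psi> (f (emb2 (lpt a 0, mid))))) \<and>
        (\<forall>n. fst (\<psi> (f (emb2 (lpt (s n) 0, mid)))) = fst (\<psi> (f (emb2 (lpt a 0, mid)))))"
  shows False
proof -
  obtain c where ac: "a < c" using cord_gt_ex by blast
  obtain e \<delta> y b where e: "e \<noteq> (0 :: real \<times> real)" "\<delta> > 0" "\<And>n :: nat. blk (y n) = bot"
    "(\<lambda>n. (\<psi> (f (emb2 (lpt a 0, y n))) - \<psi> (f (emb2 (lpt a 0, mid)))) /\<^sub>R b n) \<longlonglongrightarrow> e"
    "(\<lambda>n. (\<psi> (f (emb2 (lpt (s n) 0, mid))) - \<psi> (f (emb2 (lpt a 0, mid))))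
       /\<^sub>R (- infsum (m c) {s n..<a})) \<longlonglongrightarrow> \<delta> *\<^sub>R e"
    using twisted_diffeo_directions[OF r m fg V s ac] by blast
  show False using no_constant_components[OF e(1,2,4,5)] const e(3) by blast
qed

text \<open>By the dichotomy one component of the homeomorphism is constant on the vertical line at
  \<open>a\<close> and the other along a ladder to \<open>a\<close>. Product charts treat the
  components separately, so the constancy persists in the chart.\<close>

lemma twisted_exotic:
  fixes D E :: "(lpoint, real) chart set"
  assumes r: "r \<ge> 1" and m: "weight_family I m" and D: "diff_structure r long_ray D" and E: "diff_structure r long_ray E"
  shows "\<not> diffeomorphic r long_ray_sq (twisted r m) long_ray_sq (prod_atlas D E)"
proof
  assume "diffeomorphic r long_ray_sq (twisted r m) long_ray_sq (prod_atlas D E)"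
  then obtain f g where fg: "homeomorphic_maps long_ray_sq long_ray_sq f g"
      "smooth_map r (twisted r m) (prod_atlas D E) f" "smooth_map r (prod_atlas D E) (twisted r m) g"
    unfolding diffeomorphic_def by blast
  obtain F where F: "continuous_on UNIV F" "inj F" "\<And>P. f (emb2 P) = emb2 (F P)" using induced_map[OF fg(1)] by blast
  define u v where "u P = fst (F P)" and "v P = snd (F P)" for P
  have uv: "continuous_on UNIV u" "continuous_on UNIV v" "inj (\<lambda>p. (u p, v p))"
    unfolding u_def v_def using F by (auto intro: continuous_intros)
  have chart: "\<exists>U \<alpha>. (U, \<alpha>) \<in> X \<and> emb x \<in> U \<and> is_chart long_ray (U, \<alpha>)"
    if X: "diff_structure r long_ray X" for X :: "(lpoint, real) chart set" and x
  proof -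
    have "atlas r long_ray X" using X unfolding diff_structure_def by (rule conjunct1)
    then have *: "\<Union> (fst ` X) = range emb" "\<forall>c\<in>X. is_chart long_ray c"
      unfolding atlas_def topspace_long_ray by blast+
    have "emb x \<in> \<Union> (fst ` X)" unfolding *(1) by (rule rangeI)
    then obtain c where "c \<in> X" "emb x \<in> fst c" by (elim UN_E)
    then show ?thesis using *(2) by (intro exI[of _ "fst c"] exI[of _ "snd c"]) simp
  qed
  have contra: False
    if s: "strict_mono (s :: nat \<Rightarrow> cord)" "limit_cord a" "\<And>n. s n < a" "\<And>c. c < a \<Longrightarrow> \<exists>n. c < s n" "\<And>n. s n \<noteq> bot"
      and c: "(\<forall>y. blk y = bot \<longrightarrow> u (lpt a 0, y) = u (lpt a 0, mid)) \<and>
          (\<forall>n. v (lpt (s n) 0, mid) = v (lpt a 0, mid))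
        \<or> (\<forall>y. blk y = bot \<longrightarrow> v (lpt a 0, y) = v (lpt a 0, mid)) \<and>
          (\<forall>n. u (lpt (s n) 0, mid) = u (lpt a 0, mid))" for s a
  proof -
    let ?P = "(lpt a 0, mid)"
    obtain U \<alpha> where U: "(U, \<alpha>) \<in> D" "emb (u ?P) \<in> U" "is_chart long_ray (U, \<alpha>)" using chart[OF D] by blast
    obtain W \<beta> where W: "(W, \<beta>) \<in> E" "emb (v ?P) \<in> W" "is_chart long_ray (W, \<beta>)" using chart[OF E] by blast
    let ?\<psi> = "\<lambda>(x, y). (\<alpha> x, \<beta> y)"
    have \<psi>: "?\<psi> (f (emb2 P)) = (\<alpha> (emb (u P)), \<beta> (emb (v P)))" for P
      unfolding F(3) by (simp add: emb2_def u_def v_def)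
    have 1: "(U \<times> W, ?\<psi>) \<in> prod_atlas D E" unfolding prod_atlas_def using U(1) W(1) by blast
    have 2: "openin long_ray_sq (U \<times> W)"
      using U(3) W(3) by (auto simp: long_ray_sq_def is_chart_def openin_prod_Times_iff)
    have 3: "inj_on ?\<psi> (U \<times> W)"
      using is_chart_inj[OF U(3)] is_chart_inj[OF W(3)] by (auto simp: inj_on_def)
    have 4: "f (emb2 ?P) \<in> U \<times> W" using U(2) W(2) unfolding F(3) by (simp add: emb2_def u_def v_def)
    show False
    proof (rule diffeo_not_product_like[OF r m fg 1 2 3 4 s], unfold \<psi> fst_conv snd_conv)
      from c show "(\<forall>y. blk y = bot \<longrightarrow> \<alpha> (emb (u (lpt a 0, y))) = \<alpha> (emb (u ?P))) \<and>
          (\<forall>n. \<beta> (emb (v (lpt (s n) 0, mid))) = \<beta> (emb (v ?P)))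
        \<or> (\<forall>y. blk y = bot \<longrightarrow> \<beta> (emb (v (lpt a 0, y))) = \<beta> (emb (v ?P))) \<and>
          (\<forall>n. \<alpha> (emb (u (lpt (s n) 0, mid))) = \<alpha> (emb (u ?P)))"
      proof
        assume "(\<forall>y. blk y = bot \<longrightarrow> u (lpt a 0, y) = u ?P) \<and> (\<forall>n. v (lpt (s n) 0, mid) = v ?P)"
        then show ?thesis by (intro disjI1) metis
      next
        assume "(\<forall>y. blk y = bot \<longrightarrow> v (lpt a 0, y) = v ?P) \<and> (\<forall>n. u (lpt (s n) 0, mid) = u ?P)"
        then show ?thesis by (intro disjI2) metis
      qed
    qed
  qed
  have blk_half: "blk (mid) = bot" by (simp add: blk_off_lpt)
  from slice_dichotomy[OF uv] show False
  proof
    assume b: "\<forall>t\<in>{0<..<1}. bounded_ray (\<lambda>x. v (x, lpt bot t)) \<and> \<not> bounded_ray (\<lambda>x. u (x, lpt bot t))"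
    from slice_ladder[OF uv(1,2) b, of bot] obtain s a q where
      s: "strict_mono (s :: nat \<Rightarrow> cord)" "limit_cord a" "\<And>n. s n < a" "\<And>c. c < a \<Longrightarrow> \<exists>n. c < s n" "\<And>n. bot < s n"
      and c: "\<And>y. blk y = bot \<Longrightarrow> u (lpt a 0, y) = lpt a 0" "\<And>n. v (lpt (s n) 0, mid) = q"
        "v (lpt a 0, mid) = q" by metis
    have sb: "\<And>n. s n \<noteq> bot" using s(5) by (metis less_irrefl)
    show False using contra[OF s(1-4) sb] c blk_half by simp
  next
    assume b: "\<forall>t\<in>{0<..<1}. bounded_ray (\<lambda>x. u (x, lpt bot t)) \<and> \<not> bounded_ray (\<lambda>x. v (x, lpt bot t))"
    from slice_ladder[OF uv(2,1) b, of bot] obtain s a q where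
      s: "strict_mono (s :: nat \<Rightarrow> cord)" "limit_cord a" "\<And>n. s n < a" "\<And>c. c < a \<Longrightarrow> \<exists>n. c < s n" "\<And>n. bot < s n"
      and c: "\<And>y. blk y = bot \<Longrightarrow> v (lpt a 0, y) = lpt a 0" "\<And>n. u (lpt (s n) 0, mid) = q"
        "u (lpt a 0, mid) = q" by metis
    have sb: "\<And>n. s n \<noteq> bot" using s(5) by (metis less_irrefl)
    show False using contra[OF s(1-4) sb] c blk_half by simp
  qed
qed

text \<open>If the factors are interchanged, or if the ladder maps to a line outside the first
  block, the flow of the target is at rest and the target looks like a product. Otherwise both
  structures measure the same vertical displacement by their own tails, whose ratio must then have a
  nonzero limit.\<close>

lemma twisted_not_diffeomorphic:
  assumes r: "r \<ge> 1" and m: "weight_family I m" and m': "weight_family J m'"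
    and IJ: "\<forall>a>d. finite (I a \<inter> J a)"
  shows "\<not> diffeomorphic r long_ray_sq (twisted r m) long_ray_sq (twisted r m')"
proof
  assume "diffeomorphic r long_ray_sq (twisted r m) long_ray_sq (twisted r m')"
  then obtain f g where fg: "homeomorphic_maps long_ray_sq long_ray_sq f g"
      "smooth_map r (twisted r m) (twisted r m') f" "smooth_map r (twisted r m') (twisted r m) g"
    unfolding diffeomorphic_def by blast
  obtain F where F: "continuous_on UNIV F" "inj F" "\<And>P. f (emb2 P) = emb2 (F P)" using induced_map[OF fg(1)] by blast
  define u v where "u P = fst (F P)" and "v P = snd (F P)" for P
  have uv: "continuous_on UNIV u" "continuous_on UNIV v" "inj (\<lambda>p. (u p, v p))"
    unfolding u_def v_def using F by (auto intro: continuous_intros)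
  have Fuv: "F P = (u P, v P)" for P by (simp add: u_def v_def)
  have blk_half: "blk mid = bot" by (simp add: blk_off_lpt)
  have chart: "(emb2 ` (square c), chart_map m' c) \<in> twisted r m'"
      "openin long_ray_sq (emb2 ` (square c))"
      "inj_on (chart_map m' c) (emb2 ` (square c))" for c
    using twist_chart_in_twisted[OF m', of c r] twist_chart_is_chart[OF m', of c] is_chart_inj[OF twist_chart_is_chart[OF m', of c]]
    by (simp_all add: twist_chart_def[OF m'] is_chart_def)
  have \<psi>: "(chart_map m' c) (f (emb2 P)) = (phi m' c (u P), flow (kap m' c (u P)) (phi m' c (v P)))" for c P
    by (simp add: F(3) unemb2_emb2 twist_def Fuv)
  from slice_dichotomy[OF uv] show False
  proof
    assume b: "\<forall>t\<in>{0<..<1}. bounded_ray (\<lambda>x. u (x, lpt bot t)) \<and> \<not> bounded_ray (\<lambda>x. v (x, lpt bot t))"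
    from slice_ladder[OF uv(2,1) b, of bot] obtain s a q where
      s: "strict_mono (s :: nat \<Rightarrow> cord)" "limit_cord a" "\<And>n. s n < a" "\<And>c. c < a \<Longrightarrow> \<exists>n. c < s n" "\<And>n. bot < s n"
      and q: "blk q < s 0"
      and c: "\<And>y. blk y = bot \<Longrightarrow> v (lpt a 0, y) = lpt a 0" "\<And>n. u (lpt (s n) 0, mid) = q" "u (lpt a 0, mid) = q" by metis
    have sb: "\<And>n. s n \<noteq> bot" using s(5) by (metis less_irrefl)
    obtain c where ac: "a < c" using cord_gt_ex by blast
    have ab: "a \<noteq> bot" using s(2) by (simp add: limit_cord_def)
    have bc: "lpt a 0 \<in> below c" "blk (lpt a 0) \<noteq> bot" using ac ab by (simp_all add: below_def blk_off_lpt)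
    have qc: "q \<in> below c" using q s(3)[of 0] ac by (simp add: below_def)
    have 4: "f (emb2 (lpt a 0, mid)) \<in> emb2 ` (square c)"
      using c(3) c(1)[OF blk_half] bc qc by (simp add: F(3) Fuv)
    \<comment> \<open>After the interchange the second component of the image is
      \<open>lpt a 0\<close>, outside the first block, so the flow leaves it alone.\<close>
    have ge: "1 \<le> phi m' c (lpt a 0)" by (rule phi_ge_1[OF m' bc])
    show False
    proof (rule diffeo_not_product_like[OF r m fg chart[of c] 4 s(1-4) sb], assumption, rule disjI2, intro conjI allI impI)
      fix y assume "blk y = bot"
      then show "snd ((chart_map m' c) (f (emb2 (lpt a 0, y)))) = snd ((chart_map m' c) (f (emb2 (lpt a 0, mid))))"
        unfolding \<psi> snd_conv using c(1) blk_half flow_ge_1[OF ge] by simp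
    next
      fix n
      show "fst ((chart_map m' c) (f (emb2 (lpt (s n) 0, mid)))) = fst ((chart_map m' c) (f (emb2 (lpt a 0, mid))))"
        unfolding \<psi> fst_conv c(2,3) ..
    qed
  next
    assume b: "\<forall>t\<in>{0<..<1}. bounded_ray (\<lambda>x. v (x, lpt bot t)) \<and> \<not> bounded_ray (\<lambda>x. u (x, lpt bot t))"
    from slice_ladder[OF uv(1,2) b, of d] obtain s a q where
      s: "strict_mono (s :: nat \<Rightarrow> cord)" "limit_cord a" "\<And>n. s n < a" "\<And>c. c < a \<Longrightarrow> \<exists>n. c < s n" "\<And>n. d < s n"
      and q: "blk q < s 0"
      and c: "\<And>n y. blk y = bot \<Longrightarrow> u (lpt (s n) 0, y) = lpt (s n) 0"
        "\<And>y. blk y = bot \<Longrightarrow> u (lpt a 0, y) = lpt a 0" "\<And>n. v (lpt (s n) 0, mid) = q" "v (lpt a 0, mid) = q" by metis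
    have sb: "s n \<noteq> bot" for n using s(5)[of n] by (metis bot_least leD)
    obtain c where ac: "a < c" using cord_gt_ex by blast
    have ab: "a \<noteq> bot" using s(2) by (simp add: limit_cord_def)
    have bc: "lpt a 0 \<in> below c" using ac ab by (simp add: below_def blk_off_lpt)
    have qc: "q \<in> below c" using q s(3)[of 0] ac by (simp add: below_def)
    have 4: "f (emb2 (lpt a 0, mid)) \<in> emb2 ` (square c)"
      using c(4) c(2)[OF blk_half] bc qc by (simp add: F(3) Fuv)
    show False
    proof (cases "blk q = bot")
      case False
      have ge: "1 \<le> phi m' c q" by (rule phi_ge_1[OF m' qc False])
      show False
      proof (rule diffeo_not_product_like[OF r m fg chart[of c] 4 s(1-4) sb], assumption, rule disjI1, intro conjI allI impI)
        fix y assume "blk y = bot"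
        then show "fst ((chart_map m' c) (f (emb2 (lpt a 0, y)))) = fst ((chart_map m' c) (f (emb2 (lpt a 0, mid))))"
          unfolding \<psi> fst_conv using c(2) blk_half by simp
      next
        fix n
        show "snd ((chart_map m' c) (f (emb2 (lpt (s n) 0, mid)))) = snd ((chart_map m' c) (f (emb2 (lpt a 0, mid))))"
          unfolding \<psi> snd_conv c(3,4) flow_ge_1[OF ge] ..
      qed
    next
      \<comment> \<open>Now the ladder maps into the moving part of the target, where the twists of
        both structures are visible.\<close>
      case True
      define t t' where "t n = infsum (m c) {s n..<a}" and "t' n = infsum (m' c) {s n..<a}" for n
      have T: "t \<longlonglongrightarrow> 0" "t n > 0" "\<forall>\<^sub>F n in sequentially. in_window (I a) (t n)" for n
        unfolding t_def by (rule tail_facts[OF m ac s(1-4) sb], assumption)+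
      have T': "t' \<longlonglongrightarrow> 0" "t' n > 0" "\<forall>\<^sub>F n in sequentially. in_window (J a) (t' n)" for n
        unfolding t'_def by (rule tail_facts[OF m' ac s(1-4) sb], assumption)+
      define w where "w = phi m' c q"
      have w: "0 < w" "w < 1" unfolding w_def phi_bot[OF m' True] using off_bounds off_pos[OF True] by auto
      define ka where "ka = kap m' c (lpt a 0)"
      have ka: "ka \<ge> 0" unfolding ka_def using kap_bounds(1)[OF m' bc] by simp
      have kan: "kap m' c (lpt (s n) 0) = ka + - t' n" for n
        using kap_lpt[OF m' ac less_imp_le[OF s(3)] sb, of n] by (simp add: t'_def ka_def)
      define Q where "Q n = flow (ka + - t' n) w - flow ka w" for n
      have \<psi>n: "(chart_map m' c) (f (emb2 (lpt (s n) 0, mid))) = (phi m' c (lpt (s n) 0), flow (ka + - t' n) w)" for n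
        unfolding \<psi> c(1)[OF blk_half] c(3) kan w_def ..
      have \<psi>a: "(chart_map m' c) (f (emb2 (lpt a 0, mid))) = (phi m' c (lpt a 0), flow ka w)"
        unfolding \<psi> c(2)[OF blk_half] c(4) ka_def w_def ..
      have \<psi>y: "fst ((chart_map m' c) (f (emb2 (lpt a 0, y)))) = phi m' c (lpt a 0)" if "blk y = bot" for y
        unfolding \<psi> c(2)[OF that] fst_conv ..
      obtain e \<delta> y b where e: "e \<noteq> (0 :: real \<times> real)" "\<delta> > 0" "\<And>n :: nat. blk (y n) = bot"
        "(\<lambda>n. ((chart_map m' c) (f (emb2 (lpt a 0, y n))) - (chart_map m' c) (f (emb2 (lpt a 0, mid)))) /\<^sub>R b n) \<longlonglongrightarrow> e"
        "(\<lambda>n. ((chart_map m' c) (f (emb2 (lpt (s n) 0, mid))) - (chart_map m' c) (f (emb2 (lpt a 0, mid))))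
           /\<^sub>R (- infsum (m c) {s n..<a})) \<longlonglongrightarrow> \<delta> *\<^sub>R e"
        using twisted_diffeo_directions[OF r m fg chart[of c] 4 s(1-4) sb ac] by blast
      \<comment> \<open>The first coordinate of the image is constant on the vertical line, so the
        limiting direction is vertical and its second component carries all of
        \<open>e\<close>.\<close>
      have "fst e = 0"
        using tendsto_fst[OF e(4)] by (simp add: \<psi>y[OF e(3)] \<psi>y[OF blk_half] LIMSEQ_const_iff del: comp_apply)
      then have e2: "snd e \<noteq> 0" using e(1) by (simp add: prod_eq_iff)
      have lim1: "(\<lambda>n. Q n /\<^sub>R (- t n)) \<longlonglongrightarrow> \<delta> * snd e"
        using tendsto_snd[OF e(5)] unfolding \<psi>n \<psi>a t_def[symmetric] Q_def by (simp add: snd_scaleR)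
      obtain \<delta>' where \<delta>': "\<delta>' > 0" "((\<lambda>t. flow t w) has_real_derivative \<delta>') (at ka)"
        using flow_has_derivative[OF w ka] by blast
      have nt: "(\<lambda>n. - t' n) \<longlonglongrightarrow> 0" "- t' n \<noteq> 0" for n using tendsto_minus[OF T'(1)] T'(2)[of n] by auto
      have lim2: "(\<lambda>n. Q n /\<^sub>R (- t' n)) \<longlonglongrightarrow> \<delta>' * 1"
        unfolding Q_def
      proof -
        have "((\<lambda>t. flow t w) has_derivative (*) \<delta>') (at ka)" using \<delta>'(2) by (simp add: has_field_derivative_def)
        moreover have "(\<lambda>n. (ka + - t' n - ka) /\<^sub>R (- t' n)) \<longlonglongrightarrow> 1" using nt(2) by simp
        ultimately show "(\<lambda>n. (flow (ka + - t' n) w - flow ka w) /\<^sub>R (- t' n)) \<longlonglongrightarrow> \<delta>' * 1"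
          by (rule has_derivative_along_sequence[OF _ nt])
      qed
      \<comment> \<open>The displacement \<open>Q n\<close> is asymptotically proportional to
        \<open>t n\<close> through the derivative of the diffeomorphism, and to \<open>t' n\<close>
        through the flow of the target; dividing eliminates it.\<close>
      have "(\<lambda>n. (Q n /\<^sub>R (- t n)) / (Q n /\<^sub>R (- t' n))) \<longlonglongrightarrow> (\<delta> * snd e) / (\<delta>' * 1)"
        by (rule tendsto_divide[OF lim1 lim2]) (use \<delta>' in simp)
      moreover have "\<forall>\<^sub>F n in sequentially. Q n /\<^sub>R (- t' n) \<noteq> 0"
        by (rule tendsto_imp_eventually_ne[OF lim2]) (use \<delta>' in simp)
      then have "\<forall>\<^sub>F n in sequentially. (Q n /\<^sub>R (- t n)) / (Q n /\<^sub>R (- t' n)) = t' n / t n"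
        by eventually_elim (use T(2) T'(2) in \<open>auto simp: field_simps\<close>)
      ultimately have "(\<lambda>n. t' n / t n) \<longlonglongrightarrow> (\<delta> * snd e) / (\<delta>' * 1)" by (rule Lim_transform_eventually)
      moreover have "d < a" using s(5)[of 0] s(3)[of 0] by (rule less_trans)
      then have "finite (I a \<inter> J a)" using IJ by blast
      ultimately have "(\<delta> * snd e) / (\<delta>' * 1) = 0" using windows_not_comparable[OF _ T(3,1) T'(3,1)] by blast
      then show False using e(2) e2 \<delta>'(1) by simp
    qed
  qed
qed

theorem theorem2p1:
  fixes r :: enat
  assumes "r \<ge> 1"
  shows "\<exists>\<S> :: (lpoint \<times> lpoint, real \<times> real) chart set set.
     \<S> \<approx> Pow (Field omega1) \<and>
     (\<forall>A\<in>\<S>. diff_structure r long_ray_sq A) \<and>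
     (\<forall>A\<in>\<S>. \<forall>B\<in>\<S>. A \<noteq> B \<longrightarrow> \<not> diffeomorphic r long_ray_sq A long_ray_sq B) \<and>
     (\<forall>A\<in>\<S>. \<forall>(D :: (lpoint, real) chart set) (E :: (lpoint, real) chart set).
        diff_structure r long_ray D \<and> diff_structure r long_ray E \<longrightarrow>
        \<not> diffeomorphic r long_ray_sq A long_ray_sq (prod_atlas D E))"
proof -
  have "\<exists>m. weight_family (subset_code A) m" for A
  proof -
    have inf: "infinite (subset_code A a)" for a unfolding subset_code_def by (rule infinite_code_set)
    show ?thesis
    proof (rule weights_exist[of "subset_code A", OF inf])
      fix m assume "\<And>a. weights (subset_code A) m a (m a)"
      then have "weight_family (subset_code A) m" unfolding weight_family_def by (rule allI)
      then show ?thesis by (intro exI[where x = m])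
    qed
  qed
  then have "\<exists>w. \<forall>A. weight_family (subset_code A) (w A)" by (intro choice allI)
  then obtain w where w: "\<And>A. weight_family (subset_code A) (w A)" by blast
  define M where "M A = twisted r (w A)" for A
  have nd: "\<not> diffeomorphic r long_ray_sq (M A) long_ray_sq (M B)"
    if AB: "A \<subseteq> Field omega1" "B \<subseteq> Field omega1" "A \<noteq> B" for A B
  proof -
    obtain d where "\<forall>a>d. finite (subset_code A a \<inter> subset_code B a)"
      using finite_subset_code_Int[OF AB] by blast
    then show ?thesis unfolding M_def by (rule twisted_not_diffeomorphic[OF assms w w])
  qed
  have ds: "diff_structure r long_ray_sq (M A)" for A
    unfolding M_def by (rule diff_structure_twisted[OF w])
  \<comment> \<open>Equal structures would be diffeomorphic by reflexivity, so distinct index sets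
    give distinct structures and the family has the full cardinality.\<close>
  have "inj_on M (Pow (Field omega1))"
  proof (rule inj_onI)
    fix A B assume AB: "A \<in> Pow (Field omega1)" "B \<in> Pow (Field omega1)" "M A = M B"
    show "A = B"
    proof (rule ccontr)
      assume "A \<noteq> B"
      then have "\<not> diffeomorphic r long_ray_sq (M A) long_ray_sq (M B)" using AB(1,2) by (intro nd) auto
      then show False unfolding AB(3) using diffeomorphic_refl[OF ds] by blast
    qed
  qed
  then have "M ` Pow (Field omega1) \<approx> Pow (Field omega1)" by (rule inj_on_image_eqpoll_self)
  moreover have "\<forall>X\<in>M ` Pow (Field omega1). \<forall>Y\<in>M ` Pow (Field omega1). X \<noteq> Y \<longrightarrow> \<not> diffeomorphic r long_ray_sq X long_ray_sq Y"
    using nd by blast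
  moreover have "\<forall>X\<in>M ` Pow (Field omega1). \<forall>(D :: (lpoint, real) chart set) (E :: (lpoint, real) chart set).
      diff_structure r long_ray D \<and> diff_structure r long_ray E \<longrightarrow>
      \<not> diffeomorphic r long_ray_sq X long_ray_sq (prod_atlas D E)"
  proof (intro ballI allI impI)
    fix X and D E :: "(lpoint, real) chart set"
    assume "X \<in> M ` Pow (Field omega1)" and DE: "diff_structure r long_ray D \<and> diff_structure r long_ray E"
    then obtain A where "X = M A" by blast
    then show "\<not> diffeomorphic r long_ray_sq X long_ray_sq (prod_atlas D E)"
      unfolding M_def using twisted_exotic[OF assms w conjunct1[OF DE] conjunct2[OF DE]] by simp
  qed
  moreover have "\<forall>X\<in>M ` Pow (Field omega1). diff_structure r long_ray_sq X" using ds by blast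
  ultimately show ?thesis by (intro exI[of _ "M ` Pow (Field omega1)"] conjI)
qed

end
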